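(* Let $B$ be a proper board of size $2n+1$. Then any two configurations of the same set of $n$ numbered (or colored) gourds on $B$ can be transformed into each other by a sequence of $O(n^3)$ moves.
   Context: A board is a finite, connected set of cells of the regular hexagonal tiling of the plane; two cells are adjacent if they share a side. The board graph $G_B$ has the cells as vertices, with edges between adjacent cells. A board is proper if all of the following hold: - it has $2n+1$ cells; - it is hole-free (the complement of the union of its cells is connected); - $G_B$ is 2-connected; - it is not the Star of David board: the 13-cell board consisting of a central cell, its 6 neighbors, and the 6 further cells each adjacent to two consecutive neighbors of the central cell. A gourd is a piece covering two adjacent cells; its two ends are distinguishable, carrying numbers or colors. A configuration is a placement of the $n$ gourds on pairwise disjoint pairs of adjacent cells, specifying which end lies on which cell, leaving one empty cell $e$. Suppose a gourd has ends $a$ on cell $p$ and $b$ on cell $q$. A move is one of: - Slide: $p,q,e$ are consecutive along a straight grid line. The gourd moves to $a$ on $q$, $b$ on $e$. - Turn: $q$ is adjacent to $p$ and $e$, with a $120^\circ$ angle at $q$. The gourd moves to $a$ on $q$, $b$ on $e$. - Pivot: $e$ is adjacent to both $p$ and $q$. One end stays fixed and the other moves to $e$. *)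

theory Defs
  imports "HOL-Analysis.Analysis" "HOL-Library.Multiset" "HOL-Library.Landau_Symbols"
begin

(* Hexagons have side length 1.  The cell (x, y) has centre sqrt 3 * (x + y * cis (pi / 3)), so
   neighbouring centres are at distance sqrt 3, twice the apothem (lemma adjacent_iff_dist). *)

type_synonym cell = "int \<times> int"

definition hex_centre :: "cell \<Rightarrow> complex" where
  "hex_centre c = of_real (sqrt 3) * (of_int (fst c) + of_int (snd c) * cis (pi / 3))"

definition hexagon :: "cell \<Rightarrow> complex set" where
  "hexagon c = convex hull ((\<lambda>k. hex_centre c + cis (pi / 6 + real k * (pi / 3))) ` {..<6})"

definition hex_directions :: "cell set" where
  "hex_directions = {(1, 0), (0, 1), (-1, 1), (-1, 0), (0, -1), (1, -1)}"

definition adjacent :: "cell \<Rightarrow> cell \<Rightarrow> bool" where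
  "adjacent c d \<longleftrightarrow> d - c \<in> hex_directions"

(* Counterclockwise rotation of an offset by 60 degrees (lemma hex_centre_rot60). *)
definition rot60 :: "cell \<Rightarrow> cell" where
  "rot60 d = (- snd d, fst d + snd d)"

lemma hex_centre_diff: "hex_centre (c - d) = hex_centre c - hex_centre d"
  by (simp add: hex_centre_def algebra_simps)

lemma hex_centre_rot60: "hex_centre (rot60 d) = cis (pi / 3) * hex_centre d"
  by (simp add: hex_centre_def rot60_def complex_eq_iff cos_60 sin_60 algebra_simps)

lemma norm_hex_centre:
  "(norm (hex_centre d))\<^sup>2 = of_int (3 * (fst d * fst d + fst d * snd d + snd d * snd d))"
proof -
  have "Re (hex_centre d) = sqrt 3 * (of_int (fst d) + of_int (snd d) / 2)"
    by (simp add: hex_centre_def cos_60)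
  moreover have "Im (hex_centre d) = of_int (snd d) * 3 / 2"
    by (simp add: hex_centre_def sin_60)
  ultimately show ?thesis
    by (simp only: cmod_power2 power_mult_distrib) (simp add: power2_eq_square field_simps)
qed

lemma hex_directions_iff:
  "d \<in> hex_directions \<longleftrightarrow> fst d * fst d + fst d * snd d + snd d * snd d = 1"
proof
  assume h: "fst d * fst d + fst d * snd d + snd d * snd d = 1"
  obtain x y where d: "d = (x, y)" by (cases d)
  have e: "x * x + x * y + y * y = 1" using h d by simp
  have "3 * (x * x) + (x + 2 * y) * (x + 2 * y) = 4" using e by (simp add: algebra_simps)
  moreover have "(x + 2 * y) * (x + 2 * y) \<ge> 0" by simp
  ultimately have "x * x \<le> 1" by linarith
  then have x: "\<bar>x\<bar> \<le> 1" using abs_le_square_iff[of x 1] by (simp add: power2_eq_square)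
  have "3 * (y * y) + (2 * x + y) * (2 * x + y) = 4" using e by (simp add: algebra_simps)
  moreover have "(2 * x + y) * (2 * x + y) \<ge> 0" by simp
  ultimately have "y * y \<le> 1" by linarith
  then have y: "\<bar>y\<bar> \<le> 1" using abs_le_square_iff[of y 1] by (simp add: power2_eq_square)
  have "x = -1 \<or> x = 0 \<or> x = 1" "y = -1 \<or> y = 0 \<or> y = 1" using x y by auto
  then show "d \<in> hex_directions" using e d by (auto simp: hex_directions_def)
qed (auto simp: hex_directions_def)

lemma adjacent_iff_dist: "adjacent c d \<longleftrightarrow> dist (hex_centre c) (hex_centre d) = sqrt 3"
proof -
  define N where "N = (let v = d - c in fst v * fst v + fst v * snd v + snd v * snd v)"
  have "(dist (hex_centre c) (hex_centre d))\<^sup>2 = of_int (3 * N)"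
    using norm_hex_centre[of "d - c"]
    by (simp add: dist_norm norm_minus_commute hex_centre_diff N_def Let_def)
  moreover have "dist (hex_centre c) (hex_centre d) = sqrt 3 \<longleftrightarrow>
      (dist (hex_centre c) (hex_centre d))\<^sup>2 = 3"
    by (metis real_sqrt_pow2 real_sqrt_unique zero_le_dist zero_le_numeral)
  ultimately have "dist (hex_centre c) (hex_centre d) = sqrt 3 \<longleftrightarrow> N = 1"
    by simp
  then show ?thesis
    by (simp add: adjacent_def hex_directions_iff N_def Let_def)
qed

(* Graphs are given by a vertex set and a symmetric edge relation. *)

definition graph_connected :: "'a set \<Rightarrow> ('a \<Rightarrow> 'a \<Rightarrow> bool) \<Rightarrow> bool" where
  "graph_connected V E \<longleftrightarrow> (\<forall>u\<in>V. \<forall>v\<in>V. (\<lambda>x y. x \<in> V \<and> y \<in> V \<and> E x y)\<^sup>*\<^sup>* u v)"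

definition two_connected :: "'a set \<Rightarrow> ('a \<Rightarrow> 'a \<Rightarrow> bool) \<Rightarrow> bool" where
  "two_connected V E \<longleftrightarrow>
     card V > 2 \<and> graph_connected V E \<and> (\<forall>v\<in>V. graph_connected (V - {v}) E)"

definition board :: "cell set \<Rightarrow> bool" where
  "board B \<longleftrightarrow> finite B \<and> graph_connected B adjacent"

definition hole_free :: "cell set \<Rightarrow> bool" where
  "hole_free B \<longleftrightarrow> connected (- (\<Union>c\<in>B. hexagon c))"

(* The last set also contains the centre c, and apart from it exactly the six tips. *)
definition star_of_david :: "cell \<Rightarrow> cell set" where
  "star_of_david c = {c} \<union> {a. adjacent c a} \<union>
     {d. \<exists>a b. adjacent c a \<and> adjacent c b \<and> adjacent a b \<and> adjacent d a \<and> adjacent d b}"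

(* Congruent copies of the star differ by a translation only. *)
definition proper_board :: "nat \<Rightarrow> cell set \<Rightarrow> bool" where
  "proper_board n B \<longleftrightarrow>
     board B \<and> card B = 2 * n + 1 \<and> hole_free B \<and> two_connected B adjacent \<and>
     (\<forall>c. B \<noteq> star_of_david c)"

lemma star_of_david_eq:
  "star_of_david c = insert c ((+) c ` hex_directions \<union> (\<lambda>u. c + (u + rot60 u)) ` hex_directions)"
proof (intro equalityI subsetI)
  have up: "\<forall>u\<in>hex_directions. \<forall>v\<in>hex_directions.
      v - u \<in> hex_directions \<longrightarrow> v = rot60 u \<or> u = rot60 v"
    by (simp add: hex_directions_def rot60_def prod_eq_iff)
  have down: "\<forall>u\<in>hex_directions. \<forall>w\<in>hex_directions.
      rot60 u - u + w \<in> hex_directions \<longrightarrow> w = u \<or> w = - rot60 u"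
    by (simp add: hex_directions_def rot60_def prod_eq_iff)
  have tip: "t = 0 \<or> t = u + rot60 u"
    if u: "u \<in> hex_directions" and ut: "u - t \<in> hex_directions"
      and vt: "rot60 u - t \<in> hex_directions" for u t
  proof -
    have "rot60 u - u + (u - t) \<in> hex_directions" using vt by simp
    with u ut down have "u - t = u \<or> u - t = - rot60 u" by blast
    then show ?thesis by (auto simp: algebra_simps)
  qed
  fix x assume x: "x \<in> star_of_david c"
  then consider "x = c" | "x - c \<in> hex_directions"
    | a b where "a - c \<in> hex_directions" "b - c \<in> hex_directions" "b - a \<in> hex_directions"
        "a - x \<in> hex_directions" "b - x \<in> hex_directions"
    unfolding star_of_david_def adjacent_def by blast
  then have "x - c = 0 \<or> x - c \<in> hex_directions \<or> (\<exists>u\<in>hex_directions. x - c = u + rot60 u)"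
  proof cases
    case 3
    have "(b - c) - (a - c) \<in> hex_directions" "(a - c) - (x - c) \<in> hex_directions"
        "(b - c) - (x - c) \<in> hex_directions" using 3 by simp_all
    moreover from this(1) up 3(1,2) have "b - c = rot60 (a - c) \<or> a - c = rot60 (b - c)" by blast
    ultimately show ?thesis
      using 3(1,2) tip[of "a - c" "x - c"] tip[of "b - c" "x - c"] by fastforce
  qed simp_all
  then consider "x = c" | "x - c \<in> hex_directions"
    | u where "u \<in> hex_directions" "x - c = u + rot60 u" by auto
  then show
    "x \<in> insert c ((+) c ` hex_directions \<union> (\<lambda>u. c + (u + rot60 u)) ` hex_directions)"
  proof cases
    case 2
    from imageI[OF this, of "(+) c"] show ?thesis by simp
  next
    case 3
    from 3(2) have "x = c + (u + rot60 u)" by (metis add.commute diff_add_cancel)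
    with 3(1) show ?thesis by blast
  qed simp
next
  have rot: "\<forall>u\<in>hex_directions.
      rot60 u \<in> hex_directions \<and> rot60 u - u \<in> hex_directions \<and> - u \<in> hex_directions"
    by (simp add: hex_directions_def rot60_def prod_eq_iff)
  fix x
  assume "x \<in> insert c ((+) c ` hex_directions \<union> (\<lambda>u. c + (u + rot60 u)) ` hex_directions)"
  then consider "x = c" | u where "u \<in> hex_directions" "x = c + u"
    | u where "u \<in> hex_directions" "x = c + (u + rot60 u)" by blast
  then show "x \<in> star_of_david c"
  proof cases
    case 3
    then have "rot60 u \<in> hex_directions" "rot60 u - u \<in> hex_directions"
        "- u \<in> hex_directions" "- rot60 u \<in> hex_directions"
      using rot by blast+
    with 3 have "adjacent c (c + u)" "adjacent c (c + rot60 u)" "adjacent (c + u) (c + rot60 u)"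
        "adjacent x (c + u)" "adjacent x (c + rot60 u)"
      by (simp_all add: adjacent_def)
    then show ?thesis unfolding star_of_david_def by blast
  qed (simp_all add: star_of_david_def adjacent_def)
qed

lemma card_star_of_david: "card (star_of_david c) = 13"
proof -
  have "star_of_david c = (+) c ` insert 0 (hex_directions \<union> (\<lambda>u. u + rot60 u) ` hex_directions)"
    by (simp add: star_of_david_eq image_Un image_image)
  moreover have "inj_on ((+) c) S" for S by (rule inj_onI) simp
  ultimately show ?thesis
    by (simp add: card_image hex_directions_def rot60_def prod_eq_iff)
qed

(* A placed gourd with end a on p and end b on q is the set {(p, a), (q, b)}; the two ends have no
   order.  Labels are arbitrary: numbered gourds are those with all labels different, for coloured
   gourds labels may repeat. *)

type_synonym 'l configuration = "(cell \<times> 'l) set set"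

definition occupied :: "'l configuration \<Rightarrow> cell set" where
  "occupied C = fst ` \<Union> C"

definition is_configuration :: "nat \<Rightarrow> cell set \<Rightarrow> 'l configuration \<Rightarrow> bool" where
  "is_configuration n B C \<longleftrightarrow>
     finite C \<and> card C = n \<and>
     (\<forall>g\<in>C. \<exists>p q a b. p \<in> B \<and> q \<in> B \<and> adjacent p q \<and> g = {(p, a), (q, b)}) \<and>
     (\<forall>g\<in>C. \<forall>h\<in>C. g \<noteq> h \<longrightarrow> fst ` g \<inter> fst ` h = {})"

(* The set of gourds being used, as a multiset because coloured gourds may coincide: the gourd
   with end labels a and b is the multiset {#a, b#}. *)
definition gourds :: "'l configuration \<Rightarrow> 'l multiset multiset" where
  "gourds C = image_mset (\<lambda>g. image_mset snd (mset_set g)) (mset_set C)"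

definition straight :: "cell \<Rightarrow> cell \<Rightarrow> cell \<Rightarrow> bool" where
  "straight p q e \<longleftrightarrow> adjacent p q \<and> e - q = q - p"

definition angle120 :: "cell \<Rightarrow> cell \<Rightarrow> cell \<Rightarrow> bool" where
  "angle120 p q e \<longleftrightarrow> adjacent q p \<and> adjacent q e \<and>
     (e - q = rot60 (rot60 (p - q)) \<or> p - q = rot60 (rot60 (e - q)))"

(* Since {(p, a), (q, b)} = {(q, b), (p, a)}, each rule applies with either end as the one on p. *)
inductive move :: "cell set \<Rightarrow> 'l configuration \<Rightarrow> 'l configuration \<Rightarrow> bool"
  for B :: "cell set" where
  slide: "move B C (insert {(q, a), (e, b)} (C - {{(p, a), (q, b)}}))"
    if "{(p, a), (q, b)} \<in> C" "e \<in> B - occupied C" "straight p q e"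
| turn: "move B C (insert {(q, a), (e, b)} (C - {{(p, a), (q, b)}}))"
    if "{(p, a), (q, b)} \<in> C" "e \<in> B - occupied C" "angle120 p q e"
| pivot: "move B C (insert {(p, a), (e, b)} (C - {{(p, a), (q, b)}}))"
    if "{(p, a), (q, b)} \<in> C" "e \<in> B - occupied C" "adjacent e p" "adjacent e q"

end

(*
  A hole-free 2-connected board is locally connected: its cells, seen as a flag complex, have
  vanishing first cohomology modulo 2, so a cell whose neighbours on the board form a disconnected
  graph would be a cut vertex.  In a connected and locally connected board, a set of unit triangles
  forming a polygon whose boundary passes through all covered cells can be enlarged cell by cell
  until it covers everything, except on the Star of David.  The result is a Hamiltonian cycle that
  bounds a triangulated polygon.

  The hole can run around this cycle, which rotates the gourds along it; any configuration becomes
  aligned with the cycle on the way.  Near an ear of the triangulation a gourd can be reversed and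
  can be carried past its successor.  This gives an insertion sort with O(n^2) steps, each of which
  takes O(n) moves.
*)

theory Submission
  imports Defs
begin

section \<open>Moves along a path\<close>

text \<open>A Hamiltonian cycle alone is not enough: with all moves confined to it, the cyclic order
  of the gourds never changes. The triangles supply the extra adjacencies: a polygon on k cells has
  k - 2 triangles but k boundary edges, so an ear always exists. Polygons are purely combinatorial
  here; a boundary counted modulo 2 that is one cycle through all cells, together with the number of
  triangles, replaces planar topology. The obstacle in growing a polygon is an uncovered cell w next
  to two adjacent covered cells c, x such that {c, x} is not a boundary edge. In a polygon with the
  most cells, moving one vertex of the cycle elsewhere keeps the set of covered cells, so no chain
  of such relocations may bring {c, x} to the boundary. Each relocation that must fail says which
  triangles are present; if all fail, the covered cells are a Star of David without the tip w. The
  star is a true exception: its tips have two neighbours each, so a Hamiltonian cycle would contain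
  the 12-cycle around the centre and miss the centre.\<close>

definition reach :: "cell set \<Rightarrow> nat \<Rightarrow> 'l configuration \<Rightarrow> 'l configuration \<Rightarrow> bool" where
  "reach B k C D \<longleftrightarrow> (\<exists>j\<le>k. (move B ^^ j) C D)"

lemma reach_refl [simp]: "reach B k C C"
  unfolding reach_def by (rule exI[of _ 0]) auto

lemma reach_mono: "reach B j C D \<Longrightarrow> j \<le> k \<Longrightarrow> reach B k C D"
  unfolding reach_def by (meson le_trans)

lemma reach_move: "move B C D \<Longrightarrow> reach B 1 C D"
  unfolding reach_def by (rule exI[of _ 1]) auto

lemma reach_trans:
  assumes "reach B j C D" "reach B k D E"
  shows "reach B (j + k) C E"
proof -
  from assms obtain j' k' where *: "j' \<le> j" "(move B ^^ j') C D" "k' \<le> k" "(move B ^^ k') D E"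
    unfolding reach_def by blast
  then have "(move B ^^ (j' + k')) C E" by (auto simp: relpowp_add)
  with * show ?thesis unfolding reach_def by (meson add_mono)
qed

lemma uminus_hex_directions: "d \<in> hex_directions \<Longrightarrow> - d \<in> hex_directions"
  by (simp add: hex_directions_iff)

lemma adjacent_sym: "adjacent c d \<Longrightarrow> adjacent d c"
  unfolding adjacent_def using uminus_hex_directions[of "d - c"] by simp

lemma adjacent_irrefl [simp]: "\<not> adjacent c c"
  by (auto simp: adjacent_def hex_directions_def zero_prod_def)

lemma adjacent_neq: "adjacent c d \<Longrightarrow> c \<noteq> d"
  by auto

lemma adjacent_plus: "adjacent (i, j) (k, l) \<longleftrightarrow> (k - i, l - j) \<in> hex_directions"
  by (simp add: adjacent_def)

text \<open>Two different neighbours of a cell subtend 60, 180 or 120 degrees there. The three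
  outcomes are the situations of a pivot, a slide and a turn.\<close>

lemma angle_cases:
  assumes "adjacent y x" "adjacent x e" "y \<noteq> e"
  shows "adjacent e y \<or> straight y x e \<or> angle120 y x e"
proof -
  have *: "\<forall>u\<in>hex_directions. \<forall>v\<in>hex_directions.
      u = v \<or> v = - u \<or> u - v \<in> hex_directions \<or> v = rot60 (rot60 u) \<or> u = rot60 (rot60 v)"
    by (simp add: hex_directions_def rot60_def prod_eq_iff)
  define u v where "u = y - x" and "v = e - x"
  have uv: "u \<in> hex_directions" "v \<in> hex_directions"
    using assms adjacent_sym unfolding adjacent_def u_def v_def by blast+
  have "u \<noteq> v" using assms(3) by (auto simp: u_def v_def)
  with bspec[OF bspec[OF * uv(1)] uv(2)]
  consider "v = - u" | "u - v \<in> hex_directions" | "v = rot60 (rot60 u) \<or> u = rot60 (rot60 v)" by blast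
  then show ?thesis
  proof cases
    case 1
    then have "e - x = x - y" by (simp add: u_def v_def)
    then show ?thesis using assms by (simp add: straight_def)
  next
    case 2
    then show ?thesis by (simp add: adjacent_def u_def v_def)
  next
    case 3
    then show ?thesis using assms adjacent_sym by (auto simp: angle120_def u_def v_def)
  qed
qed

lemma occupied_insert [simp]:
  "occupied (insert {(p, a), (q, b)} F) = insert p (insert q (occupied F))"
  by (auto simp: occupied_def)

lemma occupied_empty [simp]: "occupied {} = {}"
  by (simp add: occupied_def)

lemma occupied_Un [simp]: "occupied (F \<union> G) = occupied F \<union> occupied G"
  by (auto simp: occupied_def)

lemma not_mem_if_not_occupied: "p \<notin> occupied F \<Longrightarrow> {(p, a), (q, b)} \<notin> F"
  unfolding occupied_def by (metis UnionI fst_conv image_eqI insertI1)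

text \<open>Frame form of the rules, with \<open>F\<close> as the rest of the configuration. Since
  \<open>p\<close> is free in \<open>F\<close>, the old gourd is not a member of \<open>F\<close>,
  and removing it leaves exactly \<open>F\<close>.\<close>

lemma move_insertI:
  assumes "move B (insert {(p, a), (q, b)} F)
      (insert h (insert {(p, a), (q, b)} F - {{(p, a), (q, b)}}))"
    and "p \<notin> occupied F"
  shows "move B (insert {(p, a), (q, b)} F) (insert h F)"
  using assms not_mem_if_not_occupied[OF assms(2)] by simp

lemma move_pivot:
  assumes "e \<in> B" "e \<notin> occupied F" "p \<notin> occupied F" "q \<notin> occupied F" "e \<noteq> p" "e \<noteq> q"
    "adjacent e p" "adjacent e q"
  shows "move B (insert {(p, a), (q, b)} F) (insert {(p, a), (e, b)} F)"
  by (rule move_insertI[OF move.pivot]) (use assms in auto)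

text \<open>One step of a gourd along the path y, x, e, whatever the angle at \<open>x\<close>. At
  60 degrees neither a slide nor a turn is available, but two pivots have the same effect; hence the
  bound 2.\<close>

lemma reach_shift:
  assumes "e \<in> B" "x \<in> B" "y \<in> B" "e \<notin> occupied F" "x \<notin> occupied F" "y \<notin> occupied F"
    "y \<noteq> e" "adjacent e x" "adjacent x y"
  shows "reach B 2 (insert {(x, a), (y, b)} F) (insert {(e, a), (x, b)} F)"
proof -
  have ne: "x \<noteq> e" "x \<noteq> y" using assms by auto
  have "adjacent y x" "adjacent x e" using assms adjacent_sym by blast+
  with angle_cases[OF this assms(7)]
  consider "adjacent e y" | "straight y x e" | "angle120 y x e" by blast
  then show ?thesis
  proof cases
    case 1
    have "move B (insert {(y, b), (x, a)} F) (insert {(y, b), (e, a)} F)"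
      by (rule move_pivot) (use assms ne 1 in auto)
    moreover have "move B (insert {(e, a), (y, b)} F) (insert {(e, a), (x, b)} F)"
      by (rule move_pivot) (use assms ne \<open>adjacent x e\<close> in auto)
    ultimately have "reach B (1 + 1) (insert {(x, a), (y, b)} F) (insert {(e, a), (x, b)} F)"
      by (intro reach_trans reach_move) (auto simp: insert_commute)
    then show ?thesis by (simp add: numeral_2_eq_2)
  next
    case 2
    have "move B (insert {(y, b), (x, a)} F) (insert {(x, b), (e, a)} F)"
      by (rule move_insertI[OF move.slide]) (use assms ne 2 in auto)
    from reach_move[OF this] show ?thesis
      by (rule_tac reach_mono[of _ 1]) (auto simp: insert_commute)
  next
    case 3
    have "move B (insert {(y, b), (x, a)} F) (insert {(x, b), (e, a)} F)"
      by (rule move_insertI[OF move.turn]) (use assms ne 3 in auto)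
    from reach_move[OF this] show ?thesis
      by (rule_tac reach_mono[of _ 1]) (auto simp: insert_commute)
  qed
qed

text \<open>Three pivots take the ends around the triangle; the hole is back at \<open>e\<close> and
  the gourd is reversed.\<close>

lemma reach_flip:
  assumes "e \<in> B" "x \<in> B" "y \<in> B" "e \<notin> occupied F" "x \<notin> occupied F" "y \<notin> occupied F"
    "adjacent e x" "adjacent x y" "adjacent e y"
  shows "reach B 3 (insert {(x, a), (y, b)} F) (insert {(x, b), (y, a)} F)"
proof -
  have ne: "x \<noteq> e" "x \<noteq> y" "e \<noteq> y" using assms by auto
  have adj: "adjacent y x" "adjacent x e" "adjacent y e" using assms adjacent_sym by blast+
  have "move B (insert {(y, b), (x, a)} F) (insert {(y, b), (e, a)} F)"
    by (rule move_pivot) (use assms ne in auto)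
  moreover have "move B (insert {(e, a), (y, b)} F) (insert {(e, a), (x, b)} F)"
    by (rule move_pivot) (use assms ne adj in auto)
  moreover have "move B (insert {(x, b), (e, a)} F) (insert {(x, b), (y, a)} F)"
    by (rule move_pivot) (use assms ne adj in auto)
  ultimately have "reach B (1 + (1 + 1)) (insert {(x, a), (y, b)} F) (insert {(x, b), (y, a)} F)"
    by (intro reach_trans reach_move) (auto simp: insert_commute)
  then show ?thesis by (simp add: numeral_3_eq_3)
qed

text \<open>Surplus cells or labels are silently dropped, so the lemmas ask for exactly twice as
  many cells as gourds.\<close>

fun place :: "cell list \<Rightarrow> ('l \<times> 'l) list \<Rightarrow> 'l configuration" where
  "place (x # y # xs) ((a, b) # ls) = insert {(x, a), (y, b)} (place xs ls)"
| "place xs ls = {}"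

lemma place_append:
  "length xs = 2 * length ls \<Longrightarrow> place (xs @ ys) (ls @ ms) = place xs ls \<union> place ys ms"
  by (induction xs ls rule: place.induct) auto

lemma occupied_place [simp]:
  "length xs = 2 * length ls \<Longrightarrow> occupied (place xs ls) = set xs"
proof (induction xs ls rule: place.induct)
  case ("2_1" ls) then show ?case by simp
next
  case ("2_3" xs) then show ?case by simp
qed auto

text \<open>After the shift the hole is at \<open>y\<close>, and the cycle read from there continues
  with \<open>xs @ [e, x]\<close>: the hole has advanced by two cells and the cyclic list of gourds
  by one.\<close>

lemma reach_hop:
  assumes "distinct (e # x # y # xs)" "set (e # x # y # xs) \<subseteq> B"
    "occupied F \<inter> set (e # x # y # xs) = {}" "length xs = 2 * length ls"
    "adjacent e x" "adjacent x y"
  shows "reach B 2 (F \<union> place (x # y # xs) ((a, b) # ls)) (F \<union> place (xs @ [e, x]) (ls @ [(a, b)]))"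
proof -
  have "reach B 2 (insert {(x, a), (y, b)} (F \<union> place xs ls)) (insert {(e, a), (x, b)} (F \<union> place xs ls))"
    by (rule reach_shift) (use assms in auto)
  then show ?thesis using assms(4) by (simp add: place_append)
qed

section \<open>Rotation along a cycle and sorting\<close>

fun pedges :: "'a list \<Rightarrow> 'a set set" where
  "pedges (x # y # xs) = insert {x, y} (pedges (y # xs))"
| "pedges xs = {}"

definition cedges :: "'a list \<Rightarrow> 'a set set" where
  "cedges vs = (case vs of [] \<Rightarrow> {} | v # _ \<Rightarrow> pedges (vs @ [v]))"

lemma cedges_Cons: "cedges (v # vs) = pedges (v # vs @ [v])"
  by (simp add: cedges_def)

lemma cedges_Nil [simp]: "cedges [] = {}"
  by (simp add: cedges_def)

lemma pedges_append: "pedges (xs @ y # zs) = pedges (xs @ [y]) \<union> pedges (y # zs)"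
  by (induction xs rule: pedges.induct) auto

lemma pedges_rev: "pedges (rev xs) = pedges xs"
proof (induction xs rule: pedges.induct)
  case (1 x y xs)
  have "pedges (rev (x # y # xs)) = pedges (rev xs @ y # [x])" by simp
  also have "\<dots> = pedges (rev xs @ [y]) \<union> {{y, x}}" by (subst pedges_append) simp
  also have "\<dots> = pedges (x # y # xs)" using 1 by (auto simp: insert_commute)
  finally show ?case .
qed auto

lemma cedges_append: "cedges (xs @ ys) = cedges (ys @ xs)"
proof (cases xs; cases ys)
  fix x xs' y ys' assume [simp]: "xs = x # xs'" "ys = y # ys'"
  have "cedges (xs @ ys) = pedges ((x # xs') @ y # (ys' @ [x]))" by (simp add: cedges_Cons)
  also have "\<dots> = pedges (x # xs' @ [y]) \<union> pedges (y # ys' @ [x])" by (subst pedges_append) simp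
  finally have 1: "cedges (xs @ ys) = \<dots>" .
  have "cedges (ys @ xs) = pedges ((y # ys') @ x # (xs' @ [y]))" by (simp add: cedges_Cons)
  also have "\<dots> = pedges (y # ys' @ [x]) \<union> pedges (x # xs' @ [y])" by (subst pedges_append) simp
  finally show ?thesis using 1 by auto
qed auto

lemma cedges_rotate [simp]: "cedges (rotate k vs) = cedges vs"
  by (metis append_take_drop_id cedges_append rotate_drop_take)

lemma cedges_rev: "cedges (rev vs) = cedges vs"
proof (cases vs)
  case (Cons v vs')
  have "cedges (rev vs) = cedges (v # rev vs')" using Cons cedges_append[of "rev vs'" "[v]"] by simp
  also have "\<dots> = pedges (rev (v # vs' @ [v]))" by (simp add: cedges_Cons)
  also have "\<dots> = cedges vs" unfolding pedges_rev using Cons by (simp add: cedges_Cons)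
  finally show ?thesis .
qed simp

lemma pedges_split: "{x, y} \<in> pedges zs \<Longrightarrow> \<exists>us ws. zs = us @ x # y # ws \<or> zs = us @ y # x # ws"
proof (induction zs rule: pedges.induct)
  case (1 a b xs)
  then consider "{x, y} = {a, b}" | "{x, y} \<in> pedges (b # xs)" by auto
  then show ?case
  proof cases
    case 1
    then show ?thesis by (metis append_Nil doubleton_eq_iff)
  next
    case 2
    with "1.IH" show ?thesis by (metis append_Cons)
  qed
qed auto

lemma pedges_subset: "e \<in> pedges zs \<Longrightarrow> e \<subseteq> set zs"
  by (induction zs rule: pedges.induct) auto

lemma cedges_subset: "e \<in> cedges vs \<Longrightarrow> e \<subseteq> set vs"
  by (cases vs) (auto simp: cedges_Cons dest!: pedges_subset)

lemma cedges_Cons_Cons: "cedges (a # b # rest) = insert {a, b} (pedges (b # rest @ [a]))"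
  by (simp add: cedges_Cons)

lemma pedges_subset_append: "pedges xs \<subseteq> pedges (xs @ ys)"
  by (induction xs rule: pedges.induct) auto

lemma pedges_subset_cedges: "pedges vs \<subseteq> cedges vs"
  by (cases vs) (simp_all only: cedges_Cons cedges_Nil pedges.simps, metis append_Cons pedges_subset_append)

text \<open>Rotation and reversal keep the edge set, so any edge can be brought to the front in
  either direction. This is how arguments about edge sets get hold of a suitable list.\<close>

lemma cedges_normal_form:
  assumes "{x, y} \<in> cedges vs" "distinct vs" "x \<noteq> y"
  shows "\<exists>rest. distinct (x # y # rest) \<and> set (x # y # rest) = set vs \<and>
    cedges (x # y # rest) = cedges vs"
proof -
  obtain v vs' where vs: "vs = v # vs'" using assms by (cases vs) auto
  define P where "P = (\<lambda>ws. distinct ws \<and> set ws = set vs \<and> cedges ws = cedges vs)"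
  have rot: "P (ws @ us)" if "P (us @ ws)" for us ws
    using that cedges_append[of us ws] unfolding P_def by auto
  have rv: "P (rev ws)" if "P ws" for ws
    using that cedges_rev[of ws] unfolding P_def by auto
  have P0: "P vs" using assms by (simp add: P_def)
  have *: "\<exists>rest. P (x # y # rest)" if "vs @ [v] = us @ x # y # ws" "x \<noteq> y" for us x y ws
  proof (cases ws rule: rev_cases)
    \<comment> \<open>Here the edge is the closing one, from the last vertex back to
      \<open>v\<close>.\<close>
    case Nil
    then have *: "vs = us @ [x]" "y = v" using that by auto
    with vs \<open>x \<noteq> y\<close> obtain us' where "us = y # us'" by (cases us) auto
    with * rot[of "us" "[x]"] P0 show ?thesis by auto
  next
    case (snoc ws' z)
    then have "vs = us @ x # y # ws'" using that by auto
    then have "P ((x # y # ws') @ us)" using rot P0 by metis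
    then show ?thesis by auto
  qed
  have "{x, y} \<in> pedges (vs @ [v])" using assms(1) vs by (simp add: cedges_Cons)
  from pedges_split[OF this] obtain us ws
    where "vs @ [v] = us @ x # y # ws \<or> vs @ [v] = us @ y # x # ws" by blast
  then have "\<exists>rest. P (x # y # rest)"
  proof
    assume "vs @ [v] = us @ y # x # ws"
    from *[OF this] assms(3) obtain rest where "P (y # x # rest)" by blast
    from rot[of "rev rest" "[x, y]"] rv[OF this] show ?thesis by auto
  qed (use * assms(3) in blast)
  then show ?thesis by (simp only: P_def)
qed

lemma cedges_neighbours:
  assumes "distinct (a # m # b # rest)"
  shows "{m, z} \<in> cedges (a # m # b # rest) \<longleftrightarrow> z = a \<or> z = b"
proof -
  have "{m, z} \<notin> pedges (b # rest @ [a])"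
    using pedges_subset[of "{m, z}" "b # rest @ [a]"] assms by auto
  then show ?thesis using assms by (auto simp: cedges_Cons doubleton_eq_iff)
qed

definition adj_cycle :: "cell list \<Rightarrow> bool" where
  "adj_cycle vs \<longleftrightarrow> distinct vs \<and> (\<forall>x y. {x, y} \<in> cedges vs \<longrightarrow> adjacent x y)"

lemma adj_cycleD: "adj_cycle vs \<Longrightarrow> {x, y} \<in> cedges vs \<Longrightarrow> adjacent x y"
  unfolding adj_cycle_def by blast

lemma adj_cycle_rotate: "adj_cycle vs \<Longrightarrow> adj_cycle (rotate k vs)"
  by (simp add: adj_cycle_def)

lemma reach_hops:
  assumes "adj_cycle vs" "set vs \<subseteq> B" "occupied F \<inter> set vs = {}" "length vs = 2 * length ls + 1"
  shows "reach B (2 * k) (F \<union> place (tl vs) ls) (F \<union> place (tl (rotate (2 * k) vs)) (rotate k ls))"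
proof (induction k)
  case (Suc k)
  define vs' ls' where "vs' = rotate (2 * k) vs" and "ls' = rotate k ls"
  have vs': "adj_cycle vs'" "set vs' \<subseteq> B" "occupied F \<inter> set vs' = {}" "length vs' = 2 * length ls' + 1"
    using assms by (auto simp: vs'_def ls'_def adj_cycle_rotate)
  have "reach B 2 (F \<union> place (tl vs') ls') (F \<union> place (tl (rotate 2 vs')) (rotate 1 ls'))"
  proof (cases ls')
    case Nil
    with vs'(4) obtain e where "vs' = [e]" by (cases vs') auto
    with Nil show ?thesis by simp
  next
    case (Cons ab ls'')
    obtain a b where ab: "ab = (a, b)" by (cases ab)
    obtain e x y xs where v: "vs' = e # x # y # xs"
      using vs'(4) Cons by (auto simp: length_Suc_conv)
    have "{e, x} \<in> cedges vs'" "{x, y} \<in> cedges vs'" by (auto simp: v cedges_Cons)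
    then have "adjacent e x" "adjacent x y" using adj_cycleD[OF vs'(1)] by blast+
    with reach_hop[of e x y xs B F ls'' a b] vs' show ?thesis
      by (simp add: v Cons ab adj_cycle_def numeral_2_eq_2)
  qed
  then have "reach B 2 (F \<union> place (tl vs') ls')
      (F \<union> place (tl (rotate (2 * Suc k) vs)) (rotate (Suc k) ls))"
    by (simp add: vs'_def ls'_def rotate_rotate)
  with Suc have "reach B (2 * k + 2) (F \<union> place (tl vs) ls)
      (F \<union> place (tl (rotate (2 * Suc k) vs)) (rotate (Suc k) ls))"
    using reach_trans unfolding vs'_def ls'_def by blast
  then show ?case by simp
qed simp

text \<open>Each hop moves the hole by two cells of an odd cycle, so \<open>length vs\<close> hops
  carry it twice around and back to its place. The n gourds have then been rotated 2n + 1 times,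
  which is once modulo n.\<close>

lemma reach_rotate1:
  assumes "adj_cycle vs" "set vs \<subseteq> B" "occupied F \<inter> set vs = {}" "length vs = 2 * length ls + 1"
  shows "reach B (2 * length vs) (F \<union> place (tl vs) ls) (F \<union> place (tl vs) (rotate1 ls))"
proof -
  have "rotate (2 * length vs) vs = vs" by (simp add: rotate_id)
  moreover have "rotate (length vs) ls = rotate1 ls"
  proof (cases "length ls = 0")
    case False
    have "rotate (length vs) ls = rotate (length vs mod length ls) ls" by (simp add: rotate_conv_mod[symmetric])
    also have "length vs mod length ls = 1 mod length ls"
      by (simp only: assms(4) mod_mult_self3)
    also have "rotate (1 mod length ls) ls = rotate1 ls" by (simp add: rotate_conv_mod[symmetric])
    finally show ?thesis .
  qed auto
  ultimately show ?thesis using reach_hops[OF assms, of "length vs"] by simp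
qed

lemma reach_unrotate:
  assumes "adj_cycle vs" "set vs \<subseteq> B" "length vs = 2 * length ls + 1"
  shows "\<exists>k. reach B (2 * length vs) (place (tl (rotate i vs)) ls) (place (tl vs) (rotate k ls))"
proof -
  define N j where "N = length vs" and "j = i mod N"
  have N: "odd N" "j < N" using assms(3) by (auto simp: N_def j_def)
  \<comment> \<open>The number of hops must satisfy 2k + j = 0 modulo \<open>N\<close>. As
    \<open>N\<close> is odd, exactly one of \<open>N - j\<close> and \<open>2 * N - j\<close> is
    even, and half of it will do.\<close>
  define k where "k = (if even (N - j) then (N - j) div 2 else (2 * N - j) div 2)"
  have "k \<le> N" using N by (auto simp: k_def)
  have "2 * k + j = N \<or> 2 * k + j = 2 * N"
  proof (cases "even (N - j)")
    case False
    then have "even (2 * N - j)" using N by auto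
    then show ?thesis using False N by (auto simp: k_def)
  qed (use N in \<open>auto simp: k_def\<close>)
  then have "(2 * k + i) mod N = 0" unfolding j_def
    by (metis mod_add_right_eq mod_mult_self2_is_0 mod_self mult.commute)
  then have "rotate (2 * k) (rotate i vs) = vs" by (simp add: rotate_rotate rotate_id N_def)
  with reach_hops[of "rotate i vs" B "{}" ls k] assms
  have "reach B (2 * k) (place (tl (rotate i vs)) ls) (place (tl vs) (rotate k ls))"
    by (simp add: adj_cycle_rotate)
  with \<open>k \<le> N\<close> show ?thesis unfolding N_def by (meson reach_mono mult_le_mono2)
qed

text \<open>In the first case a gourd is parked on \<open>p, q\<close> while the others rotate along the odd cycle
  \<open>u # r # rest\<close>; in the second one two gourds are exchanged by rotating them along the 5-cycle
  \<open>u, p, q, r, s\<close>.\<close>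

definition gadget_cycle :: "cell list \<Rightarrow> bool" where
  "gadget_cycle vs \<longleftrightarrow> adj_cycle vs \<and> (\<exists>u p q rest. vs = u # p # q # rest \<and> adjacent u q \<and>
     (rest = [] \<or> adjacent u (hd rest) \<or> (\<exists>r s rest'. rest = r # s # rest' \<and> adjacent u s)))"

lemma reach_flip_first:
  assumes "gadget_cycle vs" "length vs = 2 * length ls + 3"
  shows "reach (set vs) 3 (place (tl vs) ((a, b) # ls)) (place (tl vs) ((b, a) # ls))"
proof -
  from assms(1) obtain u p q rest where v: "vs = u # p # q # rest" "adjacent u q" and c: "adj_cycle vs"
    unfolding gadget_cycle_def by blast
  have "adjacent u p" "adjacent p q" by (rule adj_cycleD[OF c]; simp add: v cedges_Cons)+
  moreover have "distinct vs" using c by (simp add: adj_cycle_def)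
  ultimately show ?thesis using v assms(2) reach_flip[of u "set vs" p q "place rest ls" a b] by auto
qed

lemma reach_carry:
  assumes "gadget_cycle vs" "length vs = 2 * length ls + 3"
  shows "reach (set vs) (2 * length vs + 10) (place (tl vs) (x # ls)) (place (tl vs) (x # rotate1 ls))"
proof -
  from assms(1) obtain u p q rest where v: "vs = u # p # q # rest"
    and g: "rest = [] \<or> adjacent u (hd rest) \<or> (\<exists>r s rest'. rest = r # s # rest' \<and> adjacent u s)"
    and c: "adj_cycle vs"
    unfolding gadget_cycle_def by blast
  have d: "distinct vs" using c by (simp add: adj_cycle_def)
  obtain a b where x: "x = (a, b)" by (cases x)
  from g consider "rest = []" | r rest' where "rest = r # rest'" "adjacent u r"
    | r s rest' where "rest = r # s # rest'" "adjacent u s"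
    by (metis list.exhaust list.sel(1))
  then show ?thesis
  proof cases
    case 1
    with v assms(2) have "ls = []" by simp
    then show ?thesis by simp
  next
    case 2
    have "pedges (r # rest' @ [u]) \<subseteq> cedges vs" using v 2 by (auto simp: cedges_Cons)
    then have "adj_cycle (u # r # rest')"
      using c d v 2 adjacent_sym[OF 2(2)] unfolding adj_cycle_def
      by (auto simp: cedges_Cons_Cons doubleton_eq_iff)
    then have "reach (set vs) (2 * length (u # r # rest'))
        ({{(p, a), (q, b)}} \<union> place (tl (u # r # rest')) ls)
        ({{(p, a), (q, b)}} \<union> place (tl (u # r # rest')) (rotate1 ls))"
      by (rule reach_rotate1) (use v 2 d assms(2) in \<open>auto simp: occupied_def\<close>)
    then show ?thesis using v 2 x by (auto elim!: reach_mono)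
  next
    case 3
    with v assms(2) obtain y ls' where ls: "ls = y # ls'" by (cases ls) auto
    obtain a' b' where y: "y = (a', b')" by (cases y)
    have "{u, p} \<in> cedges vs" "{p, q} \<in> cedges vs" "{q, r} \<in> cedges vs" "{r, s} \<in> cedges vs"
      using v 3 by (auto simp: cedges_Cons)
    then have adj: "adjacent u p" "adjacent p q" "adjacent q r" "adjacent r s"
      using adj_cycleD[OF c] by auto
    then have "adj_cycle [u, p, q, r, s]"
      using d v 3 adjacent_sym unfolding adj_cycle_def
      by (auto simp: cedges_Cons doubleton_eq_iff)
    then have "reach (set vs) (2 * length [u, p, q, r, s])
        (place rest' ls' \<union> place (tl [u, p, q, r, s]) [x, y])
        (place rest' ls' \<union> place (tl [u, p, q, r, s]) (rotate1 [x, y]))"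
      by (rule reach_rotate1) (use v 3 d assms(2) ls in auto)
    then have 1: "reach (set vs) 10 (place (tl vs) (x # y # ls')) (place (tl vs) (y # x # ls'))"
      using v 3 x y by (simp add: insert_commute)
    \<comment> \<open>After the exchange the list is \<open>y # x # ls'\<close>. One rotation sends
      \<open>y\<close> to the end and leaves \<open>x\<close> in front, as required.\<close>
    have "reach (set vs) (2 * length vs) ({} \<union> place (tl vs) (y # x # ls'))
       ({} \<union> place (tl vs) (rotate1 (y # x # ls')))"
      by (rule reach_rotate1) (use c v 3 assms(2) ls in auto)
    from reach_trans[OF 1 this[simplified Un_empty_left]] show ?thesis by (simp add: ls add.commute)
  qed
qed

definition unord :: "'l \<times> 'l \<Rightarrow> 'l multiset" where
  "unord p = {#fst p, snd p#}"

lemma unord_eq_iff: "unord p = unord q \<longleftrightarrow> p = q \<or> p = prod.swap q"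
  by (cases p; cases q) (auto simp: unord_def add_eq_conv_ex)

text \<open>Carrying the head past its successors places it anywhere in the cyclic order of the others,
  which gives an insertion sort.\<close>

lemma cyclic_insertion_sort:
  fixes R :: "nat \<Rightarrow> ('l \<times> 'l) list \<Rightarrow> ('l \<times> 'l) list \<Rightarrow> bool"
  assumes refl: "\<And>ls. R 0 ls ls"
    and trans: "\<And>j k ls ms ns. R j ls ms \<Longrightarrow> R k ms ns \<Longrightarrow> R (j + k) ls ns"
    and mono: "\<And>j k ls ms. R j ls ms \<Longrightarrow> j \<le> k \<Longrightarrow> R k ls ms"
    and rot: "\<And>ls. length ls = n \<Longrightarrow> R K ls (rotate1 ls)"
    and carry: "\<And>x ls. Suc (length ls) = n \<Longrightarrow> R K (x # ls) (x # rotate1 ls)"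
    and flip: "\<And>x ls. Suc (length ls) = n \<Longrightarrow> R K (x # ls) (prod.swap x # ls)"
    and ls: "length ls = n" "image_mset unord (mset ls) = image_mset unord (mset ls')"
  shows "R (n * ((3 * n + 1) * K)) ls ls'"
proof -
  have n': "length ls' = n"
    using ls by (metis size_image_mset size_mset)
  have rots: "R (j * K) ms (rotate j ms)" if "length ms = n" for j ms
  proof (induction j)
    case (Suc j)
    from trans[OF Suc rot[of "rotate j ms"]] that show ?case by (simp add: add.commute)
  qed (simp add: refl)
  have carries: "R (j * K) (x # ms) (x # rotate j ms)" if "Suc (length ms) = n" for j x ms
  proof (induction j)
    case (Suc j)
    from trans[OF Suc carry[of "rotate j ms"]] that show ?case by (simp add: add.commute)
  qed (simp add: refl)
  \<comment> \<open>Invariant: after k rounds the first k gourds agree with \<open>ls'\<close> and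
    the stock of gourds is unchanged. A round rotates the next gourd to the front, reverses it if
    necessary, carries it into position and rotates back; the first, third and fourth stage take at
    most n operations each, which gives 3n + 1.\<close>
  have "\<exists>rest. R (k * ((3 * n + 1) * K)) ls (take k ls' @ rest) \<and>
      image_mset unord (mset (take k ls' @ rest)) = image_mset unord (mset ls')" if "k \<le> n" for k
    using that
  proof (induction k)
    case 0
    then show ?case using refl ls by auto
  next
    case (Suc k)
    then obtain rest where rest: "R (k * ((3 * n + 1) * K)) ls (take k ls' @ rest)"
      and m: "image_mset unord (mset (take k ls' @ rest)) = image_mset unord (mset ls')" by auto
    define P t where "P = take k ls'" and "t = ls' ! k"
    have take: "take (Suc k) ls' = P @ [t]"
      using Suc.prems n' by (simp add: P_def t_def take_Suc_conv_app_nth)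
    have lP: "length P = k" using Suc.prems n' by (simp add: P_def)
    have len: "length rest + k = n"
      using arg_cong[OF m, of size] n' lP by (simp add: P_def)
    have "mset ls' = mset P + mset (drop k ls')"
      by (metis P_def append_take_drop_id mset_append)
    with m have "image_mset unord (mset rest) = image_mset unord (mset (drop k ls'))"
      by (simp add: P_def)
    moreover have "t \<in> set (drop k ls')"
      using Suc.prems n' by (metis Cons_nth_drop_Suc Suc_le_lessD list.set_intros(1) t_def)
    ultimately have "unord t \<in># image_mset unord (mset rest)" by simp
    then obtain t' where t': "t' \<in> set rest" "unord t' = unord t" by auto
    then obtain r1 r2 where r: "rest = r1 @ t' # r2" by (meson split_list)
    define l1 l2 where "l1 = length r1" and "l2 = length r2"
    have sum: "l1 + l2 + k + 1 = n" using len r by (simp add: l1_def l2_def)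
    have 1: "R (n * K) (P @ rest) (t' # r2 @ P @ r1)"
    proof (rule mono[OF _ mult_le_mono1[of "k + l1" n]])
      have "rotate (k + l1) ((P @ r1) @ (t' # r2)) = (t' # r2) @ (P @ r1)"
        using rotate_append[of "P @ r1" "t' # r2"] lP by (simp add: l1_def)
      with rots[of "P @ rest" "k + l1"] show "R ((k + l1) * K) (P @ rest) (t' # r2 @ P @ r1)"
        using len lP r by simp
    qed (use sum in simp)
    have 2: "R K (t' # r2 @ P @ r1) (t # r2 @ P @ r1)"
      using t'(2) flip[of "r2 @ P @ r1" t'] mono[OF refl, of K] sum lP
      unfolding unord_eq_iff by (auto simp: l1_def l2_def)
    \<comment> \<open>Carrying \<open>t\<close> past \<open>r2\<close> and \<open>P\<close> puts it
      right behind \<open>P\<close> in the cyclic order and leaves the cyclic order of all others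
      intact.\<close>
    have 3: "R (n * K) (t # r2 @ P @ r1) (t # r1 @ r2 @ P)"
    proof (rule mono[OF _ mult_le_mono1[of "l2 + k" n]])
      have "rotate (l2 + k) ((r2 @ P) @ r1) = r1 @ r2 @ P"
        using rotate_append[of "r2 @ P" r1] lP by (simp add: l2_def)
      with carries[of "r2 @ P @ r1" "l2 + k" t] show "R ((l2 + k) * K) (t # r2 @ P @ r1) (t # r1 @ r2 @ P)"
        using sum lP by (simp add: l1_def l2_def)
    qed (use sum in simp)
    have 4: "R (n * K) (t # r1 @ r2 @ P) (P @ t # r1 @ r2)"
    proof (rule mono[OF _ mult_le_mono1[of "l1 + l2 + 1" n]])
      have "rotate (l1 + l2 + 1) ((t # r1 @ r2) @ P) = P @ t # r1 @ r2"
        using rotate_append[of "t # r1 @ r2" P] by (simp add: l1_def l2_def)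
      with rots[of "t # r1 @ r2 @ P" "l1 + l2 + 1"] show "R ((l1 + l2 + 1) * K) (t # r1 @ r2 @ P) (P @ t # r1 @ r2)"
        using sum lP by (simp add: l1_def l2_def)
    qed (use sum in simp)
    from trans[OF rest trans[OF 1[unfolded P_def] trans[OF 2[unfolded P_def]
          trans[OF 3[unfolded P_def] 4[unfolded P_def]]]]]
    have "R (Suc k * ((3 * n + 1) * K)) ls (take (Suc k) ls' @ r1 @ r2)"
      unfolding take P_def[symmetric] by (simp add: algebra_simps)
    moreover have "image_mset unord (mset (take (Suc k) ls' @ r1 @ r2)) = image_mset unord (mset ls')"
      using m t'(2) unfolding take r P_def[symmetric] by simp
    ultimately show ?case by blast
  qed
  from this[of n] obtain rest where rest: "R (n * ((3 * n + 1) * K)) ls (take n ls' @ rest)"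
      "image_mset unord (mset (take n ls' @ rest)) = image_mset unord (mset ls')" by blast
  from arg_cong[OF rest(2), of size] n' have "rest = []" by simp
  with rest(1) n' show ?thesis by simp
qed

lemma reach_sort:
  fixes ls ls' :: "('l \<times> 'l) list"
  assumes "gadget_cycle vs" "length vs = 2 * n + 1" "length ls = n"
    "image_mset unord (mset ls) = image_mset unord (mset ls')"
  shows "reach (set vs) (n * ((3 * n + 1) * (2 * length vs + 10))) (place (tl vs) ls) (place (tl vs) ls')"
proof (rule cyclic_insertion_sort[where R = "\<lambda>k ls ms. reach (set vs) k (place (tl vs) ls) (place (tl vs) ms)"
      and n = n and K = "2 * length vs + 10"])
  fix ls :: "('l \<times> 'l) list" assume "length ls = n"
  moreover have "adj_cycle vs" using assms(1) by (simp add: gadget_cycle_def)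
  ultimately show "reach (set vs) (2 * length vs + 10) (place (tl vs) ls) (place (tl vs) (rotate1 ls))"
    using reach_rotate1[of vs "set vs" "{}" ls] assms(2) by (auto elim!: reach_mono)
next
  fix x :: "'l \<times> 'l" and ls :: "('l \<times> 'l) list" assume "Suc (length ls) = n"
  with reach_flip_first[OF assms(1), of ls "fst x" "snd x"] assms(2)
  show "reach (set vs) (2 * length vs + 10) (place (tl vs) (x # ls)) (place (tl vs) (prod.swap x # ls))"
    by (cases x) (auto elim!: reach_mono)
next
  fix x :: "'l \<times> 'l" and ls :: "('l \<times> 'l) list" assume "Suc (length ls) = n"
  with reach_carry[OF assms(1), of ls x] assms(2)
  show "reach (set vs) (2 * length vs + 10) (place (tl vs) (x # ls)) (place (tl vs) (x # rotate1 ls))"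
    by auto
qed (use assms in \<open>auto intro: reach_trans reach_mono\<close>)

section \<open>Aligning a configuration with a cycle\<close>

declare split_paired_All [simp del] split_paired_Ex [simp del]

lemma gourds_insert:
  assumes "finite F" "p \<notin> occupied F" "p \<noteq> q"
  shows "gourds (insert {(p, a), (q, b)} F) = add_mset {#a, b#} (gourds F)"
  using assms not_mem_if_not_occupied[OF assms(2), of a q b] by (simp add: gourds_def)

lemma is_configurationD:
  assumes "is_configuration n B C"
  shows "finite C" "card C = n"
    "\<And>g. g \<in> C \<Longrightarrow> \<exists>p q a b. p \<in> B \<and> q \<in> B \<and> adjacent p q \<and> g = {(p, a), (q, b)}"
    "\<And>g h. g \<in> C \<Longrightarrow> h \<in> C \<Longrightarrow> g \<noteq> h \<Longrightarrow> fst ` g \<inter> fst ` h = {}"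
  using assms unfolding is_configuration_def by simp_all

lemma is_configurationI:
  assumes "finite C" "card C = n"
    "\<And>g. g \<in> C \<Longrightarrow> \<exists>p q a b. p \<in> B \<and> q \<in> B \<and> adjacent p q \<and> g = {(p, a), (q, b)}"
    "\<And>g h. g \<in> C \<Longrightarrow> h \<in> C \<Longrightarrow> g \<noteq> h \<Longrightarrow> fst ` g \<inter> fst ` h = {}"
  shows "is_configuration n B C"
  using assms unfolding is_configuration_def by simp

lemma is_configuration_insert:
  assumes "is_configuration n B F" "p \<in> B" "q \<in> B" "adjacent p q" "p \<notin> occupied F" "q \<notin> occupied F"
  shows "is_configuration (Suc n) B (insert {(p, a), (q, b)} F)"
proof -
  define g where "g = {(p, a), (q, b)}"
  have g: "fst ` g = {p, q}" by (auto simp: g_def)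
  have "fst ` h \<subseteq> occupied F" if "h \<in> F" for h
    using that by (auto simp: occupied_def)
  then have disj: "fst ` g \<inter> fst ` h = {}" "fst ` h \<inter> fst ` g = {}" if "h \<in> F" for h
    using that assms(5,6) unfolding g by auto
  have gF: "g \<notin> F" using not_mem_if_not_occupied[OF assms(5)] by (simp add: g_def)
  have ex: "\<exists>p q a b. p \<in> B \<and> q \<in> B \<and> adjacent p q \<and> g = {(p, a), (q, b)}"
    unfolding g_def using assms(2-4) by (intro exI[of _ p] exI[of _ q] exI[of _ a] exI[of _ b]) simp
  note F = is_configurationD[OF assms(1)]
  have "is_configuration (Suc n) B (insert g F)"
  proof (rule is_configurationI)
    fix h assume "h \<in> insert g F"
    then show "\<exists>p q a b. p \<in> B \<and> q \<in> B \<and> adjacent p q \<and> h = {(p, a), (q, b)}"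
      using ex F(3) by (elim insertE) simp_all
  next
    fix h k assume "h \<in> insert g F" "k \<in> insert g F" "h \<noteq> k"
    then show "fst ` h \<inter> fst ` k = {}" using disj F(4) by (metis insertE)
  qed (use F(1,2) gF in simp_all)
  then show ?thesis by (simp add: g_def)
qed

lemma is_configuration_remove:
  assumes "is_configuration n B C" "g \<in> C"
  obtains p q a b m F where "g = {(p, a), (q, b)}" "C = insert g F" "g \<notin> F" "n = Suc m"
    "is_configuration m B F" "p \<in> B" "q \<in> B" "adjacent p q" "p \<notin> occupied F" "q \<notin> occupied F"
proof -
  from assms obtain p q a b where g: "g = {(p, a), (q, b)}" and pq: "p \<in> B" "q \<in> B" "adjacent p q"
    using is_configurationD(3)[OF assms] by auto
  have fg: "fst ` g = {p, q}" using g by auto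
  define F where "F = C - {g}"
  have C: "C = insert g F" "g \<notin> F" using assms by (auto simp: F_def)
  have fin: "finite C" "card C = n" using assms by (auto simp: is_configuration_def)
  then have n: "n = Suc (card F)" using C by auto
  have "is_configuration (card F) B F"
    using is_configurationD[OF assms(1)] by (intro is_configurationI) (simp_all add: F_def)
  moreover have "{p, q} \<inter> fst ` h = {}" if "h \<in> F" for h
    using is_configurationD(4)[OF assms, of h] that C fg by auto
  then have "p \<notin> occupied F" "q \<notin> occupied F" by (auto simp: occupied_def)
  ultimately show ?thesis using that g C n pq by blast
qed

lemma is_configuration_remove_gourd:
  assumes "is_configuration n B C" "{(p, a), (q, b)} \<in> C"
  obtains m F where "C = insert {(p, a), (q, b)} F" "{(p, a), (q, b)} \<notin> F" "n = Suc m"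
    "is_configuration m B F" "p \<in> B" "q \<in> B" "adjacent p q" "p \<notin> occupied F" "q \<notin> occupied F"
proof (rule is_configuration_remove[OF assms])
  fix p' q' a' b' m F
  assume *: "{(p, a), (q, b)} = {(p', a'), (q', b')}" "C = insert {(p, a), (q, b)} F"
    "{(p, a), (q, b)} \<notin> F" "n = Suc m" "is_configuration m B F" "p' \<in> B" "q' \<in> B"
    "adjacent p' q'" "p' \<notin> occupied F" "q' \<notin> occupied F"
  from *(1) have "p = p' \<and> q = q' \<or> p = q' \<and> q = p'" by (auto simp: doubleton_eq_iff)
  then show ?thesis using that *(2-) adjacent_sym[OF *(8)] by blast
qed

lemma card_occupied:
  "is_configuration n B C \<Longrightarrow> card (occupied C) = 2 * n \<and> occupied C \<subseteq> B \<and> finite (occupied C)"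
proof (induction n arbitrary: C)
  case 0
  then have "C = {}" using is_configurationD(1,2) by fastforce
  then show ?case by simp
next
  case (Suc n)
  then obtain g where "g \<in> C" using is_configurationD(2) by fastforce
  from is_configuration_remove[OF Suc.prems this] obtain p q a b m F where
    "g = {(p, a), (q, b)}" "C = insert g F" "g \<notin> F" "Suc n = Suc m" "is_configuration m B F"
    "p \<in> B" "q \<in> B" "adjacent p q" "p \<notin> occupied F" "q \<notin> occupied F" .
  with Suc.IH[of F] show ?case by (auto simp: card_insert_if)
qed

lemma move_replace:
  assumes F: "is_configuration m B F" and pq: "p \<in> B" "q \<in> B" "adjacent p q" "p \<notin> occupied F" "q \<notin> occupied F"
    and pq': "p' \<in> B" "q' \<in> B" "adjacent p' q'" "p' \<notin> occupied F" "q' \<notin> occupied F"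
    and C: "C = insert {(p, a), (q, b)} F" and D: "D = insert {(p', a), (q', b)} F"
  shows "is_configuration (Suc m) B D \<and> gourds D = gourds C"
proof -
  have "finite F" using F by (simp add: is_configuration_def)
  moreover have "p \<noteq> q" "p' \<noteq> q'" using pq pq' by auto
  ultimately show ?thesis unfolding C D
    using gourds_insert pq pq' is_configuration_insert[OF F pq'] by metis
qed

lemma straight_flip: "straight p q e \<Longrightarrow> straight e q p"
proof -
  assume "straight p q e"
  then have *: "e - q = q - p" "q - p \<in> hex_directions" by (auto simp: straight_def adjacent_def)
  then have "q - e = - (q - p)" by (metis minus_diff_eq)
  with * uminus_hex_directions have "q - e \<in> hex_directions" by metis
  moreover have "p - q = q - e" using *(1) by (metis minus_diff_eq)
  ultimately show ?thesis by (simp add: straight_def adjacent_def)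
qed

text \<open>A move is undone by the same rule, with the vacated cell as the new hole. Reversibility
  makes it enough to bring both configurations to a normal form.\<close>

lemma move_preserves:
  assumes "is_configuration n B C" "move B C D"
  shows "is_configuration n B D \<and> gourds D = gourds C \<and> move B D C"
  using assms(2)
proof cases
  case (slide p a q b e)
  from is_configuration_remove_gourd[OF assms(1) slide(2)] obtain m F where
    F: "C = insert {(p, a), (q, b)} F" "{(p, a), (q, b)} \<notin> F" "n = Suc m" "is_configuration m B F"
    and pq: "p \<in> B" "q \<in> B" "adjacent p q" "p \<notin> occupied F" "q \<notin> occupied F" .
  have e: "e \<in> B" "e \<notin> occupied F" "e \<noteq> p" "e \<noteq> q" using slide F by auto
  have D: "D = insert {(q, a), (e, b)} F" using slide(1) F by simp
  have st: "straight e q p" using slide(4) by (rule straight_flip)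
  then have eq: "adjacent q e" by (simp add: straight_def adjacent_sym)
  have "move B (insert {(e, b), (q, a)} F) (insert {(q, b), (p, a)} F)"
    by (rule move_insertI[OF move.slide]) (use st pq e in auto)
  then have "move B D C" by (simp add: D F(1) insert_commute)
  with move_replace[OF F(4) pq pq(2) e(1) eq pq(5) e(2) F(1) D] F(3) show ?thesis by simp
next
  case (turn p a q b e)
  from is_configuration_remove_gourd[OF assms(1) turn(2)] obtain m F where
    F: "C = insert {(p, a), (q, b)} F" "{(p, a), (q, b)} \<notin> F" "n = Suc m" "is_configuration m B F"
    and pq: "p \<in> B" "q \<in> B" "adjacent p q" "p \<notin> occupied F" "q \<notin> occupied F" .
  have e: "e \<in> B" "e \<notin> occupied F" "e \<noteq> p" "e \<noteq> q" using turn F by auto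
  have D: "D = insert {(q, a), (e, b)} F" using turn(1) F by simp
  have st: "angle120 e q p" using turn(4) by (auto simp: angle120_def)
  then have eq: "adjacent q e" by (simp add: angle120_def)
  have "move B (insert {(e, b), (q, a)} F) (insert {(q, b), (p, a)} F)"
    by (rule move_insertI[OF move.turn]) (use st pq e in auto)
  then have "move B D C" by (simp add: D F(1) insert_commute)
  with move_replace[OF F(4) pq pq(2) e(1) eq pq(5) e(2) F(1) D] F(3) show ?thesis by simp
next
  case (pivot p a q b e)
  from is_configuration_remove_gourd[OF assms(1) pivot(2)] obtain m F where
    F: "C = insert {(p, a), (q, b)} F" "{(p, a), (q, b)} \<notin> F" "n = Suc m" "is_configuration m B F"
    and pq: "p \<in> B" "q \<in> B" "adjacent p q" "p \<notin> occupied F" "q \<notin> occupied F" .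
  have e: "e \<in> B" "e \<notin> occupied F" "e \<noteq> p" "e \<noteq> q" using pivot F by auto
  have D: "D = insert {(p, a), (e, b)} F" using pivot(1) F by simp
  have pe: "adjacent p e" "adjacent q e" "adjacent q p" using pivot(4,5) pq(3) adjacent_sym by auto
  have "move B (insert {(p, a), (e, b)} F) (insert {(p, a), (q, b)} F)"
    by (rule move_pivot) (use pe pq e in auto)
  then have "move B D C" by (simp add: D F(1))
  with move_replace[OF F(4) pq pq(1) e(1) pe(1) pq(4) e(2) F(1) D] F(3) show ?thesis by simp
qed

lemma relpowp_move_preserves:
  assumes "is_configuration n B C" "(move B ^^ k) C D"
  shows "is_configuration n B D \<and> gourds D = gourds C \<and> (move B ^^ k) D C"
  using assms(2)
proof (induction k arbitrary: D)
  case 0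
  then show ?case using assms(1) by simp
next
  case (Suc k)
  then obtain E where E: "(move B ^^ k) C E" "move B E D" by auto
  with Suc.IH[OF E(1)] move_preserves[of n B E D]
  have "is_configuration n B D" "gourds D = gourds C" "move B D E" "(move B ^^ k) E C" by auto
  then show ?case using relpowp_Suc_I2 by metis
qed

lemma reach_preserves:
  "is_configuration n B C \<Longrightarrow> reach B k C D \<Longrightarrow>
    is_configuration n B D \<and> gourds D = gourds C \<and> reach B k D C"
  unfolding reach_def using relpowp_move_preserves by blast

lemma gourds_place:
  "distinct xs \<Longrightarrow> length xs = 2 * length ls \<Longrightarrow>
    gourds (place xs ls) = image_mset unord (mset ls) \<and> finite (place xs ls)"
proof (induction xs ls rule: place.induct)
  case (1 x y xs a b ls)
  then show ?case by (auto simp: gourds_insert unord_def)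
qed (auto simp: gourds_def)

text \<open>Unlike in \<open>reach_hop\<close> the list is not closed up: the hole runs through the
  whole segment to its last cell, and every gourd on the way moves back by one cell.\<close>

lemma reach_hop_path:
  assumes "distinct (e # us)" "set (e # us) \<subseteq> B" "occupied F \<inter> set (e # us) = {}"
    "length us = 2 * length ls" "\<forall>x y. {x, y} \<in> pedges (e # us) \<longrightarrow> adjacent x y"
  shows "reach B (2 * length ls) (F \<union> place us ls) (F \<union> place (butlast (e # us)) ls)"
  using assms
proof (induction ls arbitrary: e us F)
  case (Cons ab ls)
  obtain a b where ab: "ab = (a, b)" by (cases ab)
  obtain x y us' where us: "us = x # y # us'" using Cons.prems(4) by (auto simp: length_Suc_conv)
  have "{e, x} \<in> pedges (e # us)" "{x, y} \<in> pedges (e # us)" using us by auto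
  then have adj: "adjacent e x" "adjacent x y" using Cons.prems(5) by blast+
  have "reach B 2 (insert {(x, a), (y, b)} (F \<union> place us' ls)) (insert {(e, a), (x, b)} (F \<union> place us' ls))"
    by (rule reach_shift) (use Cons.prems us adj in auto)
  moreover have "reach B (2 * length ls) (insert {(e, a), (x, b)} F \<union> place us' ls)
      (insert {(e, a), (x, b)} F \<union> place (butlast (y # us')) ls)"
    by (rule Cons.IH) (use Cons.prems us in auto)
  ultimately have "reach B (2 + 2 * length ls) (insert {(x, a), (y, b)} (F \<union> place us' ls))
    (insert {(e, a), (x, b)} F \<union> place (butlast (y # us')) ls)"
    by (intro reach_trans) auto
  then show ?case by (simp add: us ab)
qed simp

text \<open>Read the cells in order as long as each gourd fills the next two of them. Either this
  uses up the list, or it stops at a cell \<open>r\<close> whose gourd has its other end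
  \<open>p\<close> elsewhere than on the following cell.\<close>

lemma aligned_prefix:
  assumes "is_configuration m B F" "distinct (us @ rest)" "occupied F = set rest" "length us = 2 * length ls"
    "C = F \<union> place us ls" "xs = us @ rest"
  shows "(\<exists>ls. length xs = 2 * length ls \<and> C = place xs ls) \<or>
    (\<exists>us r rest ls p a b F k. xs = us @ r # rest \<and> length us = 2 * length ls \<and> p \<in> set rest \<and> p \<noteq> hd rest \<and>
      adjacent r p \<and> is_configuration k B F \<and> occupied F = set rest - {p} \<and> C = insert {(r, a), (p, b)} F \<union> place us ls)"
  using assms
proof (induction "length rest" arbitrary: m us rest ls F rule: less_induct)
  case less
  show ?case
  proof (cases rest)
    case Nil
    then have "occupied F = {}" using less.prems(3) by simp
    with card_occupied[OF less.prems(1)] have "m = 0" by simp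
    then have "F = {}" using less.prems(1) by (auto simp: is_configuration_def)
    with less.prems Nil show ?thesis by (intro disjI1 exI[of _ ls]) simp
  next
    case (Cons r rest')
    then have "r \<in> occupied F" using less.prems by simp
    then obtain g where g: "g \<in> F" "r \<in> fst ` g" unfolding occupied_def by blast
    from is_configuration_remove[OF less.prems(1) g(1)] obtain p0 q0 a0 b0 k G where
      G: "g = {(p0, a0), (q0, b0)}" "F = insert g G" "m = Suc k" "is_configuration k B G"
        "p0 \<in> B" "q0 \<in> B" "adjacent p0 q0" "p0 \<notin> occupied G" "q0 \<notin> occupied G" by metis
    have "\<exists>p a b. g = {(r, a), (p, b)} \<and> adjacent r p \<and> r \<notin> occupied G \<and> p \<notin> occupied G"
      using g(2) G(1,7-9) adjacent_sym[of p0 q0] by (auto intro: insert_commute)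
    then obtain p a b where p: "g = {(r, a), (p, b)}" "adjacent r p" "r \<notin> occupied G" "p \<notin> occupied G" by blast
    have "r \<noteq> p" using p by auto
    have occ: "insert r (insert p (occupied G)) = insert r (set rest')"
      using less.prems(3) Cons G(2) p(1) by simp
    have "r \<notin> set rest'" using less.prems(2) Cons by auto
    with occ p \<open>r \<noteq> p\<close> have og: "occupied G = set rest' - {p}" and pr: "p \<in> set rest'" by auto
    show ?thesis
    proof (cases "p = hd rest'")
      case True
      with pr obtain rest'' where r'': "rest' = p # rest''" by (cases rest') auto
      have "C = G \<union> place (us @ [r, p]) (ls @ [(a, b)])"
        using less.prems(4,5) G(2) p(1) by (simp add: place_append)
      with less.hyps[of rest'' k G "us @ [r, p]" "ls @ [(a, b)]"] less.prems G(4) og Cons r''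
      show ?thesis by auto
    next
      case False
      then show ?thesis using less.prems Cons G(2,4) p(1,2) og pr
        by (intro disjI2 exI[of _ us] exI[of _ r] exI[of _ rest'] exI[of _ ls] exI[of _ p] exI[of _ a]
            exI[of _ b] exI[of _ G] exI[of _ k]) simp
    qed
  qed
qed

lemma hole_exists:
  assumes "is_configuration n B C" "card B = 2 * n + 1" "finite B"
  shows "\<exists>e\<in>B. occupied C = B - {e}"
proof -
  from card_occupied[OF assms(1)] have o: "card (occupied C) = 2 * n" "occupied C \<subseteq> B" "finite (occupied C)" by auto
  then have "card (B - occupied C) = 1" using assms by (simp add: card_Diff_subset)
  then obtain e where "B - occupied C = {e}" by (auto simp: card_1_singleton_iff)
  with o(2) show ?thesis by (intro bexI[of _ e]) auto
qed

text \<open>The number of these gourds is the measure that brings the alignment to an end.\<close>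

definition misaligned :: "cell list \<Rightarrow> 'l configuration \<Rightarrow> 'l configuration" where
  "misaligned vs C = {g \<in> C. fst ` g \<notin> cedges vs}"

lemma misaligned_insert:
  "misaligned vs (insert {(p, a), (q, b)} F) =
    (if {p, q} \<in> cedges vs then misaligned vs F else insert {(p, a), (q, b)} (misaligned vs F))"
  by (auto simp: misaligned_def)

lemma misaligned_Un: "misaligned vs (F \<union> G) = misaligned vs F \<union> misaligned vs G"
  by (auto simp: misaligned_def)

lemma misaligned_place: "pedges xs \<subseteq> cedges vs \<Longrightarrow> misaligned vs (place xs ls) = {}"
proof (induction xs ls rule: place.induct)
  case (1 x y xs a b ls)
  have "pedges xs \<subseteq> pedges (y # xs)" by (cases xs) auto
  with 1 show ?case by (auto simp: misaligned_insert)
qed (auto simp: misaligned_def)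

lemma distinct_cycle_at:
  assumes "e \<in> set vs" "distinct vs"
  obtains i xs where "rotate i vs = e # xs"
proof -
  from assms obtain us ws where "vs = us @ e # ws" by (meson split_list)
  then have "rotate (length us) vs = e # ws @ us" by (simp add: rotate_append)
  then show ?thesis using that by blast
qed

text \<open>Reading the cycle from the hole, skip the aligned prefix \<open>us\<close>; the next
  gourd, on \<open>r\<close> and \<open>p\<close>, is misaligned. The hole runs through
  \<open>us\<close> to the cell \<open>l\<close> before \<open>r\<close>, which keeps the gourds of
  \<open>us\<close> on cycle edges, and then the gourd on \<open>r\<close>, \<open>p\<close> is
  shifted onto the cycle edge from \<open>l\<close> to \<open>r\<close>. Gourds further on are not
  touched.\<close>

lemma reach_fewer_misaligned:
  assumes vs: "adj_cycle vs" "set vs = B" and C: "is_configuration n B C" "card B = 2 * n + 1"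
  shows "(\<exists>i ls. length ls = n \<and> C = place (tl (rotate i vs)) ls) \<or>
    (\<exists>D. reach B (2 * n + 2) C D \<and> card (misaligned vs D) < card (misaligned vs C))"
proof -
  have fin: "finite B" using vs(2) by auto
  from hole_exists[OF C fin] obtain e where e: "e \<in> B" "occupied C = B - {e}" by blast
  have d: "distinct vs" using vs by (simp add: adj_cycle_def)
  from distinct_cycle_at[of e vs] e vs d obtain i xs where xs: "rotate i vs = e # xs" by blast
  have dx: "distinct (e # xs)" "set (e # xs) = B" using d vs(2) xs by (metis distinct_rotate, metis set_rotate)
  have lx: "length xs = 2 * n" using dx C(2) by (metis card_insert_disjoint distinct.simps(2) distinct_card diff_Suc_1 length_Cons add.commute plus_1_eq_Suc)
  have ce: "cedges (e # xs) = cedges vs" using xs by (metis cedges_rotate)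
  have adj: "adjacent x y" if "{x, y} \<in> cedges vs" for x y using vs that adj_cycleD by blast
  have "occupied C = set xs" using e dx by auto
  with aligned_prefix[OF C(1), of "[]" xs "[]" C xs] dx
  consider ls where "length xs = 2 * length ls" "C = place xs ls"
    | us r rest ls p a b F k where "xs = us @ r # rest" "length us = 2 * length ls" "p \<in> set rest" "p \<noteq> hd rest"
      "adjacent r p" "is_configuration k B F" "occupied F = set rest - {p}" "C = insert {(r, a), (p, b)} F \<union> place us ls"
    by auto
  then show ?thesis
  proof cases
    case 1
    then show ?thesis using xs lx by (intro disjI1 exI[of _ i] exI[of _ ls]) simp
  next
    case 2
    define l where "l = last (e # us)"
    have bl: "butlast (e # us) @ [l] = e # us" by (simp add: l_def)
    have split: "e # xs = butlast (e # us) @ l # r # rest"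
      using 2(1) bl by (metis append.assoc append_Cons append_Nil)
    have pe: "pedges (e # xs) \<subseteq> cedges vs"
      unfolding ce[symmetric] by (rule pedges_subset_cedges)
    have pu: "pedges (e # us) \<subseteq> pedges (e # xs)" "pedges (butlast (e # us)) \<subseteq> pedges (e # xs)" "pedges us \<subseteq> pedges (e # xs)"
         "{l, r} \<in> pedges (e # xs)"
    proof -
      have "pedges (e # xs) = pedges (butlast (e # us) @ [l]) \<union> pedges (l # r # rest)"
        unfolding split by (rule pedges_append)
      moreover have "pedges (butlast (e # us) @ [l]) = pedges (e # us)" by (simp only: bl)
      moreover have "pedges (butlast (e # us)) \<subseteq> pedges (butlast (e # us) @ [l])"
        by (cases "butlast (e # us)" rule: rev_cases) (auto simp: pedges_append[of _ _ "[_]"])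
      moreover have "pedges us \<subseteq> pedges (e # us)" by (cases us) auto
      ultimately show "pedges (e # us) \<subseteq> pedges (e # xs)" "pedges (butlast (e # us)) \<subseteq> pedges (e # xs)"
         "pedges us \<subseteq> pedges (e # xs)" "{l, r} \<in> pedges (e # xs)" by auto
    qed
    have lu: "length ls \<le> n" using lx 2(1,2) by simp
    have dl: "l \<in> set (e # us)" by (simp add: l_def)
    obtain t rest' where rest: "rest = t # rest'" using 2(3) by (cases rest) auto
    \<comment> \<open>The neighbours of \<open>r\<close> on the cycle are \<open>l\<close> and
      \<open>t\<close>, and \<open>p\<close> is neither of them.\<close>
    have nal: "{r, p} \<notin> cedges vs"
    proof -
      have "cedges vs = cedges (l # r # rest @ butlast (e # us))"
        using ce split cedges_append[of "butlast (e # us)" "l # r # rest"] by simp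
      moreover have "distinct (l # r # rest @ butlast (e # us))" using dx(1) unfolding split by auto
      moreover have "p \<noteq> l" using 2(1,3) dx(1) dl by auto
      ultimately show ?thesis using cedges_neighbours[of l r t "rest' @ butlast (e # us)" p] rest 2(4) by auto
    qed
    have pus: "p \<notin> set (e # us)" "r \<notin> set (e # us)" "p \<noteq> r" using 2(1,3) dx(1) by auto
    have "reach B (2 * length ls) (insert {(r, a), (p, b)} F \<union> place us ls)
       (insert {(r, a), (p, b)} F \<union> place (butlast (e # us)) ls)"
    proof (rule reach_hop_path)
      show "distinct (e # us)" "set (e # us) \<subseteq> B" using dx 2(1) by auto
      show "occupied (insert {(r, a), (p, b)} F) \<inter> set (e # us) = {}"
        using 2(1,7) dx(1) pus by auto
      show "\<forall>x y. {x, y} \<in> pedges (e # us) \<longrightarrow> adjacent x y" using pe pu adj by blast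
    qed fact
    moreover have "reach B 2 (insert {(r, a), (p, b)} (F \<union> place (butlast (e # us)) ls))
       (insert {(l, a), (r, b)} (F \<union> place (butlast (e # us)) ls))"
    proof (rule reach_shift)
      have sb: "set (butlast (e # us)) \<subseteq> set (e # us)" "l \<notin> set (butlast (e # us))"
        using dx(1) unfolding split by (auto dest: in_set_butlastD)
      have oc: "occupied (F \<union> place (butlast (e # us)) ls) = set rest - {p} \<union> set (butlast (e # us))"
        using 2(2,7) occupied_place[of "butlast (e # us)" ls] by (simp del: butlast.simps)
      show "l \<notin> occupied (F \<union> place (butlast (e # us)) ls)"
        unfolding oc using sb dl 2(1) dx(1) by auto
      show "r \<notin> occupied (F \<union> place (butlast (e # us)) ls)" "p \<notin> occupied (F \<union> place (butlast (e # us)) ls)"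
        unfolding oc using sb pus 2(1) dx(1) by auto
      show "adjacent l r" using pu(4) pe adj by blast
      show "l \<in> B" "r \<in> B" "p \<in> B" "p \<noteq> l" using dl dx 2(1,3) pus by auto
    qed fact
    ultimately have "reach B (2 * length ls + 2) C (insert {(l, a), (r, b)} (F \<union> place (butlast (e # us)) ls))"
      using reach_trans 2(8) by (simp only: Un_insert_left) blast
    then have "reach B (2 * n + 2) C (insert {(l, a), (r, b)} (F \<union> place (butlast (e # us)) ls))"
      by (rule reach_mono) (use lu in simp)
    moreover have "misaligned vs (insert {(l, a), (r, b)} (F \<union> place (butlast (e # us)) ls)) = misaligned vs F"
      using pu pe misaligned_place[of "butlast (e # us)" vs ls] by (auto simp: misaligned_insert misaligned_Un)
    moreover have "misaligned vs C = insert {(r, a), (p, b)} (misaligned vs F)"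
      using nal 2(8) pu pe misaligned_place[of us vs ls] by (auto simp: misaligned_insert misaligned_Un)
    moreover have "finite F" using 2(6) by (simp add: is_configuration_def)
    moreover have "{(r, a), (p, b)} \<notin> F" by (rule not_mem_if_not_occupied) (use 2(1,7) dx(1) in auto)
    ultimately show ?thesis
      by (intro disjI2 exI[of _ "insert {(l, a), (r, b)} (F \<union> place (butlast (e # us)) ls)"])
        (simp add: misaligned_def)
  qed
qed

lemma reach_aligned:
  assumes vs: "adj_cycle vs" "set vs = B" and C: "is_configuration n B C" "card B = 2 * n + 1"
  shows "\<exists>i ls. length ls = n \<and> reach B (card (misaligned vs C) * (2 * n + 2)) C (place (tl (rotate i vs)) ls)"
  using C(1)
proof (induction "card (misaligned vs C)" arbitrary: C rule: less_induct)
  case less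
  from reach_fewer_misaligned[OF vs less.prems C(2)] show ?case
  proof
    assume "\<exists>i ls. length ls = n \<and> C = place (tl (rotate i vs)) ls"
    then show ?thesis by (metis reach_refl)
  next
    assume "\<exists>D. reach B (2 * n + 2) C D \<and> card (misaligned vs D) < card (misaligned vs C)"
    then obtain D where D: "reach B (2 * n + 2) C D" "card (misaligned vs D) < card (misaligned vs C)" by blast
    from less.hyps[OF D(2)] reach_preserves[OF less.prems D(1)] obtain i ls where
      ls: "length ls = n" "reach B (card (misaligned vs D) * (2 * n + 2)) D (place (tl (rotate i vs)) ls)" by blast
    have "2 * n + 2 + card (misaligned vs D) * (2 * n + 2) \<le> card (misaligned vs C) * (2 * n + 2)"
      using D(2) mult_le_mono1[of "Suc (card (misaligned vs D))" "card (misaligned vs C)" "2 * n + 2"] by simp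
    from reach_mono[OF reach_trans[OF D(1) ls(2)] this] ls(1) show ?thesis by blast
  qed
qed

text \<open>The hole is brought to the head of \<open>vs\<close>, so that only the order and
  direction of the gourds remain to be settled. The first summand pays for at most \<open>n\<close>
  misaligned gourds, the second for running the hole along the aligned cycle.\<close>

lemma reach_canonical:
  assumes vs: "adj_cycle vs" "set vs = B" and C: "is_configuration n B C" "card B = 2 * n + 1"
  shows "\<exists>ls. length ls = n \<and> reach B (n * (2 * n + 2) + 2 * (2 * n + 1)) C (place (tl vs) ls) \<and>
     image_mset unord (mset ls) = gourds C"
proof -
  have lv: "length vs = 2 * n + 1" "distinct vs" using vs C(2) by (auto simp: adj_cycle_def distinct_card[symmetric])
  from reach_aligned[OF vs C] obtain i ls where
    ls: "length ls = n" "reach B (card (misaligned vs C) * (2 * n + 2)) C (place (tl (rotate i vs)) ls)" by blast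
  have "card (misaligned vs C) \<le> card C"
    using C(1) by (intro card_mono) (auto simp: misaligned_def is_configuration_def)
  then have "card (misaligned vs C) \<le> n" using C(1) by (simp add: is_configuration_def)
  then have 1: "reach B (n * (2 * n + 2)) C (place (tl (rotate i vs)) ls)"
    using ls(2) reach_mono mult_le_mono1 by blast
  from reach_unrotate[OF vs(1), of B ls i] vs lv ls obtain k
    where "reach B (2 * (2 * n + 1)) (place (tl (rotate i vs)) ls) (place (tl vs) (rotate k ls))" by auto
  from reach_trans[OF 1 this] have r: "reach B (n * (2 * n + 2) + 2 * (2 * n + 1)) C (place (tl vs) (rotate k ls))" .
  from reach_preserves[OF C(1) r] gourds_place[of "tl vs" "rotate k ls"] lv ls(1)
  have "image_mset unord (mset (rotate k ls)) = gourds C" by (simp add: distinct_tl)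
  with r ls(1) show ?thesis by (intro exI[of _ "rotate k ls"]) simp
qed

theorem reach_gadget_cycle:
  assumes "gadget_cycle vs" "set vs = B" "card B = 2 * n + 1" "n \<ge> 1"
    "is_configuration n B C" "is_configuration n B C'" "gourds C = gourds C'"
  shows "reach B (100 * n ^ 3) C C'"
proof -
  have vs: "adj_cycle vs" using assms(1) by (simp add: gadget_cycle_def)
  then have lv: "length vs = 2 * n + 1" using assms(2,3) by (auto simp: adj_cycle_def distinct_card[symmetric])
  define A where "A = n * (2 * n + 2) + 2 * (2 * n + 1)"
  from reach_canonical[OF vs assms(2,5,3)] obtain ls where
    ls: "length ls = n" "reach B A C (place (tl vs) ls)" "image_mset unord (mset ls) = gourds C" by (auto simp: A_def)
  from reach_canonical[OF vs assms(2,6,3)] obtain ls' where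
    ls': "length ls' = n" "reach B A C' (place (tl vs) ls')" "image_mset unord (mset ls') = gourds C'" by (auto simp: A_def)
  have "reach B (n * ((3 * n + 1) * (2 * (2 * n + 1) + 10))) (place (tl vs) ls) (place (tl vs) ls')"
    using reach_sort[OF assms(1) lv ls(1), of ls'] ls(3) ls'(3) assms(2,7) lv by simp
  then have r: "reach B (A + (n * ((3 * n + 1) * (2 * (2 * n + 1) + 10)) + A)) C C'"
    using reach_trans[OF ls(2) reach_trans] reach_preserves[OF assms(6) ls'(2)] by blast
  have n: "n \<le> n ^ 3" "n ^ 2 \<le> n ^ 3" using assms(4) by (auto intro: self_le_power power_increasing)
  have "A + (n * ((3 * n + 1) * (2 * (2 * n + 1) + 10)) + A) = 12 * n ^ 3 + 44 * n ^ 2 + 24 * n + 4"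
    by (simp add: A_def algebra_simps power2_eq_square power3_eq_cube)
  \<comment> \<open>The coefficients add up to 84, and n is at least 1.\<close>
  also have "\<dots> \<le> 100 * n ^ 3" using n assms(4) by linarith
  finally show ?thesis by (rule reach_mono[OF r])
qed

section \<open>Triangulated polygons\<close>

text \<open>A cycle is represented by its set of edges, so that deleting or inserting a vertex is a
  set operation that involves no starting point and no direction.\<close>

definition cycle_on :: "'a set \<Rightarrow> 'a set set \<Rightarrow> bool" where
  "cycle_on S C \<longleftrightarrow> (\<exists>vs. distinct vs \<and> set vs = S \<and> length vs \<ge> 3 \<and> cedges vs = C)"

lemma pedges_neq: "distinct zs \<Longrightarrow> {x, y} \<in> pedges zs \<Longrightarrow> x \<noteq> y"
  by (induction zs rule: pedges.induct) (auto simp: doubleton_eq_iff)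

lemma cycle_on_edge:
  assumes "cycle_on S C" "{a, b} \<in> C"
  shows "a \<noteq> b" "a \<in> S" "b \<in> S"
proof -
  from assms obtain vs where vs: "distinct vs" "set vs = S" "length vs \<ge> 3" "cedges vs = C"
    unfolding cycle_on_def by blast
  obtain v p q vs' where v: "vs = v # p # q # vs'"
    using vs(3) by (auto simp: numeral_3_eq_3 Suc_le_length_iff)
  have "distinct (p # q # vs' @ [v])" "v \<noteq> p" using vs(1) v by auto
  moreover have "{a, b} = {v, p} \<or> {a, b} \<in> pedges (p # q # vs' @ [v])"
    using assms(2) unfolding vs(4)[symmetric] v cedges_Cons by simp
  ultimately show "a \<noteq> b" using pedges_neq by (metis doubleton_eq_iff)
  show "a \<in> S" "b \<in> S" using assms(2) vs cedges_subset[of "{a, b}" vs] by auto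
qed

lemma cycle_on_start:
  assumes "cycle_on S C" "{a, b} \<in> C"
  obtains c rest where "distinct (a # b # c # rest)" "set (a # b # c # rest) = S"
    "cedges (a # b # c # rest) = C"
proof -
  from assms obtain vs where vs: "distinct vs" "set vs = S" "length vs \<ge> 3" "cedges vs = C"
    unfolding cycle_on_def by blast
  with cedges_normal_form[of a b vs] cycle_on_edge[OF assms] assms(2) obtain rest where
    r: "distinct (a # b # rest)" "set (a # b # rest) = S" "cedges (a # b # rest) = C" by auto
  have "length (a # b # rest) = length vs" using r vs by (metis distinct_card)
  with vs(3) obtain c rest' where "rest = c # rest'" by (cases rest) auto
  with r that show ?thesis by blast
qed

lemma cycle_on_neighbours:
  assumes "cycle_on S C" "m \<in> S"
  obtains a b where "a \<noteq> b" "\<And>z. {m, z} \<in> C \<longleftrightarrow> z = a \<or> z = b"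
proof -
  from assms(1) obtain vs where vs: "distinct vs" "set vs = S" "length vs \<ge> 3" "cedges vs = C"
    unfolding cycle_on_def by blast
  from distinct_cycle_at[of m vs] vs assms(2) obtain i xs where xs: "rotate i vs = m # xs" by blast
  have d: "distinct (m # xs)" "length (m # xs) \<ge> 3" "cedges (m # xs) = C"
    using vs xs by (metis distinct_rotate, metis length_rotate, metis cedges_rotate)
  then obtain b rest where r: "xs = b # rest" "rest \<noteq> []"
    by (auto simp: numeral_3_eq_3 Suc_le_length_iff)
  then obtain a rest' where r': "rest = rest' @ [a]" by (cases rest rule: rev_cases) auto
  have "cedges (a # m # b # rest') = C" using d(3) r r' cedges_append[of "[a]" "m # b # rest'"] by simp
  moreover have "distinct (a # m # b # rest')" using d r r' by auto
  ultimately show ?thesis using that[of a b] cedges_neighbours[of a m b rest'] by auto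
qed

text \<open>If {a, b} were an edge, the cycle would be a triangle and only two vertices would
  remain.\<close>

lemma cycle_on_delete:
  assumes C: "cycle_on S C" and e: "{a, m} \<in> C" "{m, b} \<in> C" "a \<noteq> b" and ab: "{a, b} \<notin> C"
  shows "cycle_on (S - {m}) (C - {{a, m}, {m, b}} \<union> {{a, b}})"
proof -
  from cycle_on_start[OF C e(1)] obtain c rest where
    r: "distinct (a # m # c # rest)" "set (a # m # c # rest) = S" "cedges (a # m # c # rest) = C" .
  have "b = c" using e(2,3) cedges_neighbours[OF r(1), of b] r(3) by auto
  with r obtain d rest' where rest: "rest = d # rest'" using ab
    by (cases rest) (auto simp: cedges_Cons insert_commute)
  define P where "P = pedges (b # rest @ [a])"
  have "m \<notin> e" if "e \<in> P" for e
    using pedges_subset[of e "b # rest @ [a]"] that r(1) \<open>b = c\<close> by (auto simp: P_def)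
  then have "{a, m} \<notin> P" "{m, b} \<notin> P" by blast+
  moreover have "C = {{a, m}, {m, b}} \<union> P" using r(3) \<open>b = c\<close> by (auto simp: cedges_Cons P_def)
  moreover have "cedges (a # b # rest) = insert {a, b} P" by (simp add: cedges_Cons P_def)
  ultimately have "cedges (a # b # rest) = C - {{a, m}, {m, b}} \<union> {{a, b}}" by auto
  then show ?thesis unfolding cycle_on_def
    using r \<open>b = c\<close> rest by (intro exI[of _ "a # b # rest"]) auto
qed

lemma cycle_on_insert:
  assumes C: "cycle_on S C" and e: "{a, b} \<in> C" "z \<notin> S"
  shows "cycle_on (insert z S) (C - {{a, b}} \<union> {{a, z}, {z, b}})"
proof -
  from cycle_on_start[OF C e(1)] obtain c rest where
    r: "distinct (a # b # c # rest)" "set (a # b # c # rest) = S" "cedges (a # b # c # rest) = C" .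
  define P where "P = pedges (b # c # rest @ [a])"
  have "{a, b} \<notin> pedges (c # rest @ [a])"
    using pedges_subset[of "{a, b}" "c # rest @ [a]"] r(1) by auto
  then have "{a, b} \<notin> P" using r(1) by (auto simp: P_def doubleton_eq_iff)
  moreover have "C = insert {a, b} P" using r(3) by (auto simp: cedges_Cons P_def)
  moreover have "cedges (a # z # b # c # rest) = {{a, z}, {z, b}} \<union> P" by (auto simp: cedges_Cons P_def)
  ultimately have "cedges (a # z # b # c # rest) = C - {{a, b}} \<union> {{a, z}, {z, b}}" by auto
  then show ?thesis unfolding cycle_on_def
    using r e(2) by (intro exI[of _ "a # z # b # c # rest"]) auto
qed

lemma card_pedges: "distinct zs \<Longrightarrow> finite (pedges zs) \<and> card (pedges zs) = length zs - 1"
proof (induction zs rule: pedges.induct)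
  case (1 x y xs)
  moreover have "{x, y} \<notin> pedges (y # xs)" using pedges_subset[of "{x, y}" "y # xs"] 1 by auto
  ultimately show ?case by simp
qed auto

lemma card_cycle_on:
  assumes "cycle_on S C"
  shows "finite C" "card C = card S" "card S \<ge> 3" "finite S"
proof -
  from assms obtain vs where vs: "distinct vs" "set vs = S" "length vs \<ge> 3" "cedges vs = C"
    unfolding cycle_on_def by blast
  obtain v p q vs' where v: "vs = v # p # q # vs'"
    using vs(3) by (auto simp: numeral_3_eq_3 Suc_le_length_iff)
  have "{v, p} \<notin> pedges (q # vs' @ [v])" using pedges_subset[of "{v, p}" "q # vs' @ [v]"] vs v by auto
  moreover have "{v, p} \<noteq> {p, q}" using vs v by (auto simp: doubleton_eq_iff)
  moreover have "distinct (p # q # vs' @ [v])" using vs v by auto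
  ultimately have "card (insert {v, p} (pedges (p # q # vs' @ [v]))) = length vs"
    "finite (pedges (p # q # vs' @ [v]))"
    using card_pedges[of "p # q # vs' @ [v]"] v by (auto simp: card_insert_if)
  moreover have "C = insert {v, p} (pedges (p # q # vs' @ [v]))" using vs v by (simp add: cedges_Cons)
  ultimately show "finite C" "card C = card S" "card S \<ge> 3" "finite S"
    using vs by (auto simp: distinct_card)
qed

lemma cycle_on_no_triangle:
  assumes "cycle_on S C" "card S \<ge> 4" "{a, m} \<in> C" "{m, b} \<in> C" "a \<noteq> b"
  shows "{a, b} \<notin> C"
proof -
  from cycle_on_start[OF assms(1,3)] obtain c rest where
    r: "distinct (a # m # c # rest)" "set (a # m # c # rest) = S" "cedges (a # m # c # rest) = C" .
  have b: "b = c" using assms(4,5) cedges_neighbours[OF r(1), of b] r(3) by auto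
  have "card S = length (a # m # c # rest)" using r by (metis distinct_card)
  with assms(2) obtain d rest' where rest: "rest = d # rest'" by (cases rest) auto
  have "cedges (m # c # d # rest' @ [a]) = C"
    using r(3) rest cedges_append[of "[a]" "m # c # rest"] by simp
  moreover have "distinct (m # c # d # rest' @ [a])" using r rest by auto
  ultimately have "{b, a} \<in> C \<longleftrightarrow> a = m \<or> a = d" using cedges_neighbours[of m c d "rest' @ [a]" a] b by simp
  then show ?thesis using r(1) rest by (auto simp: insert_commute)
qed

section \<open>Unit triangles, boundaries modulo 2, polygons\<close>

definition unit_triangle :: "cell set \<Rightarrow> bool" where
  "unit_triangle t \<longleftrightarrow> (\<exists>a b c. t = {a, b, c} \<and> adjacent a b \<and> adjacent b c \<and> adjacent a c)"

text \<open>The boundary modulo 2: adding or removing a triangle toggles its three sides, so that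
  changes of the triangle set are computed without orientation or planarity.\<close>

definition bd :: "'a set set \<Rightarrow> 'a set set" where
  "bd T = {{a, b} | a b. a \<noteq> b \<and> odd (card {t \<in> T. {a, b} \<subseteq> t})}"

text \<open>\<open>card T + 2 = card S\<close> is the Euler relation of a triangulated disc without
  interior vertices. With one boundary cycle through all of \<open>S\<close> it stands in for a
  topological notion of polygon.\<close>

definition polygon :: "cell set \<Rightarrow> cell set set \<Rightarrow> bool" where
  "polygon S T \<longleftrightarrow> finite T \<and> (\<forall>t\<in>T. unit_triangle t \<and> t \<subseteq> S) \<and> card T + 2 = card S \<and>
    cycle_on S (bd T)"

lemma bd_iff: "{a, b} \<in> bd T \<longleftrightarrow> a \<noteq> b \<and> odd (card {t \<in> T. {a, b} \<subseteq> t})"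
proof
  assume "{a, b} \<in> bd T"
  then obtain x y where xy: "{a, b} = {x, y}" "x \<noteq> y" "odd (card {t \<in> T. {x, y} \<subseteq> t})"
    unfolding bd_def by blast
  then have "a \<noteq> b" by auto
  with xy(3) show "a \<noteq> b \<and> odd (card {t \<in> T. {a, b} \<subseteq> t})" unfolding xy(1) by simp
next
  assume "a \<noteq> b \<and> odd (card {t \<in> T. {a, b} \<subseteq> t})"
  then show "{a, b} \<in> bd T" unfolding bd_def by blast
qed

lemma bd_insert:
  assumes "finite T" "{a, b, c} \<notin> T" "a \<noteq> b" "b \<noteq> c" "a \<noteq> c"
  shows "bd (insert {a, b, c} T) = sym_diff (bd T) {{a, b}, {b, c}, {a, c}}"
proof (rule set_eqI)
  fix e
  show "e \<in> bd (insert {a, b, c} T) \<longleftrightarrow> e \<in> sym_diff (bd T) {{a, b}, {b, c}, {a, c}}"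
  proof (cases "\<exists>x y. e = {x, y} \<and> x \<noteq> y")
    case False
    then have "e \<notin> bd U" for U :: "'a set set" unfolding bd_def by blast
    moreover have "e \<notin> {{a, b}, {b, c}, {a, c}}" using False assms(3-5) by blast
    ultimately show ?thesis by simp
  next
    case True
    then obtain x y where e: "e = {x, y}" "x \<noteq> y" by blast
    define N Q where "N = {t \<in> T. {x, y} \<subseteq> t}" and "Q \<longleftrightarrow> {x, y} \<subseteq> {a, b, c}"
    have "{t \<in> insert {a, b, c} T. {x, y} \<subseteq> t} = (if Q then insert {a, b, c} N else N)"
      unfolding N_def Q_def by auto
    moreover have "finite N" "{a, b, c} \<notin> N" using assms(1,2) by (simp_all add: N_def)
    ultimately have "{x, y} \<in> bd (insert {a, b, c} T) \<longleftrightarrow> ({x, y} \<in> bd T) \<noteq> Q"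
      using e(2) unfolding bd_iff N_def[symmetric] by (cases Q) simp_all
    then have "{x, y} \<in> bd (insert {a, b, c} T) \<longleftrightarrow> ({x, y} \<in> bd T) \<noteq> ({x, y} \<subseteq> {a, b, c})"
      by (simp only: Q_def)
    moreover have "{x, y} \<subseteq> {a, b, c} \<longleftrightarrow> {x, y} \<in> {{a, b}, {b, c}, {a, c}}"
      using e(2) by (auto simp: doubleton_eq_iff)
    ultimately show ?thesis unfolding e(1) by blast
  qed
qed

lemma bd_remove:
  assumes "finite T" "{a, b, c} \<in> T" "a \<noteq> b" "b \<noteq> c" "a \<noteq> c"
  shows "bd (T - {{a, b, c}}) = sym_diff (bd T) {{a, b}, {b, c}, {a, c}}"
proof -
  have "bd T = sym_diff (bd (T - {{a, b, c}})) {{a, b}, {b, c}, {a, c}}"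
    using bd_insert[of "T - {{a, b, c}}" a b c] assms by (simp add: insert_absorb)
  then show ?thesis by blast
qed

lemma bd_obtain:
  assumes "{a, b} \<in> bd T"
  obtains t where "t \<in> T" "{a, b} \<subseteq> t"
proof -
  have "card {t \<in> T. {a, b} \<subseteq> t} \<noteq> 0" using assms unfolding bd_iff by (metis even_zero)
  then have "{t \<in> T. {a, b} \<subseteq> t} \<noteq> {}" by (metis card.empty)
  then show ?thesis using that by blast
qed

lemma unit_triangle_adjacent: "unit_triangle t \<Longrightarrow> a \<in> t \<Longrightarrow> b \<in> t \<Longrightarrow> a \<noteq> b \<Longrightarrow> adjacent a b"
  unfolding unit_triangle_def using adjacent_sym by auto

lemma polygonD:
  assumes "polygon S T"
  shows "finite T" "\<And>t. t \<in> T \<Longrightarrow> unit_triangle t" "\<And>t. t \<in> T \<Longrightarrow> t \<subseteq> S" "card T + 2 = card S"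
    "cycle_on S (bd T)"
  using assms unfolding polygon_def by auto

lemma polygon_bd_adjacent: "polygon S T \<Longrightarrow> {a, b} \<in> bd T \<Longrightarrow> adjacent a b"
  by (metis bd_iff bd_obtain insert_subset polygonD(2) unit_triangle_adjacent)

lemma polygon_insert:
  assumes P: "polygon S T" and e: "{a, b} \<in> bd T" and z: "z \<notin> S" "adjacent z a" "adjacent z b"
  shows "polygon (insert z S) (insert {a, z, b} T)"
    "bd (insert {a, z, b} T) = bd T - {{a, b}} \<union> {{a, z}, {z, b}}"
proof -
  note P' = polygonD[OF P]
  have adj: "adjacent a b" using polygon_bd_adjacent[OF P e] .
  have ab: "a \<in> S" "b \<in> S" "a \<noteq> b" using cycle_on_edge[OF P'(5) e] by auto
  have t: "{a, z, b} \<notin> T" using P'(3) z(1) by blast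
  have "{a, z} \<notin> bd T" "{z, b} \<notin> bd T" using cycle_on_edge[OF P'(5)] z(1) by blast+
  then show *: "bd (insert {a, z, b} T) = bd T - {{a, b}} \<union> {{a, z}, {z, b}}"
    using bd_insert[OF P'(1) t] ab z e by auto
  have "cycle_on (insert z S) (bd (insert {a, z, b} T))"
    unfolding * by (rule cycle_on_insert[OF P'(5) e z(1)])
  moreover have "unit_triangle {a, z, b}"
    unfolding unit_triangle_def using adj z adjacent_sym by blast
  ultimately show "polygon (insert z S) (insert {a, z, b} T)"
    using P' ab t z(1) card_cycle_on(4)[OF P'(5)] unfolding polygon_def by auto
qed

lemma hex_directions_60:
  "u \<in> hex_directions \<Longrightarrow> v \<in> hex_directions \<Longrightarrow> v - u \<in> hex_directions \<Longrightarrow>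
    v = rot60 u \<or> u = rot60 v"
proof -
  have "\<forall>u\<in>hex_directions. \<forall>v\<in>hex_directions. v - u \<in> hex_directions \<longrightarrow>
     v = rot60 u \<or> u = rot60 v"
    by (simp add: hex_directions_def rot60_def prod_eq_iff)
  then show "u \<in> hex_directions \<Longrightarrow> v \<in> hex_directions \<Longrightarrow> v - u \<in> hex_directions \<Longrightarrow>
    v = rot60 u \<or> u = rot60 v" by blast
qed

lemma triangle_at:
  assumes "unit_triangle t" "(i, j) \<in> t"
  shows "t \<in> {{(i, j), (i + 1, j), (i, j + 1)}, {(i, j), (i, j + 1), (i - 1, j + 1)},
    {(i, j), (i - 1, j + 1), (i - 1, j)}, {(i, j), (i - 1, j), (i, j - 1)},
    {(i, j), (i, j - 1), (i + 1, j - 1)}, {(i, j), (i + 1, j - 1), (i + 1, j)}}"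
proof -
  from assms obtain a b where t: "t = {(i, j), a, b}" "adjacent (i, j) a" "adjacent (i, j) b" "adjacent a b"
  proof -
    from assms(1) obtain x y z where xyz: "t = {x, y, z}" "adjacent x y" "adjacent y z" "adjacent x z"
      unfolding unit_triangle_def by blast
    from assms(2) xyz(1) consider "(i, j) = x" | "(i, j) = y" | "(i, j) = z" by auto
    then show ?thesis
    proof cases
      case 1 with xyz that show ?thesis by simp
    next
      case 2 with xyz that[of x z] show ?thesis by (simp add: adjacent_sym insert_commute)
    next
      case 3 with xyz that[of x y] show ?thesis by (simp add: adjacent_sym insert_commute)
    qed
  qed
  define u v where "u = a - (i, j)" and "v = b - (i, j)"
  have ab: "a = (i + fst u, j + snd u)" "b = (i + fst v, j + snd v)"
    by (auto simp: u_def v_def prod_eq_iff)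
  have "u \<in> hex_directions" "v \<in> hex_directions" "v - u \<in> hex_directions"
    using t(2-4) by (auto simp: u_def v_def adjacent_def)
  then have "v = rot60 u \<or> u = rot60 v" using hex_directions_60 by blast
  then have "t = {(i, j), (i + fst u, j + snd u), (i + fst (rot60 u), j + snd (rot60 u))} \<or>
     t = {(i, j), (i + fst v, j + snd v), (i + fst (rot60 v), j + snd (rot60 v))}"
    using t(1) ab by (metis insert_commute)
  then obtain u where "u \<in> hex_directions" and u: "t = {(i, j), (i + fst u, j + snd u), (i + fst (rot60 u), j + snd (rot60 u))}"
    using \<open>u \<in> _\<close> \<open>v \<in> _\<close> by blast
  then have "u = (1, 0) \<or> u = (0, 1) \<or> u = (-1, 1) \<or> u = (-1, 0) \<or> u = (0, -1) \<or> u = (1, -1)"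
    by (simp add: hex_directions_def)
  then show ?thesis unfolding u rot60_def by (elim disjE; hypsubst; simp)
qed

lemma triangle_through:
  assumes "unit_triangle t" "{p, q} \<subseteq> t" "adjacent p q"
  shows "t = {p, q, p + rot60 (q - p)} \<or> t = {p, q, q + rot60 (p - q)}"
proof -
  have "p \<noteq> q" using assms(3) by auto
  from assms(1) obtain x y z where t: "t = {x, y, z}" and adj: "adjacent x y" "adjacent y z" "adjacent x z"
    unfolding unit_triangle_def by blast
  note ne = adj[THEN adjacent_neq]
  then have "\<exists>r. t = {p, q, r} \<and> r \<noteq> p \<and> r \<noteq> q"
  proof -
    have "p \<in> {x, y, z}" "q \<in> {x, y, z}" using assms(2) t(1) by auto
    then consider "p = x" "q = y" | "p = x" "q = z" | "p = y" "q = x" | "p = y" "q = z"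
      | "p = z" "q = x" | "p = z" "q = y" using \<open>p \<noteq> q\<close> by (elim insertE emptyE) auto
    then show ?thesis
    proof cases
      case 1 then show ?thesis using t ne by (intro exI[of _ z]) simp
    next
      case 2 then show ?thesis using t ne by (intro exI[of _ y]) (simp add: insert_commute)
    next
      case 3 then show ?thesis using t ne by (intro exI[of _ z]) (simp add: insert_commute)
    next
      case 4 then show ?thesis using t ne by (intro exI[of _ x]) (simp add: insert_commute)
    next
      case 5 then show ?thesis using t ne by (intro exI[of _ y]) (simp add: insert_commute)
    next
      case 6 then show ?thesis using t ne by (intro exI[of _ x]) (simp add: insert_commute)
    qed
  qed
  then obtain r where r: "t = {p, q, r}" "r \<noteq> p" "r \<noteq> q" by blast
  have adj: "adjacent p r" "adjacent q r" using unit_triangle_adjacent[OF assms(1)] r by auto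
  define u v where "u = q - p" and "v = r - p"
  have "u \<in> hex_directions" "v \<in> hex_directions" "v - u \<in> hex_directions"
    using assms(3) adj by (auto simp: u_def v_def adjacent_def)
  then consider "v = rot60 u" | "u = rot60 v" using hex_directions_60 by blast
  then show ?thesis
  proof cases
    case 1
    then have "r = p + rot60 (q - p)" unfolding u_def v_def by (metis add.commute diff_add_cancel)
    then show ?thesis using r by simp
  next
    case 2
    have "rot60 (p - q) = - rot60 u" by (simp add: u_def rot60_def)
    moreover have "rot60 u = u - v" unfolding 2 by (simp add: rot60_def prod_eq_iff)
    ultimately have "rot60 (p - q) = r - q" unfolding u_def v_def by simp
    then have "r = q + rot60 (p - q)" by simp
    then show ?thesis using r by simp
  qed
qed

lemma rot60_third_neq: "adjacent p q \<Longrightarrow> p + rot60 (q - p) \<noteq> q + rot60 (p - q) \<and>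
  p + rot60 (q - p) \<notin> {p, q} \<and> q + rot60 (p - q) \<notin> {p, q}"
  by (cases p; cases q) (auto simp: rot60_def adjacent_def hex_directions_def)

text \<open>Only two unit triangles have a given side, one on each side of it, so an odd number
  means exactly one.\<close>

lemma polygon_bd_iff:
  assumes "polygon S T" "adjacent p q"
  shows "{p, q} \<in> bd T \<longleftrightarrow> ({p, q, p + rot60 (q - p)} \<in> T) \<noteq> ({p, q, q + rot60 (p - q)} \<in> T)"
proof -
  let ?t = "{p, q, p + rot60 (q - p)}" and ?t' = "{p, q, q + rot60 (p - q)}"
  have ne: "?t \<noteq> ?t'" using rot60_third_neq[OF assms(2)] by blast
  have *: "{t \<in> T. {p, q} \<subseteq> t} = {t. t = ?t \<and> ?t \<in> T} \<union> {t. t = ?t' \<and> ?t' \<in> T}"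
    using triangle_through[OF polygonD(2)[OF assms(1)] _ assms(2)] by auto
  have "card {t \<in> T. {p, q} \<subseteq> t} = of_bool (?t \<in> T) + of_bool (?t' \<in> T)"
    unfolding * using ne by (cases "?t \<in> T"; cases "?t' \<in> T") (auto simp: insert_commute)
  then show ?thesis unfolding bd_iff using assms(2) by auto
qed

text \<open>Since the boundary is a cycle, the triangles around a vertex form a single fan.\<close>

lemma polygon_fan:
  assumes "polygon S T" "(i, j) \<in> S"
  defines "s0 \<equiv> {(i, j), (i + 1, j), (i, j + 1)} \<in> T" and "s1 \<equiv> {(i, j), (i, j + 1), (i - 1, j + 1)} \<in> T"
    and "s2 \<equiv> {(i, j), (i - 1, j + 1), (i - 1, j)} \<in> T" and "s3 \<equiv> {(i, j), (i - 1, j), (i, j - 1)} \<in> T"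
    and "s4 \<equiv> {(i, j), (i, j - 1), (i + 1, j - 1)} \<in> T" and "s5 \<equiv> {(i, j), (i + 1, j - 1), (i + 1, j)} \<in> T"
  shows "{(i, j), (i + 1, j)} \<in> bd T \<longleftrightarrow> s5 \<noteq> s0" "{(i, j), (i, j + 1)} \<in> bd T \<longleftrightarrow> s0 \<noteq> s1"
    "{(i, j), (i - 1, j + 1)} \<in> bd T \<longleftrightarrow> s1 \<noteq> s2" "{(i, j), (i - 1, j)} \<in> bd T \<longleftrightarrow> s2 \<noteq> s3"
    "{(i, j), (i, j - 1)} \<in> bd T \<longleftrightarrow> s3 \<noteq> s4" "{(i, j), (i + 1, j - 1)} \<in> bd T \<longleftrightarrow> s4 \<noteq> s5"
    "of_bool (s5 \<noteq> s0) + of_bool (s0 \<noteq> s1) + of_bool (s1 \<noteq> s2) + of_bool (s2 \<noteq> s3) +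
       of_bool (s3 \<noteq> s4) + of_bool (s4 \<noteq> s5) = (2 :: nat)"
proof -
  note iff = polygon_bd_iff[OF assms(1)]
  show e: "{(i, j), (i + 1, j)} \<in> bd T \<longleftrightarrow> s5 \<noteq> s0" "{(i, j), (i, j + 1)} \<in> bd T \<longleftrightarrow> s0 \<noteq> s1"
    "{(i, j), (i - 1, j + 1)} \<in> bd T \<longleftrightarrow> s1 \<noteq> s2" "{(i, j), (i - 1, j)} \<in> bd T \<longleftrightarrow> s2 \<noteq> s3"
    "{(i, j), (i, j - 1)} \<in> bd T \<longleftrightarrow> s3 \<noteq> s4" "{(i, j), (i + 1, j - 1)} \<in> bd T \<longleftrightarrow> s4 \<noteq> s5"
    unfolding assms(3-8)
    by (subst iff; auto simp: adjacent_def hex_directions_def rot60_def insert_commute)+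
  from cycle_on_neighbours[OF polygonD(5)[OF assms(1)] assms(2)] obtain a b where
    ab: "a \<noteq> b" "\<And>z. {(i, j), z} \<in> bd T \<longleftrightarrow> z = a \<or> z = b" by blast
  have *: "z \<in> {(i + 1, j), (i, j + 1), (i - 1, j + 1), (i - 1, j), (i, j - 1), (i + 1, j - 1)}"
    if "{(i, j), z} \<in> bd T" for z
  proof -
    have "z - (i, j) \<in> hex_directions" using polygon_bd_adjacent[OF assms(1) that] by (simp add: adjacent_def)
    then have "(i, j) + (z - (i, j)) \<in> {(i + 1, j), (i, j + 1), (i - 1, j + 1), (i - 1, j), (i, j - 1), (i + 1, j - 1)}"
      unfolding hex_directions_def by (elim insertE emptyE) simp_all
    then show ?thesis by simp
  qed
  have mem: "a \<in> {(i + 1, j), (i, j + 1), (i - 1, j + 1), (i - 1, j), (i, j - 1), (i + 1, j - 1)}"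
    "b \<in> {(i + 1, j), (i, j + 1), (i - 1, j + 1), (i - 1, j), (i, j - 1), (i + 1, j - 1)}"
    using *[of a] *[of b] ab(2) by simp_all
  show "of_bool (s5 \<noteq> s0) + of_bool (s0 \<noteq> s1) + of_bool (s1 \<noteq> s2) + of_bool (s2 \<noteq> s3) +
       of_bool (s3 \<noteq> s4) + of_bool (s4 \<noteq> s5) = (2 :: nat)"
    unfolding e[symmetric] ab(2) using mem ab(1)
    by (elim insertE emptyE; hypsubst_thin; simp)
qed

lemma polygon_delete:
  assumes P: "polygon S T" and t: "{a, m, b} \<in> T" and e: "{a, m} \<in> bd T" "{m, b} \<in> bd T"
    and ab: "{a, b} \<notin> bd T"
  shows "polygon (S - {m}) (T - {{a, m, b}})"
    "bd (T - {{a, m, b}}) = bd T - {{a, m}, {m, b}} \<union> {{a, b}}"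
proof -
  note P' = polygonD[OF P]
  obtain x y z where xyz: "{a, m, b} = {x, y, z}" "adjacent x y" "adjacent y z" "adjacent x z"
    using P'(2)[OF t] unfolding unit_triangle_def by blast
  have ne: "a \<noteq> m" "m \<noteq> b" using cycle_on_edge(1)[OF P'(5)] e by auto
  have "card {x, y, z} = 3" using xyz(2-4)[THEN adjacent_neq] by simp
  then have ne': "a \<noteq> b" unfolding xyz(1)[symmetric] using ne by (auto simp: card_insert_if)
  have S: "m \<in> S" using P'(3)[OF t] by auto
  have adj: "adjacent a b" "adjacent m a" "adjacent m b"
    using unit_triangle_adjacent[OF P'(2)[OF t]] ne ne' by auto
  have *: "bd (T - {{a, m, b}}) = bd T - {{a, m}, {m, b}} \<union> {{a, b}}"
    using bd_remove[OF P'(1) t ne ne'] e ab ne ne' by (auto simp: doubleton_eq_iff)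
  then show "bd (T - {{a, m, b}}) = bd T - {{a, m}, {m, b}} \<union> {{a, b}}" .
  obtain i j where m: "m = (i, j)" by (cases m)
  note fan = polygon_fan[OF P S[unfolded m]]
  define u v where "u = a - m" and "v = b - m"
  have uv: "u \<in> hex_directions" "v \<in> hex_directions" "v - u \<in> hex_directions"
    using adj by (auto simp: u_def v_def adjacent_def)
  have a: "a = (i + fst u, j + snd u)" and b: "b = (i + fst v, j + snd v)"
    by (auto simp: u_def v_def m prod_eq_iff)
  have e': "{(i, j), a} \<in> bd T" "{(i, j), b} \<in> bd T" "{(i, j), a, b} \<in> T"
    using e t m by (auto simp: insert_commute)
  \<comment> \<open>The sector a, m, b is filled and both edges bounding it are boundary edges.
    These are the two changes that \<open>polygon_fan\<close> allows around \<open>m\<close>, so no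
    other sector at \<open>m\<close> is filled.\<close>
  have main: "s \<in> T \<Longrightarrow> (i, j) \<in> s \<Longrightarrow> s = {(i, j), a, b}" for s
  proof -
    assume s: "s \<in> T" "(i, j) \<in> s"
    from hex_directions_60[OF uv] show ?thesis
    proof
      assume v: "v = rot60 u"
      have "u = (1, 0) \<or> u = (0, 1) \<or> u = (-1, 1) \<or> u = (-1, 0) \<or> u = (0, -1) \<or> u = (1, -1)"
        using uv(1) by (simp add: hex_directions_def)
      then show ?thesis using triangle_at[OF P'(2)[OF s(1)] s(2)] s(1) e' fan unfolding a b v rot60_def
        by (elim disjE insertE emptyE; hypsubst_thin; simp add: insert_commute)
    next
      assume v: "u = rot60 v"
      have "v = (1, 0) \<or> v = (0, 1) \<or> v = (-1, 1) \<or> v = (-1, 0) \<or> v = (0, -1) \<or> v = (1, -1)"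
        using uv(2) by (simp add: hex_directions_def)
      then show ?thesis using triangle_at[OF P'(2)[OF s(1)] s(2)] s(1) e' fan unfolding a b v rot60_def
        by (elim disjE insertE emptyE; hypsubst_thin; simp add: insert_commute)
    qed
  qed
  have "{(i, j), a, b} = {a, m, b}" using m by (simp add: insert_commute)
  then have sub: "s \<subseteq> S - {m}" if "s \<in> T - {{a, m, b}}" for s
    using main[of s] that P'(3)[of s] m by blast
  have "cycle_on (S - {m}) (bd (T - {{a, m, b}}))"
    unfolding * by (rule cycle_on_delete[OF P'(5) e ne' ab])
  moreover have "card (T - {{a, m, b}}) + 2 = card (S - {m})"
    using P'(1,4) t S card_cycle_on(4)[OF P'(5)] card_Suc_Diff1[OF P'(1) t] card_Suc_Diff1[of S m] by simp
  ultimately show "polygon (S - {m}) (T - {{a, m, b}})"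
    using P'(1,2) sub unfolding polygon_def by blast
qed

text \<open>Both relocation lemmas move the vertex \<open>m\<close> of the cycle from between \<open>a\<close> and \<open>b\<close> to
  between \<open>u\<close> and \<open>v\<close>; \<open>m\<close> is a convex corner in the first one and a reflex corner in the second.\<close>

lemma relocate_set_eq: "e \<noteq> f \<Longrightarrow> X - {p, q} \<union> {f} - {e} \<union> Y = X - {p, q, e} \<union> insert f Y"
  by auto

lemma polygon_relocate_convex:
  assumes P: "polygon S T" and t: "{a, m, b} \<in> T" and e: "{a, m} \<in> bd T" "{m, b} \<in> bd T"
    and ab: "{a, b} \<notin> bd T" and uv: "{u, v} \<in> bd T" "m \<noteq> u" "m \<noteq> v" "adjacent m u" "adjacent m v"
  shows "polygon S (insert {u, m, v} (T - {{a, m, b}}))"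
    "bd (insert {u, m, v} (T - {{a, m, b}})) = bd T - {{a, m}, {m, b}, {u, v}} \<union> {{a, b}, {u, m}, {m, v}}"
proof -
  note D = polygon_delete[OF P t e ab]
  have uv': "{u, v} \<in> bd (T - {{a, m, b}})" unfolding D(2) using uv(1-3) by (auto simp: doubleton_eq_iff)
  note I = polygon_insert[OF D(1) uv' _ uv(4,5)]
  have "insert m (S - {m}) = S" using cycle_on_edge[OF polygonD(5)[OF P] e(1)] by auto
  then show "polygon S (insert {u, m, v} (T - {{a, m, b}}))" using I(1) by simp
  have "{u, v} \<noteq> {a, b}" using uv(1) ab by auto
  note eq = relocate_set_eq[OF this]
  have "m \<notin> S - {m}" by simp
  show "bd (insert {u, m, v} (T - {{a, m, b}})) = bd T - {{a, m}, {m, b}, {u, v}} \<union> {{a, b}, {u, m}, {m, v}}"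
    using I(2)[OF \<open>m \<notin> S - {m}\<close>] unfolding D(2) eq .
qed

lemma polygon_relocate_reflex:
  assumes P: "polygon S T" and t: "{a, m, b} \<notin> T" "adjacent a b" and e: "{a, m} \<in> bd T" "{m, b} \<in> bd T"
    and ab: "{a, b} \<notin> bd T" and uv: "{u, v} \<in> bd T" "{u, m, v} \<in> T" "m \<noteq> u" "m \<noteq> v"
  shows "polygon S (insert {a, m, b} (T - {{u, m, v}}))"
    "bd (insert {a, m, b} (T - {{u, m, v}})) = bd T - {{a, m}, {m, b}, {u, v}} \<union> {{a, b}, {u, m}, {m, v}}"
proof -
  note P' = polygonD[OF P]
  have ne: "a \<noteq> m" "m \<noteq> b" "a \<noteq> b" "u \<noteq> v"
    using cycle_on_edge(1)[OF P'(5)] e uv(1) t(2) by auto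
  have S: "m \<in> S" "a \<in> S" "b \<in> S" "u \<in> S" "v \<in> S" using cycle_on_edge[OF P'(5)] e uv(1) by blast+
  from cycle_on_neighbours[OF P'(5) S(1)] obtain x y where
    xy: "x \<noteq> y" "\<And>z. {m, z} \<in> bd T \<longleftrightarrow> z = x \<or> z = y" by blast
  have nb: "{m, z} \<in> bd T \<longleftrightarrow> z = a \<or> z = b" for z
    using xy(2)[of a] xy(2)[of b] xy(2)[of z] e ne(3) by (auto simp: insert_commute)
  define U where "U = T - {{u, m, v}}"
  have U: "finite U" "{a, m, b} \<notin> U" using P'(1) t(1) by (auto simp: U_def)
  \<comment> \<open>Neither half of this exchange need give a polygon: adding a, m, b first would
    bury \<open>m\<close>, removing u, m, v first may let the boundary pass \<open>m\<close> twice.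
    So the new boundary is computed modulo 2 in one go, and the cycle comes from deleting and
    reinserting \<open>m\<close> on the level of edge sets.\<close>
  have "bd (insert {a, m, b} U) = sym_diff (sym_diff (bd T) {{u, m}, {m, v}, {u, v}}) {{a, m}, {m, b}, {a, b}}"
    using bd_insert[OF U ne(1-3)] bd_remove[OF P'(1) uv(2)] uv(3,4) ne(4) by (simp add: U_def)
  also have "\<dots> = bd T - {{a, m}, {m, b}, {u, v}} \<union> {{a, b}, {u, m}, {m, v}}"
  proof (rule set_eqI)
    fix f
    have "{u, v} \<noteq> {a, b}" using uv(1) ab by auto
    moreover have "{u, v} \<noteq> {a, m}" "{u, v} \<noteq> {m, b}" "{u, v} \<noteq> {u, m}" "{u, v} \<noteq> {m, v}"
      "{a, b} \<noteq> {a, m}" "{a, b} \<noteq> {m, b}" "{a, b} \<noteq> {u, m}" "{a, b} \<noteq> {m, v}"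
      "{a, m} \<noteq> {m, b}" "{u, m} \<noteq> {m, v}"
      using uv(3,4) ne by (auto simp: doubleton_eq_iff)
    moreover have "{u, m} \<in> bd T \<longleftrightarrow> {u, m} = {a, m} \<or> {u, m} = {m, b}"
      "{m, v} \<in> bd T \<longleftrightarrow> {m, v} = {a, m} \<or> {m, v} = {m, b}"
      using nb[of u] nb[of v] uv(3,4) ne by (simp_all add: doubleton_eq_iff insert_commute[of u])
    ultimately show "f \<in> sym_diff (sym_diff (bd T) {{u, m}, {m, v}, {u, v}}) {{a, m}, {m, b}, {a, b}} \<longleftrightarrow>
       f \<in> bd T - {{a, m}, {m, b}, {u, v}} \<union> {{a, b}, {u, m}, {m, v}}"
      using e ab uv(1) unfolding Un_iff Diff_iff insert_iff empty_iff
      by (cases "f = {u, v}"; cases "f = {a, b}"; cases "f = {a, m}"; cases "f = {m, b}";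
        cases "f = {u, m}"; cases "f = {m, v}") simp_all
  qed
  finally show *: "bd (insert {a, m, b} (T - {{u, m, v}})) =
      bd T - {{a, m}, {m, b}, {u, v}} \<union> {{a, b}, {u, m}, {m, v}}" unfolding U_def .
  have C1: "cycle_on (S - {m}) (bd T - {{a, m}, {m, b}} \<union> {{a, b}})"
    by (rule cycle_on_delete[OF P'(5) e ne(3) ab])
  have "{u, v} \<in> bd T - {{a, m}, {m, b}} \<union> {{a, b}}" using uv by (auto simp: doubleton_eq_iff)
  from cycle_on_insert[OF C1 this, of m]
  have "cycle_on (insert m (S - {m})) (bd T - {{a, m}, {m, b}} \<union> {{a, b}} - {{u, v}} \<union> {{u, m}, {m, v}})" by simp
  moreover have "bd T - {{a, m}, {m, b}} \<union> {{a, b}} - {{u, v}} \<union> {{u, m}, {m, v}} =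
     bd T - {{a, m}, {m, b}, {u, v}} \<union> {{a, b}, {u, m}, {m, v}}"
    by (rule relocate_set_eq) (use uv(1) ab in metis)
  moreover have "insert m (S - {m}) = S" using S(1) by auto
  ultimately have "cycle_on S (bd (insert {a, m, b} (T - {{u, m, v}})))" unfolding * by simp
  moreover have "unit_triangle {a, m, b}"
    unfolding unit_triangle_def using polygon_bd_adjacent[OF P e(1)] polygon_bd_adjacent[OF P e(2)] t(2) by blast
  moreover have "card (insert {a, m, b} (T - {{u, m, v}})) = card T"
    using U card_Suc_Diff1[OF P'(1) uv(2)] by (simp add: U_def)
  ultimately show "polygon S (insert {a, m, b} (T - {{u, m, v}}))"
    using P' S unfolding polygon_def by auto
qed

section \<open>Ears of a polygon\<close>

text \<open>The two cases of \<open>gadget_cycle\<close> in terms of edges. The first pattern is an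
  ear \<open>p\<close> beside the triangle u, q, v, the second consists of two ears \<open>p\<close>
  and \<open>r\<close> on the triangle u, q, s; \<open>adjacent q s\<close> serves the induction in
  \<open>gadget_insert\<close>.\<close>

definition gadget :: "cell set set \<Rightarrow> bool" where
  "gadget C \<longleftrightarrow>
    (\<exists>u p q v. distinct [u, p, q, v] \<and> {u, p} \<in> C \<and> {p, q} \<in> C \<and> {q, v} \<in> C \<and> adjacent u q \<and> adjacent u v) \<or>
    (\<exists>u p q r s. distinct [u, p, q, r, s] \<and> {u, p} \<in> C \<and> {p, q} \<in> C \<and> {q, r} \<in> C \<and> {r, s} \<in> C \<and>
      adjacent u q \<and> adjacent q s \<and> adjacent u s)"

lemma gadgetI1:
  "distinct [u, p, q, v] \<Longrightarrow> {u, p} \<in> C \<Longrightarrow> {p, q} \<in> C \<Longrightarrow> {q, v} \<in> C \<Longrightarrow>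
    adjacent u q \<Longrightarrow> adjacent u v \<Longrightarrow> gadget C"
  unfolding gadget_def by blast

lemma gadgetI2:
  "distinct [u, p, q, r, s] \<Longrightarrow> {u, p} \<in> C \<Longrightarrow> {p, q} \<in> C \<Longrightarrow> {q, r} \<in> C \<Longrightarrow> {r, s} \<in> C \<Longrightarrow>
    adjacent u q \<Longrightarrow> adjacent q s \<Longrightarrow> adjacent u s \<Longrightarrow> gadget C"
  unfolding gadget_def by blast

text \<open>An edge outside the pattern may be subdivided freely. Subdividing an edge of an ear
  triangle makes \<open>w\<close> a new ear beside that triangle, which is the first pattern;
  subdividing {q, v} in the first pattern gives the second one, with the ears \<open>p\<close> and
  \<open>w\<close>.\<close>

lemma gadget_insert:
  assumes g: "gadget C" and ab: "{a, b} \<in> C" and w: "\<And>e. e \<in> C \<Longrightarrow> w \<notin> e"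
    and adj: "\<And>x y. {x, y} \<in> C \<Longrightarrow> adjacent x y"
  shows "gadget (C - {{a, b}} \<union> {{a, w}, {w, b}})" (is "gadget ?D")
proof -
  have split: "{x, y} \<in> ?D \<or> {x, y} = {a, b} \<and> {x, w} \<in> ?D \<and> {w, y} \<in> ?D" if "{x, y} \<in> C" for x y
    using that by (cases "{x, y} = {a, b}") (auto simp: doubleton_eq_iff insert_commute)
  from g[unfolded gadget_def] show ?thesis
  proof (elim disjE exE conjE)
    fix u p q v
    assume d: "distinct [u, p, q, v]" and e: "{u, p} \<in> C" "{p, q} \<in> C" "{q, v} \<in> C" and uq: "adjacent u q" "adjacent u v"
    have wd: "w \<noteq> u" "w \<noteq> p" "w \<noteq> q" "w \<noteq> v" using w e by blast+
    consider "{u, p} = {a, b}" | "{p, q} = {a, b}" | "{q, v} = {a, b}"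
      | "{u, p} \<in> ?D" "{p, q} \<in> ?D" "{q, v} \<in> ?D" using split[OF e(1)] split[OF e(2)] split[OF e(3)] by argo
    then show ?thesis
    proof cases
      case 1
      then have "{p, q} \<noteq> {a, b}" using d by (auto simp: doubleton_eq_iff)
      then have "{p, q} \<in> ?D" "{u, w} \<in> ?D" "{w, p} \<in> ?D" using 1 e(2) by (auto simp: doubleton_eq_iff)
      then show ?thesis by (intro gadgetI1[of u w p q]) (use d wd uq adj e in auto)
    next
      case 2
      then have "{u, p} \<noteq> {a, b}" using d by (auto simp: doubleton_eq_iff)
      then have "{p, u} \<in> ?D" "{w, p} \<in> ?D" "{q, w} \<in> ?D" using 2 e(1) by (auto simp: doubleton_eq_iff insert_commute)
      then show ?thesis by (intro gadgetI1[of q w p u]) (use d wd adjacent_sym[OF uq(1)] adjacent_sym[OF adj[OF e(2)]] in auto)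
    next
      case 3
      then have "{u, p} \<noteq> {a, b}" "{p, q} \<noteq> {a, b}" using d by (auto simp: doubleton_eq_iff)
      then have "{u, p} \<in> ?D" "{p, q} \<in> ?D" "{q, w} \<in> ?D" "{w, v} \<in> ?D" using 3 e by (auto simp: doubleton_eq_iff)
      then show ?thesis by (intro gadgetI2[of u p q w v]) (use d wd uq adj e in auto)
    next
      case 4
      then show ?thesis by (intro gadgetI1[of u p q v]) (use d uq in auto)
    qed
  next
    fix u p q r s
    assume d: "distinct [u, p, q, r, s]" and e: "{u, p} \<in> C" "{p, q} \<in> C" "{q, r} \<in> C" "{r, s} \<in> C"
      and uq: "adjacent u q" "adjacent q s" "adjacent u s"
    have wd: "w \<noteq> u" "w \<noteq> p" "w \<noteq> q" "w \<noteq> r" "w \<noteq> s" using w e by blast+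
    consider "{u, p} = {a, b}" | "{p, q} = {a, b}" | "{q, r} = {a, b}" | "{r, s} = {a, b}"
      | "{u, p} \<in> ?D" "{p, q} \<in> ?D" "{q, r} \<in> ?D" "{r, s} \<in> ?D"
      using split[OF e(1)] split[OF e(2)] split[OF e(3)] split[OF e(4)] by argo
    then show ?thesis
    proof cases
      case 1
      then have "{p, q} \<noteq> {a, b}" using d by (auto simp: doubleton_eq_iff)
      then have "{p, q} \<in> ?D" "{u, w} \<in> ?D" "{w, p} \<in> ?D" using 1 e(2) by (auto simp: doubleton_eq_iff)
      then show ?thesis by (intro gadgetI1[of u w p q]) (use d wd uq adj e in auto)
    next
      case 2
      then have "{u, p} \<noteq> {a, b}" using d by (auto simp: doubleton_eq_iff)
      then have "{p, u} \<in> ?D" "{w, p} \<in> ?D" "{q, w} \<in> ?D" using 2 e(1) by (auto simp: doubleton_eq_iff insert_commute)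
      then show ?thesis by (intro gadgetI1[of q w p u]) (use d wd adjacent_sym[OF uq(1)] adjacent_sym[OF adj[OF e(2)]] in auto)
    next
      case 3
      then have "{r, s} \<noteq> {a, b}" using d by (auto simp: doubleton_eq_iff)
      then have "{r, s} \<in> ?D" "{q, w} \<in> ?D" "{w, r} \<in> ?D" using 3 e by (auto simp: doubleton_eq_iff)
      then show ?thesis by (intro gadgetI1[of q w r s]) (use d wd uq adj e in auto)
    next
      case 4
      then have "{q, r} \<noteq> {a, b}" using d by (auto simp: doubleton_eq_iff)
      then have "{r, q} \<in> ?D" "{s, w} \<in> ?D" "{w, r} \<in> ?D" using 4 e by (auto simp: doubleton_eq_iff insert_commute)
      then show ?thesis by (intro gadgetI1[of s w r q])
         (use d wd adjacent_sym[OF uq(2)] adjacent_sym[OF adj[OF e(4)]] in auto)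
    next
      case 5
      then show ?thesis by (intro gadgetI2[of u p q r s]) (use d uq in auto)
    qed
  qed
qed

text \<open>There are \<open>card S - 2\<close> triangles but \<open>card S\<close> boundary edges, so some triangle carries two of them.\<close>

lemma polygon_ear:
  assumes P: "polygon S T" and S: "card S \<ge> 4"
  obtains a m b where "{a, m, b} \<in> T" "{a, m} \<in> bd T" "{m, b} \<in> bd T" "{a, b} \<notin> bd T"
proof -
  note P' = polygonD[OF P]
  have fin: "finite (bd T)" using card_cycle_on[OF P'(5)] by simp
  have "\<exists>t\<in>T. card {e \<in> bd T. e \<subseteq> t} \<ge> 2"
  proof (rule ccontr)
    assume "\<not> ?thesis"
    then have le: "card {e \<in> bd T. e \<subseteq> t} \<le> 1" if "t \<in> T" for t using that by force
    have "bd T \<subseteq> (\<Union>t\<in>T. {e \<in> bd T. e \<subseteq> t})"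
    proof
      fix e assume e: "e \<in> bd T"
      then obtain a b where ab: "e = {a, b}" unfolding bd_def by blast
      from bd_obtain[OF e[unfolded ab]] obtain t where "t \<in> T" "{a, b} \<subseteq> t" .
      with e ab show "e \<in> (\<Union>t\<in>T. {e \<in> bd T. e \<subseteq> t})" by blast
    qed
    then have "card (bd T) \<le> card (\<Union>t\<in>T. {e \<in> bd T. e \<subseteq> t})"
      using P'(1) fin by (intro card_mono) auto
    also have "\<dots> \<le> (\<Sum>t\<in>T. card {e \<in> bd T. e \<subseteq> t})" by (rule card_UN_le[OF P'(1)])
    also have "\<dots> \<le> (\<Sum>t\<in>T. 1)" by (rule sum_mono) (rule le)
    finally show False using card_cycle_on(2)[OF P'(5)] P'(4) by simp
  qed
  then obtain t where t: "t \<in> T" "card {e \<in> bd T. e \<subseteq> t} \<ge> 2" by blast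
  obtain A where A: "A \<subseteq> {e \<in> bd T. e \<subseteq> t}" "card A = 2"
    using obtain_subset_with_card_n[OF t(2)] by metis
  from A(2) obtain e f where "A = {e, f}" "e \<noteq> f" unfolding card_2_iff by blast
  with A(1) have ef: "e \<in> bd T" "f \<in> bd T" "e \<subseteq> t" "f \<subseteq> t" "e \<noteq> f"
    by auto
  obtain x y z where xyz: "t = {x, y, z}" "adjacent x y" "adjacent y z" "adjacent x z"
    using P'(2)[OF t(1)] unfolding unit_triangle_def by blast
  have "e \<in> {{x, y}, {y, z}, {x, z}}" "f \<in> {{x, y}, {y, z}, {x, z}}"
  proof -
    have "e \<in> {{x, y}, {y, z}, {x, z}}" if "e \<in> bd T" "e \<subseteq> t" for e
    proof -
      from that(1) obtain a b where "e = {a, b}" "a \<noteq> b" unfolding bd_def by blast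
      with that(2) xyz(1) show ?thesis by (auto simp: insert_commute)
    qed
    then show "e \<in> {{x, y}, {y, z}, {x, z}}" "f \<in> {{x, y}, {y, z}, {x, z}}" using ef by auto
  qed
  then have "\<exists>a m b. t = {a, m, b} \<and> {a, m} \<in> bd T \<and> {m, b} \<in> bd T \<and> a \<noteq> b"
  proof -
    consider "{x, y} \<in> bd T" "{y, z} \<in> bd T" | "{x, y} \<in> bd T" "{x, z} \<in> bd T" | "{x, z} \<in> bd T" "{y, z} \<in> bd T"
      using \<open>e \<in> {_, _, _}\<close> \<open>f \<in> {_, _, _}\<close> ef by auto
    then show ?thesis
    proof cases
      case 1 then show ?thesis using xyz adjacent_neq[OF xyz(4)] by blast
    next
      case 2
      then have "t = {y, x, z}" "{y, x} \<in> bd T" "{x, z} \<in> bd T" using xyz(1) by (simp_all add: insert_commute)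
      then show ?thesis using adjacent_neq[OF xyz(3)] by blast
    next
      case 3
      then have "t = {x, z, y}" "{x, z} \<in> bd T" "{z, y} \<in> bd T" using xyz(1) by (simp_all add: insert_commute)
      then show ?thesis using adjacent_neq[OF xyz(2)] by blast
    qed
  qed
  then obtain a m b where "t = {a, m, b}" "{a, m} \<in> bd T" "{m, b} \<in> bd T" "a \<noteq> b" by blast
  with t(1) cycle_on_no_triangle[OF P'(5) S] that show ?thesis by blast
qed

text \<open>Cut off an ear and let \<open>gadget_insert\<close> put it back. The induction starts at
  a quadrilateral, where the ear \<open>m\<close> and the remaining triangle a, b, c form the first
  pattern.\<close>

lemma polygon_gadget: "polygon S T \<Longrightarrow> card S \<ge> 4 \<Longrightarrow> gadget (bd T)"
proof (induction "card S" arbitrary: S T rule: less_induct)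
  case less
  note P = less.prems(1) and P' = polygonD[OF less.prems(1)]
  from polygon_ear[OF P less.prems(2)] obtain a m b where
    t: "{a, m, b} \<in> T" and e: "{a, m} \<in> bd T" "{m, b} \<in> bd T" and ab: "{a, b} \<notin> bd T" .
  define T' C where "T' = T - {{a, m, b}}" and "C = bd T'"
  note D = polygon_delete[OF P t e ab, folded T'_def]
  note D' = polygonD[OF D(1)]
  have ne: "a \<noteq> m" "m \<noteq> b" using cycle_on_edge(1)[OF P'(5)] e by auto
  have m: "m \<in> S" using cycle_on_edge[OF P'(5) e(1)] by simp
  have finS: "finite S" using card_cycle_on[OF P'(5)] by simp
  have eq: "bd T = C - {{a, b}} \<union> {{a, m}, {m, b}}"
    unfolding C_def D(2) using e ab by auto
  have abC: "{a, b} \<in> C" unfolding C_def D(2) by simp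
  have adjC: "adjacent x y" if "{x, y} \<in> C" for x y using polygon_bd_adjacent[OF D(1)] that by (simp add: C_def)
  show ?case
  proof (cases "card (S - {m}) \<ge> 4")
    case True
    have "card (S - {m}) < card S" using m finS by (metis card_Diff1_less)
    from less.hyps[OF this D(1) True] have "gadget C" by (simp add: C_def)
    moreover have "m \<notin> f" if f: "f \<in> C" for f
    proof -
      obtain x y where "f = {x, y}" using f unfolding C_def bd_def by blast
      with f cycle_on_edge[OF D'(5)] show ?thesis unfolding C_def by blast
    qed
    ultimately show ?thesis unfolding eq using gadget_insert abC adjC by blast
  next
    case False
    from cycle_on_start[OF D'(5) abC[unfolded C_def]] obtain c rest where
      r: "distinct (a # b # c # rest)" "set (a # b # c # rest) = S - {m}" "cedges (a # b # c # rest) = bd T'" .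
    have "length (a # b # c # rest) < 4" using False r by (metis distinct_card not_le)
    then have "rest = []" by simp
    then have "{b, c} \<in> C" "{c, a} \<in> C" using r(3) by (auto simp: C_def cedges_Cons)
    moreover have "distinct [a, m, b, c]" using r(1,2) ne by auto
    moreover have "{b, c} \<noteq> {a, b}" using r(1) by (auto simp: doubleton_eq_iff)
    ultimately show ?thesis
      by (intro gadgetI1[of a m b c]) (use adjacent_sym[OF adjC] adjC abC in \<open>auto simp: eq\<close>)
  qed
qed

lemma polygon_gadget_cycle:
  assumes "polygon S T"
  obtains vs where "gadget_cycle vs" "set vs = S"
proof -
  note P' = polygonD[OF assms]
  have cyc: "adj_cycle vs" if "distinct vs" "cedges vs = bd T" for vs
    using that polygon_bd_adjacent[OF assms] unfolding adj_cycle_def by blast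
  have "\<exists>vs. gadget_cycle vs \<and> set vs = S"
  proof (cases "card S \<ge> 4")
    case False
    from P'(5) obtain vs where vs: "distinct vs" "set vs = S" "length vs \<ge> 3" "cedges vs = bd T"
      unfolding cycle_on_def by blast
    with False have "length vs = 3" by (metis distinct_card le_antisym not_less_eq_eq numeral_3_eq_3 eval_nat_numeral(2) semiring_norm(26) semiring_norm(27))
    then obtain u p q where v: "vs = [u, p, q]" by (auto simp: length_Suc_conv numeral_3_eq_3)
    then have "{q, u} \<in> cedges vs" by (simp add: cedges_Cons)
    then have "adjacent u q" using polygon_bd_adjacent[OF assms] vs(4) adjacent_sym by blast
    then have "gadget_cycle vs" using cyc[OF vs(1,4)] v unfolding gadget_cycle_def by blast
    then show ?thesis using vs(2) by blast
  next
    case True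
    from polygon_gadget[OF assms True] show ?thesis unfolding gadget_def
    proof (elim disjE exE conjE)
      fix u p q v
      assume d: "distinct [u, p, q, v]" and e: "{u, p} \<in> bd T" "{p, q} \<in> bd T" "{q, v} \<in> bd T"
        and uq: "adjacent u q" "adjacent u v"
      from cycle_on_start[OF P'(5) e(1)] obtain c rest where
        r: "distinct (u # p # c # rest)" "set (u # p # c # rest) = S" "cedges (u # p # c # rest) = bd T" .
      have c: "c = q" using cedges_neighbours[OF r(1), of q] r(3) e(2) d by auto
      have "rest = [] \<or> adjacent u (hd rest)"
      proof (cases rest)
        case (Cons w rest')
        have "cedges (p # q # w # rest' @ [u]) = bd T"
          using r(3) c Cons cedges_append[of "[u]" "p # q # rest"] by simp
        moreover have "distinct (p # q # w # rest' @ [u])" using r(1) c Cons by auto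
        ultimately have "v = p \<or> v = w" using cedges_neighbours[of p q w "rest' @ [u]" v] e(3) by simp
        then show ?thesis using d uq(2) Cons by auto
      qed simp
      then have "gadget_cycle (u # p # q # rest)"
        using cyc[OF r(1,3)] uq(1) c unfolding gadget_cycle_def by blast
      then show ?thesis using r(2) c by blast
    next
      fix u p q r s
      assume d: "distinct [u, p, q, r, s]" and e: "{u, p} \<in> bd T" "{p, q} \<in> bd T" "{q, r} \<in> bd T" "{r, s} \<in> bd T"
        and uq: "adjacent u q" "adjacent u s"
      from cycle_on_start[OF P'(5) e(1)] obtain c rest where
        r: "distinct (u # p # c # rest)" "set (u # p # c # rest) = S" "cedges (u # p # c # rest) = bd T" .
      have c: "c = q" using cedges_neighbours[OF r(1), of q] r(3) e(2) d by auto
      have "rest = [] \<or> (\<exists>rest'. rest = r # s # rest')"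
      proof (cases rest)
        case (Cons w rest')
        have "cedges (p # q # w # rest' @ [u]) = bd T"
          using r(3) c Cons cedges_append[of "[u]" "p # q # rest"] by simp
        moreover have "distinct (p # q # w # rest' @ [u])" using r(1) c Cons by auto
        ultimately have "r = p \<or> r = w" using cedges_neighbours[of p q w "rest' @ [u]" r] e(3) by simp
        then have w: "w = r" using d by auto
        \<comment> \<open>\<open>z\<close> is the successor of \<open>r\<close> on the cycle; it
          wraps around to \<open>u\<close> when \<open>rest'\<close> is empty, which s = z then
          rules out.\<close>
        define z zs where "z = hd (rest' @ [u])" and "zs = tl (rest' @ [u]) @ [p]"
        have z: "rest' @ [u, p] = z # zs" by (cases rest') (auto simp: z_def zs_def)
        have "cedges (q # r # z # zs) = bd T"
          using r(3) c Cons w cedges_append[of "[u, p]" "q # rest"] z by simp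
        moreover have "distinct (q # r # z # zs)" using r(1) c Cons w unfolding z[symmetric] by auto
        ultimately have "s = q \<or> s = z" using cedges_neighbours[of q r z zs s] e(4) by simp
        then have "s = z" using d by auto
        then show ?thesis using d w Cons by (cases rest') (auto simp: z_def)
      qed simp
      then have "gadget_cycle (u # p # q # rest)"
        using cyc[OF r(1,3)] uq c unfolding gadget_cycle_def by blast
      then show ?thesis using r(2) c by blast
    qed
  qed
  then show ?thesis using that by blast
qed

section \<open>Extending a polygon to the whole board\<close>

definition link :: "cell set \<Rightarrow> cell \<Rightarrow> cell set" where
  "link B c = {n \<in> B. adjacent c n}"

text \<open>Connectivity in the form in which it is applied: each use needs an edge that leaves a
  given set.\<close>

definition cut_connected :: "cell set \<Rightarrow> bool" where
  "cut_connected B \<longleftrightarrow> (\<forall>A. A \<subseteq> B \<and> A \<noteq> {} \<and> A \<noteq> B \<longrightarrow> (\<exists>u\<in>A. \<exists>v\<in>B - A. adjacent u v))"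

text \<open>The polygon is maximal among all polygons on the board, not only among those extending
  \<open>T\<close>; so maximality remains available after relocations, which change \<open>T\<close>
  but not \<open>S\<close>.\<close>

definition stuck :: "cell set \<Rightarrow> cell set \<Rightarrow> cell set set \<Rightarrow> bool" where
  "stuck B S T \<longleftrightarrow> polygon S T \<and> S \<subseteq> B \<and> cut_connected B \<and> (\<forall>c\<in>B. cut_connected (link B c)) \<and>
    (\<forall>c. B \<noteq> star_of_david c) \<and> (\<forall>S' T'. polygon S' T' \<and> S' \<subseteq> B \<longrightarrow> card S' \<le> card S)"

section \<open>Symmetries of the cell lattice\<close>

definition lattice_iso :: "(cell \<Rightarrow> cell) \<Rightarrow> bool" where
  "lattice_iso f \<longleftrightarrow> bij f \<and> (\<forall>p q. adjacent (f p) (f q) \<longleftrightarrow> adjacent p q)"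

lemma lattice_isoD:
  assumes "lattice_iso f"
  shows "inj f" "surj f" "inj_on f A" "adjacent (f p) (f q) \<longleftrightarrow> adjacent p q"
  using assms unfolding lattice_iso_def bij_def by (auto intro: inj_on_subset)

lemma lattice_iso_inv: "lattice_iso f \<Longrightarrow> lattice_iso (inv f)"
  unfolding lattice_iso_def by (metis bij_imp_bij_inv bij_inv_eq_iff)

lemma pedges_map: "pedges (map f zs) = (`) f ` pedges zs"
  by (induction zs rule: pedges.induct) auto

lemma cedges_map: "cedges (map f vs) = (`) f ` cedges vs"
proof (cases vs)
  case (Cons v vs')
  then have "cedges (map f vs) = pedges (map f (v # vs' @ [v]))" by (simp add: cedges_Cons)
  then show ?thesis using Cons by (simp only: pedges_map cedges_Cons)
qed simp

lemma cycle_on_image: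
  assumes "cycle_on S C" "inj f"
  shows "cycle_on (f ` S) ((`) f ` C)"
proof -
  from assms obtain vs where "distinct vs" "set vs = S" "length vs \<ge> 3" "cedges vs = C"
    unfolding cycle_on_def by blast
  then show ?thesis unfolding cycle_on_def
    using assms(2) by (intro exI[of _ "map f vs"]) (auto simp: distinct_map cedges_map intro: inj_on_subset)
qed

lemma bd_image:
  fixes f :: "'a \<Rightarrow> 'b"
  assumes "inj f"
  shows "bd ((`) f ` T) = (`) f ` bd T"
proof -
  have inj': "inj ((`) f)" using assms by (simp add: inj_image_eq_iff inj_def)
  have *: "card {t \<in> (`) f ` T. {f a, f b} \<subseteq> t} = card {t \<in> T. {a, b} \<subseteq> t}" for a b
  proof -
    have "{t \<in> (`) f ` T. {f a, f b} \<subseteq> t} = (`) f ` {t \<in> T. {a, b} \<subseteq> t}"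
      using assms by (auto simp: inj_image_mem_iff dest: injD[OF assms])
    then show ?thesis using inj' by (simp add: card_image inj_on_subset)
  qed
  have "e \<in> bd ((`) f ` T) \<longleftrightarrow> e \<in> (`) f ` bd T" for e
  proof
    assume e: "e \<in> bd ((`) f ` T)"
    then obtain x y where xy: "e = {x, y}" unfolding bd_def by blast
    from bd_obtain[OF e[unfolded xy]] obtain t where "t \<in> (`) f ` T" "{x, y} \<subseteq> t" .
    then have "x \<in> range f" "y \<in> range f" by auto
    then obtain a b where "x = f a" "y = f b" by blast
    with e xy have "a \<noteq> b \<and> odd (card {t \<in> T. {a, b} \<subseteq> t})" using * bd_iff[of "f a" "f b"] \<open>x = f a\<close> \<open>y = f b\<close> by auto
    then have "{a, b} \<in> bd T" unfolding bd_iff .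
    then show "e \<in> (`) f ` bd T" using xy \<open>x = f a\<close> \<open>y = f b\<close> by (intro image_eqI[of _ _ "{a, b}"]) auto
  next
    assume "e \<in> (`) f ` bd T"
    then obtain d where d: "d \<in> bd T" "e = f ` d" by blast
    then obtain a b where ab: "d = {a, b}" unfolding bd_def by blast
    from d(1)[unfolded ab bd_iff] have "a \<noteq> b \<and> odd (card {t \<in> T. {a, b} \<subseteq> t})" .
    then have "{f a, f b} \<in> bd ((`) f ` T)" using assms unfolding bd_iff * by (simp add: inj_eq)
    then show "e \<in> bd ((`) f ` T)" using d(2) ab by simp
  qed
  then show ?thesis by (intro set_eqI)
qed

lemma polygon_image:
  assumes "polygon S T" "lattice_iso f"
  shows "polygon (f ` S) ((`) f ` T)"
proof -
  note P' = polygonD[OF assms(1)] and f = lattice_isoD[OF assms(2)]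
  have inj': "inj ((`) f)" using f(1) by (simp add: inj_image_eq_iff inj_def)
  have "unit_triangle (f ` t)" if "t \<in> T" for t
  proof -
    from P'(2)[OF that] obtain a b c where "t = {a, b, c}" "adjacent a b" "adjacent b c" "adjacent a c"
      unfolding unit_triangle_def by blast
    then have "f ` t = {f a, f b, f c} \<and> adjacent (f a) (f b) \<and> adjacent (f b) (f c) \<and> adjacent (f a) (f c)"
      using f(4) by simp
    then show ?thesis unfolding unit_triangle_def by blast
  qed
  moreover have "card ((`) f ` T) + 2 = card (f ` S)"
    using P'(4) inj' f(1) by (simp add: card_image inj_on_subset)
  moreover have "cycle_on (f ` S) (bd ((`) f ` T))"
    unfolding bd_image[OF f(1)] by (rule cycle_on_image[OF P'(5) f(1)])
  ultimately show ?thesis using P'(1,3) unfolding polygon_def by auto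
qed

lemma cut_connected_image:
  assumes "cut_connected B" "lattice_iso f"
  shows "cut_connected (f ` B)"
  unfolding cut_connected_def
proof (intro allI impI; elim conjE)
  note f = lattice_isoD[OF assms(2)]
  fix A assume A: "A \<subseteq> f ` B" "A \<noteq> {}" "A \<noteq> f ` B"
  define A' where "A' = {b \<in> B. f b \<in> A}"
  have im: "A = f ` A'" using A(1) by (auto simp: A'_def)
  then have "A' \<subseteq> B" "A' \<noteq> {}" "A' \<noteq> B" using A by (auto simp: A'_def)
  then obtain u v where uv: "u \<in> A'" "v \<in> B - A'" "adjacent u v"
    using assms(1) unfolding cut_connected_def by meson
  then have "f u \<in> A" "f v \<in> f ` B - A" "adjacent (f u) (f v)" using f(4) by (simp_all add: A'_def)
  then show "\<exists>u\<in>A. \<exists>v\<in>f ` B - A. adjacent u v"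
    by blast
qed

lemma link_image: "lattice_iso f \<Longrightarrow> link (f ` B) (f c) = f ` link B c"
  by (auto simp: link_def lattice_isoD(4))

lemma star_of_david_image:
  assumes "lattice_iso f"
  shows "star_of_david (f c) = f ` star_of_david c"
proof -
  note f = lattice_isoD[OF assms]
  have "f x \<in> star_of_david (f c) \<longleftrightarrow> x \<in> star_of_david c" for x
  proof -
    have "(\<exists>a b. adjacent (f c) a \<and> adjacent (f c) b \<and> adjacent a b \<and> adjacent (f x) a \<and> adjacent (f x) b) \<longleftrightarrow>
      (\<exists>a b. adjacent c a \<and> adjacent c b \<and> adjacent a b \<and> adjacent x a \<and> adjacent x b)"
      (is "?l \<longleftrightarrow> ?r")
    proof
      assume ?l
      then obtain a b where ab: "adjacent (f c) a" "adjacent (f c) b" "adjacent a b" "adjacent (f x) a" "adjacent (f x) b"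
        by blast
      obtain a' b' where "a = f a'" "b = f b'" using f(2) by (metis surj_def)
      with ab f(4) show ?r by auto
    next
      assume ?r
      then show ?l using f(4) by blast
    qed
    then show ?thesis using f(1,4) by (simp add: star_of_david_def inj_eq)
  qed
  then show ?thesis using f(2) by (metis inj_image_mem_iff[OF f(1)] set_eqI surj_def)
qed

lemma stuck_image:
  assumes "stuck B S T" "lattice_iso f"
  shows "stuck (f ` B) (f ` S) ((`) f ` T)"
proof -
  note f = lattice_isoD[OF assms(2)] and s = assms(1)[unfolded stuck_def]
  have "f ` B \<noteq> star_of_david c" for c
  proof -
    obtain c' where "c = f c'" using f(2) by (metis surj_def)
    then show ?thesis using s star_of_david_image[OF assms(2)] f(1) by (auto simp: inj_image_eq_iff)
  qed
  moreover have "card S' \<le> card (f ` S)" if P: "polygon S' T'" and S': "S' \<subseteq> f ` B" for S' T'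
  proof -
    note f' = lattice_iso_inv[OF assms(2)]
    have "inv f ` S' \<subseteq> B" using S' f(1) by auto
    with s polygon_image[OF P f'] have "card (inv f ` S') \<le> card S" by blast
    then show ?thesis using lattice_isoD(3)[OF f'] f(3) by (simp add: card_image)
  qed
  moreover have "\<forall>c\<in>f ` B. cut_connected (link (f ` B) c)"
    using s link_image[OF assms(2)] cut_connected_image[OF _ assms(2)] by auto
  ultimately show ?thesis
    using s polygon_image[OF _ assms(2)] cut_connected_image[OF _ assms(2)] unfolding stuck_def by auto
qed

text \<open>\<open>U\<close> may be any triangulation on the same cells. This makes relocations
  useful: once they bring an edge to the boundary, its common neighbours on the board have to be
  covered already.\<close>

lemma stuck_insert:
  assumes "stuck B S T" "polygon S U" "{p, q} \<in> bd U" "z \<in> B" "adjacent z p" "adjacent z q"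
  shows "z \<in> S"
proof (rule ccontr)
  assume z: "z \<notin> S"
  have "card (insert z S) \<le> card S"
    using assms(1) polygon_insert(1)[OF assms(2,3) z assms(5,6)] assms(4) unfolding stuck_def by blast
  moreover have "finite S" using card_cycle_on(4) polygonD(5) assms(2) by blast
  ultimately show False using z by simp
qed

lemma relocate_convex:
  assumes "polygon S T" "card S \<ge> 4" "{a, m, b} \<in> T" "{a, m} \<in> bd T" "{m, b} \<in> bd T" "a \<noteq> b"
    "{u, v} \<in> bd T" "m \<noteq> u" "m \<noteq> v" "adjacent m u" "adjacent m v"
  shows "polygon S (insert {u, m, v} (T - {{a, m, b}}))"
    "bd (insert {u, m, v} (T - {{a, m, b}})) = bd T - {{a, m}, {m, b}, {u, v}} \<union> {{a, b}, {u, m}, {m, v}}"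
  using polygon_relocate_convex[OF assms(1,3-5) cycle_on_no_triangle[OF polygonD(5)[OF assms(1)] assms(2,4-6)] assms(7-11)]
  by simp_all

lemma relocate_reflex:
  assumes "polygon S T" "card S \<ge> 4" "{a, m, b} \<notin> T" "adjacent a b" "{a, m} \<in> bd T" "{m, b} \<in> bd T"
    "{u, v} \<in> bd T" "{u, m, v} \<in> T" "m \<noteq> u" "m \<noteq> v"
  shows "polygon S (insert {a, m, b} (T - {{u, m, v}}))"
    "bd (insert {a, m, b} (T - {{u, m, v}})) = bd T - {{a, m}, {m, b}, {u, v}} \<union> {{a, b}, {u, m}, {m, v}}"
  using polygon_relocate_reflex[OF assms(1,3-6) cycle_on_no_triangle[OF polygonD(5)[OF assms(1)] assms(2,5,6) adjacent_neq[OF assms(4)]] assms(7-10)]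
  by simp_all

lemma pedges_closed:
  assumes "\<And>p z. p \<in> A \<Longrightarrow> {p, z} \<in> C \<Longrightarrow> z \<in> A" "pedges zs \<subseteq> C" "zs \<noteq> [] \<Longrightarrow> hd zs \<in> A"
  shows "set zs \<subseteq> A"
  using assms(2,3) by (induction zs rule: pedges.induct) (use assms(1) in auto)

text \<open>At each vertex of \<open>ws\<close> the two edges of \<open>ws\<close> are the only
  edges of \<open>C\<close>, so walking along \<open>C\<close> never leaves
  \<open>ws\<close>.\<close>

lemma cycle_on_subcycle:
  assumes C: "cycle_on S C" and ws: "distinct ws" "length ws \<ge> 3" "cedges ws \<subseteq> C"
  shows "set ws = S"
proof -
  have ws_on: "cycle_on (set ws) (cedges ws)" unfolding cycle_on_def using ws by blast
  have sub: "set ws \<subseteq> S"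
  proof
    fix p assume "p \<in> set ws"
    from cycle_on_neighbours[OF ws_on this] obtain a where "{p, a} \<in> cedges ws" by metis
    with ws(3) cycle_on_edge(2)[OF C] show "p \<in> S" by blast
  qed
  have closed: "z \<in> set ws" if p: "p \<in> set ws" "{p, z} \<in> C" for p z
  proof -
    from cycle_on_neighbours[OF ws_on p(1)] obtain a b where
      ab: "a \<noteq> b" "\<And>z. {p, z} \<in> cedges ws \<longleftrightarrow> z = a \<or> z = b" by blast
    from cycle_on_neighbours[OF C] sub p(1) obtain a' b' where
      ab': "a' \<noteq> b'" "\<And>z. {p, z} \<in> C \<longleftrightarrow> z = a' \<or> z = b'" by blast
    have "{p, a} \<in> C" "{p, b} \<in> C" using ws(3) ab(2) by auto
    with ab ab' p(2) have "{p, z} \<in> cedges ws" by metis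
    then show ?thesis using cycle_on_edge(3)[OF ws_on] by blast
  qed
  from C obtain vs where vs: "distinct vs" "set vs = S" "cedges vs = C" unfolding cycle_on_def by blast
  obtain p where p: "p \<in> set ws" using ws(2) by (cases ws) auto
  with sub vs(2) have "p \<in> set vs" by blast
  from distinct_cycle_at[OF this vs(1)] obtain i xs where xs: "rotate i vs = p # xs" .
  have "pedges (p # xs) \<subseteq> cedges (p # xs)" by (rule pedges_subset_cedges)
  also have "cedges (p # xs) = C" using xs vs(3) by (metis cedges_rotate)
  finally have "pedges (p # xs) \<subseteq> C" .
  then have "set (p # xs) \<subseteq> set ws" using pedges_closed[of "set ws" C "p # xs"] closed p by auto
  moreover have "set (p # xs) = S" using xs vs(2) by (metis set_rotate)
  ultimately show ?thesis using sub by auto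
qed

lemma adjacent_cases:
  "adjacent (i, j) z \<Longrightarrow>
    z \<in> {(i + 1, j), (i, j + 1), (i - 1, j + 1), (i - 1, j), (i, j - 1), (i + 1, j - 1)}"
proof -
  assume "adjacent (i, j) z"
  then have "(i, j) + (z - (i, j)) \<in>
      {(i + 1, j), (i, j + 1), (i - 1, j + 1), (i - 1, j), (i, j - 1), (i + 1, j - 1)}"
    unfolding adjacent_def hex_directions_def by (elim insertE emptyE) simp_all
  then show ?thesis by simp
qed

text \<open>Coordinates: \<open>c = (0, 0)\<close>, \<open>x = (1, 0)\<close> and the uncovered cell \<open>w = (0, 1)\<close> form a triangle;
  \<open>y = (1, -1)\<close> is the other common neighbour of \<open>c\<close> and \<open>x\<close>.\<close>

lemma stuck_second_triangle:
  assumes st: "stuck B S T" and cx: "(0, 0) \<in> S" "(1, 0) \<in> S" and w: "(0, 1) \<in> B" "(0, 1) \<notin> S"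
    and cdy: "{(0, 0), (0, -1), (1, -1)} \<in> T"
  shows False
proof -
  have P: "polygon S T" and SB: "S \<subseteq> B" using st by (auto simp: stuck_def)
  note P' = polygonD[OF P]
  note C = P'(5)
  have dy: "(0, -1) \<in> S" "(1, -1) \<in> S" using P'(3)[OF cdy] by auto
  have "card {(0, 0), (1, 0), (0, -1), (1, -1) :: cell} \<le> card S"
    using cx dy card_cycle_on(4)[OF C] by (intro card_mono) auto
  then have S4: "card S \<ge> 4" by simp
  have NI: "z \<in> S" if "{p, q} \<in> bd T" "z \<in> B" "adjacent z p" "adjacent z q" for p q z
    using stuck_insert[OF st P that] .
  let ?c = "(0, 0) :: cell" and ?x = "(1, 0) :: cell" and ?w = "(0, 1) :: cell" and ?y = "(1, -1) :: cell"
  let ?a = "(-1, 1) :: cell" and ?b = "(-1, 0) :: cell" and ?d = "(0, -1) :: cell"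
  let ?a' = "(1, 1) :: cell" and ?b' = "(2, 0) :: cell" and ?d' = "(2, -1) :: cell"
  let ?y1 = "(1, -2) :: cell" and ?y2 = "(2, -2) :: cell"
  let ?t1 = "(0, -2) :: cell" and ?t2 = "(2, -3) :: cell" and ?t3 = "(3, -2) :: cell"
  let ?g1 = "(-1, -1) :: cell" and ?g2 = "(1, -3) :: cell" and ?g3 = "(3, -3) :: cell" and ?g4 = "(3, -1) :: cell"
  note adj_simps = adjacent_plus hex_directions_def
  \<comment> \<open>The aim of all that follows: once {c, x} is a boundary edge of some polygon on
    \<open>S\<close>, the cell \<open>w\<close> can be glued to it.\<close>
  have no_cx: False if "polygon S U" "{?c, ?x} \<in> bd U" for U
    using stuck_insert[OF st that w(1)] w(2) by (simp add: adj_simps)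
  have now: "t \<notin> T" if "?w \<in> t" for t using P'(3)[of t] that w(2) by auto
  have ncx: "{?c, ?x} \<notin> bd T" using no_cx P by blast
  have nca: "{?c, ?a} \<notin> bd T" "{?x, ?a'} \<notin> bd T"
    using NI[of ?c ?a ?w] NI[of ?x ?a' ?w] w by (auto simp: adj_simps)
  note edge = polygon_bd_iff[OF P]
  have e_c: "{?c, ?x} \<in> bd T \<longleftrightarrow> ({?c, ?x, ?w} \<in> T) \<noteq> ({?c, ?x, ?y} \<in> T)"
    "{?c, ?a} \<in> bd T \<longleftrightarrow> ({?c, ?a, ?b} \<in> T) \<noteq> ({?c, ?a, ?w} \<in> T)"
    "{?c, ?b} \<in> bd T \<longleftrightarrow> ({?c, ?b, ?d} \<in> T) \<noteq> ({?c, ?a, ?b} \<in> T)"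
    "{?c, ?d} \<in> bd T \<longleftrightarrow> ({?c, ?d, ?y} \<in> T) \<noteq> ({?c, ?b, ?d} \<in> T)"
    "{?c, ?y} \<in> bd T \<longleftrightarrow> ({?c, ?x, ?y} \<in> T) \<noteq> ({?c, ?d, ?y} \<in> T)"
    by (subst edge; simp add: adj_simps rot60_def insert_commute)+
  have e_x: "{?x, ?a'} \<in> bd T \<longleftrightarrow> ({?x, ?a', ?w} \<in> T) \<noteq> ({?x, ?a', ?b'} \<in> T)"
    "{?x, ?b'} \<in> bd T \<longleftrightarrow> ({?x, ?a', ?b'} \<in> T) \<noteq> ({?x, ?b', ?d'} \<in> T)"
    "{?x, ?d'} \<in> bd T \<longleftrightarrow> ({?x, ?b', ?d'} \<in> T) \<noteq> ({?x, ?d', ?y} \<in> T)"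
    "{?x, ?y} \<in> bd T \<longleftrightarrow> ({?x, ?d', ?y} \<in> T) \<noteq> ({?c, ?x, ?y} \<in> T)"
    by (subst edge; simp add: adj_simps rot60_def insert_commute)+
  have e_y: "{?y, ?d} \<in> bd T \<longleftrightarrow> ({?y, ?d, ?y1} \<in> T) \<noteq> ({?c, ?d, ?y} \<in> T)"
    "{?y, ?y1} \<in> bd T \<longleftrightarrow> ({?y, ?y1, ?y2} \<in> T) \<noteq> ({?y, ?d, ?y1} \<in> T)"
    "{?y, ?y2} \<in> bd T \<longleftrightarrow> ({?y, ?y2, ?d'} \<in> T) \<noteq> ({?y, ?y1, ?y2} \<in> T)"
    "{?y, ?d'} \<in> bd T \<longleftrightarrow> ({?x, ?d', ?y} \<in> T) \<noteq> ({?y, ?y2, ?d'} \<in> T)"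
    by (subst edge; simp add: adj_simps rot60_def insert_commute)+
  \<comment> \<open>No triangle contains \<open>w\<close>, and {c, x}, {c, a}, {x, a'} are not
    boundary edges because \<open>w\<close> could be glued to them. So the triangles on their other
    sides are missing too.\<close>
  have base: "{?c, ?x, ?w} \<notin> T" "{?c, ?a, ?w} \<notin> T" "{?x, ?a', ?w} \<notin> T" "{?c, ?x, ?y} \<notin> T"
    "{?c, ?a, ?b} \<notin> T" "{?x, ?a', ?b'} \<notin> T" "{?c, ?d, ?y} \<in> T"
    using now e_c(1,2) e_x(1) ncx nca cdy by (simp_all add: insert_commute)
  have yS: "?y \<in> S" and dS: "?d \<in> S" using dy by auto
  have fan_x: "{?x, ?b', ?d'} \<in> T \<or> {?x, ?d', ?y} \<in> T"
    using polygon_fan(7)[OF P cx(2)] base by (cases "{?x, ?b', ?d'} \<in> T"; cases "{?x, ?d', ?y} \<in> T") (simp_all add: insert_commute now)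
  have cy: "{?c, ?y} \<in> bd T" using e_c(5) base by simp

  \<comment> \<open>Otherwise \<open>x\<close> is the tip of an ear over b', d', and relocating it
    to the boundary edge {c, y} brings {c, x} to the boundary. The claims \<open>cbd\<close> and
    \<open>xbd\<close> follow in the same way, by relocating \<open>c\<close> to {x, y} and
    \<open>x\<close> to {c, y}.\<close>
  have xd'y: "{?x, ?d', ?y} \<in> T"
  proof (rule ccontr)
    assume n: "{?x, ?d', ?y} \<notin> T"
    then have "{?b', ?x, ?d'} \<in> T" "{?b', ?x} \<in> bd T" "{?x, ?d'} \<in> bd T"
      using fan_x e_x base by (simp_all add: insert_commute)
    from relocate_convex[OF P S4 this _ cy] no_cx show False by (auto simp: adj_simps)
  qed
  have xy: "{?x, ?y} \<in> bd T" using e_x(4) xd'y base by simp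
  have cbd: "{?c, ?b, ?d} \<in> T"
  proof (rule ccontr)
    assume n: "{?c, ?b, ?d} \<notin> T"
    then have "{?d, ?c, ?y} \<in> T" "{?d, ?c} \<in> bd T" "{?c, ?y} \<in> bd T"
      using e_c base by (simp_all add: insert_commute)
    from relocate_convex[OF P S4 this _ xy] no_cx show False by (auto simp: adj_simps insert_commute)
  qed
  have xbd: "{?x, ?b', ?d'} \<in> T"
  proof (rule ccontr)
    assume n: "{?x, ?b', ?d'} \<notin> T"
    then have "{?y, ?x, ?d'} \<in> T" "{?y, ?x} \<in> bd T" "{?x, ?d'} \<in> bd T"
      using e_x xd'y base by (simp_all add: insert_commute)
    from relocate_convex[OF P S4 this _ cy] no_cx show False by (auto simp: adj_simps insert_commute)
  qed
  \<comment> \<open>At \<open>y\<close> the sector between \<open>c\<close> and \<open>x\<close> is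
    empty and both sectors next to it are filled. The triangles form one fan, so the other three
    sectors are filled, and \<open>y\<close> is a reflex corner with a gap of 60 degrees.\<close>
  have yT: "{?y, ?d, ?y1} \<in> T" "{?y, ?y1, ?y2} \<in> T" "{?y, ?y2, ?d'} \<in> T"
    using polygon_fan(7)[OF P yS] base xd'y
    by (cases "{?y, ?d, ?y1} \<in> T"; cases "{?y, ?y1, ?y2} \<in> T"; cases "{?y, ?y2, ?d'} \<in> T"; simp add: insert_commute)+
  have yx: "{?y, ?x} \<in> bd T" using xy by (simp add: insert_commute)
  \<comment> \<open>Relocating \<open>y\<close> into a boundary edge {u, v} opposite to it fills the
    gap with the triangle c, y, x and brings {c, x} to the boundary. It is stated for arbitrary
    \<open>U\<close> because \<open>no_reflex\<close> applies it after another relocation.\<close>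
  have reloc_y: False
    if U: "polygon S U" "{?c, ?y, ?x} \<notin> U" "{?c, ?y} \<in> bd U" "{?y, ?x} \<in> bd U"
      and uv: "{u, v} \<in> bd U" "{u, ?y, v} \<in> U" "?y \<noteq> u" "?y \<noteq> v" for u v U
    using relocate_reflex[OF U(1) S4 U(2) _ U(3,4) uv] no_cx by (auto simp: adj_simps)
  have cyx: "{?c, ?y, ?x} \<notin> T" using base by (simp add: insert_commute)
  \<comment> \<open>So the three far sides of the hexagon around \<open>y\<close> are not boundary
    edges, and each carries a second triangle: a point of the star.\<close>
  have ring: "{?d, ?y1} \<notin> bd T" "{?y1, ?y2} \<notin> bd T" "{?y2, ?d'} \<notin> bd T"
    using reloc_y[OF P cyx cy yx, of ?d ?y1] reloc_y[OF P cyx cy yx, of ?y1 ?y2] reloc_y[OF P cyx cy yx, of ?y2 ?d'] yT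
    by (auto simp: insert_commute)
  have "{?d, ?y1} \<in> bd T \<longleftrightarrow> ({?y, ?d, ?y1} \<in> T) \<noteq> ({?d, ?y1, ?t1} \<in> T)"
    "{?y1, ?y2} \<in> bd T \<longleftrightarrow> ({?y, ?y1, ?y2} \<in> T) \<noteq> ({?y1, ?y2, ?t2} \<in> T)"
    "{?y2, ?d'} \<in> bd T \<longleftrightarrow> ({?y, ?y2, ?d'} \<in> T) \<noteq> ({?y2, ?d', ?t3} \<in> T)"
    by (subst edge; simp add: adj_simps rot60_def insert_commute)+
  with ring yT have tips: "{?d, ?y1, ?t1} \<in> T" "{?y1, ?y2, ?t2} \<in> T" "{?y2, ?d', ?t3} \<in> T" by auto
  \<comment> \<open>Two relocations in a row: if a ring cell u' is itself a reflex corner with a gap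
    of 60 degrees, moving it into {u, \<tau>} brings {u, u'} to the boundary, and \<open>y\<close>
    can then be moved into {u, u'}.\<close>
  have no_reflex: False
    if t: "{u, u', \<tau>} \<in> T" "{u, \<tau>} \<in> bd T" "{u, ?y, u'} \<in> T" and ab: "{a, u', b} \<notin> T" "adjacent a b"
      "{a, u'} \<in> bd T" "{u', b} \<in> bd T" and ne: "u' \<notin> {?c, ?x, ?y}" "?y \<notin> {u, \<tau>}" "u' \<noteq> u" "u' \<noteq> \<tau>"
    for u u' \<tau> a b
  proof -
    have ut: "{u, u', \<tau>} \<noteq> {u, ?y, u'}" using ne by auto
    note R = relocate_reflex[OF P S4 ab(1,2,3,4) t(2,1) ne(3,4)]
    show False
    proof (rule reloc_y[OF R(1)])
      show "{?c, ?y, ?x} \<notin> insert {a, u', b} (T - {{u, u', \<tau>}})"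
        using cyx ne(1) by blast
      have "{?c, ?y} \<noteq> f \<and> {?y, ?x} \<noteq> f" if "f \<in> {{a, u'}, {u', b}, {u, \<tau>}}" for f
      proof -
        have "u' \<in> f \<or> ?y \<notin> f" using that ne by blast
        then show ?thesis using ne(1) by blast
      qed
      then show "{?c, ?y} \<in> bd (insert {a, u', b} (T - {{u, u', \<tau>}}))" "{?y, ?x} \<in> bd (insert {a, u', b} (T - {{u, u', \<tau>}}))"
        unfolding R(2) using cy yx by blast+
      show "{u, u'} \<in> bd (insert {a, u', b} (T - {{u, u', \<tau>}}))" unfolding R(2) by blast
      show "{u, ?y, u'} \<in> insert {a, u', b} (T - {{u, u', \<tau>}})" using t(3) ut by blast
    qed (use ne in auto)
  qed
  have SS: "?y1 \<in> S" "?y2 \<in> S" "?d' \<in> S" using P'(3)[OF yT(2)] P'(3)[OF yT(3)] by auto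
  have e_d: "{?d, ?b} \<in> bd T \<longleftrightarrow> ({?d, ?b, ?g1} \<in> T) \<noteq> ({?c, ?b, ?d} \<in> T)"
    "{?d, ?g1} \<in> bd T \<longleftrightarrow> ({?d, ?g1, ?t1} \<in> T) \<noteq> ({?d, ?b, ?g1} \<in> T)"
    "{?d, ?t1} \<in> bd T \<longleftrightarrow> ({?d, ?y1, ?t1} \<in> T) \<noteq> ({?d, ?g1, ?t1} \<in> T)"
    by (subst edge; simp add: adj_simps rot60_def insert_commute)+
  have e_y1: "{?y1, ?t1} \<in> bd T \<longleftrightarrow> ({?y1, ?t1, ?g2} \<in> T) \<noteq> ({?d, ?y1, ?t1} \<in> T)"
    "{?y1, ?g2} \<in> bd T \<longleftrightarrow> ({?y1, ?g2, ?t2} \<in> T) \<noteq> ({?y1, ?t1, ?g2} \<in> T)"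
    "{?y1, ?t2} \<in> bd T \<longleftrightarrow> ({?y1, ?y2, ?t2} \<in> T) \<noteq> ({?y1, ?g2, ?t2} \<in> T)"
    by (subst edge; simp add: adj_simps rot60_def insert_commute)+
  have e_y2: "{?y2, ?t2} \<in> bd T \<longleftrightarrow> ({?y2, ?t2, ?g3} \<in> T) \<noteq> ({?y1, ?y2, ?t2} \<in> T)"
    "{?y2, ?g3} \<in> bd T \<longleftrightarrow> ({?y2, ?g3, ?t3} \<in> T) \<noteq> ({?y2, ?t2, ?g3} \<in> T)"
    "{?y2, ?t3} \<in> bd T \<longleftrightarrow> ({?y2, ?d', ?t3} \<in> T) \<noteq> ({?y2, ?g3, ?t3} \<in> T)"
    by (subst edge; simp add: adj_simps rot60_def insert_commute)+
  have e_d': "{?d', ?t3} \<in> bd T \<longleftrightarrow> ({?d', ?t3, ?g4} \<in> T) \<noteq> ({?y2, ?d', ?t3} \<in> T)"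
    "{?d', ?g4} \<in> bd T \<longleftrightarrow> ({?d', ?g4, ?b'} \<in> T) \<noteq> ({?d', ?t3, ?g4} \<in> T)"
    "{?d', ?b'} \<in> bd T \<longleftrightarrow> ({?x, ?b', ?d'} \<in> T) \<noteq> ({?d', ?g4, ?b'} \<in> T)"
    by (subst edge; simp add: adj_simps rot60_def insert_commute)+
  have cb: "{?c, ?b} \<in> bd T" using e_c(3) cbd base by simp
  \<comment> \<open>Two filled sectors would complete the fan at \<open>v\<close>, and a single one
    would leave the gap that \<open>no_reflex\<close> excludes. With both empty, {v, \<tau>'} is a
    boundary edge, which is the premise on {u, \<tau>} for the next cell of the ring.\<close>
  have no_g: "{v, \<tau>, g} \<notin> T \<and> {v, g, \<tau>'} \<notin> T"
    if fan: "\<not> ({v, \<tau>, g} \<in> T \<and> {v, g, \<tau>'} \<in> T)"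
      and e: "{v, \<tau>} \<in> bd T \<longleftrightarrow> {v, \<tau>, g} \<notin> T" "{v, g} \<in> bd T \<longleftrightarrow> ({v, g, \<tau>'} \<in> T) \<noteq> ({v, \<tau>, g} \<in> T)"
        "{v, \<tau>'} \<in> bd T \<longleftrightarrow> {v, g, \<tau>'} \<notin> T"
      and t: "{u, v, \<tau>} \<in> T" "{u, \<tau>} \<in> bd T" "{u, ?y, v} \<in> T" "adjacent \<tau> g" "adjacent g \<tau>'"
      and ne: "v \<notin> {?c, ?x, ?y}" "?y \<notin> {u, \<tau>}" "v \<noteq> u" "v \<noteq> \<tau>" for u v \<tau> \<tau>' g
  proof (rule ccontr)
    assume "\<not> ?thesis"
    with fan consider "{v, \<tau>, g} \<in> T" "{v, g, \<tau>'} \<notin> T" | "{v, \<tau>, g} \<notin> T" "{v, g, \<tau>'} \<in> T" by blast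
    then show False
    proof cases
      case 1
      then have "{g, v, \<tau>'} \<notin> T" "{g, v} \<in> bd T" "{v, \<tau>'} \<in> bd T" using e by (simp_all add: insert_commute)
      from no_reflex[OF t(1-3) this(1) t(5) this(2,3) ne] show False .
    next
      case 2
      then have "{\<tau>, v, g} \<notin> T" "{\<tau>, v} \<in> bd T" "{v, g} \<in> bd T" using e by (simp_all add: insert_commute)
      from no_reflex[OF t(1-3) this(1) t(4) this(2,3) ne] show False .
    qed
  qed
  have no_g1: "{?d, ?b, ?g1} \<notin> T \<and> {?d, ?g1, ?t1} \<notin> T"
    by (rule no_g[of ?d ?b ?g1 ?t1 ?c])
      (use polygon_fan(7)[OF P dS] base cbd cb tips yT e_d in \<open>auto simp: insert_commute adj_simps\<close>)
  then have dt1: "{?d, ?t1} \<in> bd T" using e_d tips by simp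
  have no_g2: "{?y1, ?t1, ?g2} \<notin> T \<and> {?y1, ?g2, ?t2} \<notin> T"
    by (rule no_g[of ?y1 ?t1 ?g2 ?t2 ?d])
      (use polygon_fan(7)[OF P SS(1)] dt1 tips yT e_y1 in \<open>auto simp: insert_commute adj_simps\<close>)
  then have y1t2: "{?y1, ?t2} \<in> bd T" using e_y1 tips by simp
  have no_g3: "{?y2, ?t2, ?g3} \<notin> T \<and> {?y2, ?g3, ?t3} \<notin> T"
    by (rule no_g[of ?y2 ?t2 ?g3 ?t3 ?y1])
      (use polygon_fan(7)[OF P SS(2)] y1t2 tips yT e_y2 in \<open>auto simp: insert_commute adj_simps\<close>)
  then have y2t3: "{?y2, ?t3} \<in> bd T" using e_y2 tips by simp
  have no_g4: "{?d', ?t3, ?g4} \<notin> T \<and> {?d', ?g4, ?b'} \<notin> T"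
    by (rule no_g[of ?d' ?t3 ?g4 ?b' ?y2])
      (use polygon_fan(7)[OF P SS(3)] y2t3 tips yT xbd xd'y e_d' in \<open>auto simp: insert_commute adj_simps\<close>)
  \<comment> \<open>These twelve edges all lie on the boundary, so they are the whole boundary, and
    \<open>S\<close> is the star around \<open>y\<close> without \<open>w\<close>.\<close>
  let ?ws = "[?y, ?c, ?b, ?d, ?t1, ?y1, ?t2, ?y2, ?t3, ?d', ?b', ?x]"
  have edges: "{?y, ?c} \<in> bd T" "{?c, ?b} \<in> bd T" "{?b, ?d} \<in> bd T" "{?d, ?t1} \<in> bd T" "{?t1, ?y1} \<in> bd T"
    "{?y1, ?t2} \<in> bd T" "{?t2, ?y2} \<in> bd T" "{?y2, ?t3} \<in> bd T" "{?t3, ?d'} \<in> bd T" "{?d', ?b'} \<in> bd T"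
    "{?b', ?x} \<in> bd T" "{?x, ?y} \<in> bd T"
    using cy cb dt1 y1t2 y2t3 xy e_d e_y1 e_y2 e_d' e_x(2) no_g1 no_g2 no_g3 no_g4 tips cbd xbd base
    by (simp_all add: insert_commute)
  then have "cedges ?ws \<subseteq> bd T" by (simp add: cedges_Cons)
  from cycle_on_subcycle[OF C _ _ this] have S: "S = set ?ws" by simp
  have star: "star_of_david ?y = insert ?w S"
    unfolding S star_of_david_eq by (auto simp: hex_directions_def rot60_def)
  have "B \<noteq> star_of_david ?y" using st by (simp add: stuck_def)
  moreover have "star_of_david ?y \<subseteq> B" "star_of_david ?y \<noteq> {}" unfolding star using w SB by auto
  \<comment> \<open>Since \<open>B\<close> is not the star, connectivity yields a board cell
    \<open>z\<close> outside the star beside a cell \<open>s\<close> of it. Every position of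
    \<open>s\<close> will contradict maximality.\<close>
  ultimately obtain s z where sz: "s \<in> star_of_david ?y" "z \<in> B" "z \<notin> star_of_david ?y" "adjacent s z"
    using st unfolding stuck_def cut_connected_def by (metis DiffE)
  have link: "cut_connected (link B p)" if "p \<in> B" for p using st that by (simp add: stuck_def)
  have zS: "z \<notin> S" using sz(3) star by simp
  have NIz: False if "{p, q} \<in> bd T" "adjacent z p" "adjacent z q" for p q
    using NI[OF that(1) sz(2) that(2,3)] zS by blast
  \<comment> \<open>The tip \<tau> has just two covered neighbours, both along boundary edges. As
    \<open>z\<close> belongs to its link too, connectivity of the link gives a common neighbour of
    \<tau> and one of the two; by maximality it is covered, hence a third covered neighbour.\<close>
  have tip: False
    if t: "{u, \<tau>} \<in> bd T" "{\<tau>, u'} \<in> bd T" "s = \<tau>" "\<And>v. v \<in> S \<Longrightarrow> adjacent \<tau> v \<Longrightarrow> v = u \<or> v = u'" for u \<tau> u'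
  proof -
    have S3: "\<tau> \<in> S" "u \<in> S" "u' \<in> S" using cycle_on_edge[OF C] t by blast+
    have "adjacent \<tau> u" "adjacent \<tau> u'" using polygon_bd_adjacent[OF P] t(1,2) adjacent_sym by blast+
    then have "{u, u'} \<subseteq> link B \<tau>" "{u, u'} \<noteq> link B \<tau>"
      using S3 SB sz(2,4) t(3) zS by (auto simp: link_def)
    with link[of \<tau>] S3 SB obtain p v where "p \<in> {u, u'}" "v \<in> link B \<tau> - {u, u'}" "adjacent p v"
      unfolding cut_connected_def by (metis insert_not_empty subsetD)
    moreover have "{\<tau>, p} \<in> bd T" using \<open>p \<in> {u, u'}\<close> t(1,2) by (auto simp: insert_commute)
    ultimately show False using NI[of \<tau> p v] t(4)[of v] adjacent_sym by (auto simp: link_def)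
  qed
  have in_S: "v \<in> S \<longleftrightarrow> v \<in> set ?ws" for v using S by simp
  consider "s = ?w" | "s = ?y" | "s \<in> {?c, ?d, ?y1, ?y2, ?d', ?x}" | "s \<in> {?b, ?t1, ?t2, ?t3, ?b'}"
    using sz(1) unfolding star S by auto
  then show False
  proof cases
    case 1
    \<comment> \<open>The link of \<open>w\<close> contains \<open>z\<close> besides
      \<open>c\<close> and \<open>x\<close>; its connectivity yields the cell a or a', which could
      be glued to {c, b} or {b', x}.\<close>
    have "z \<in> link B ?w" "z \<notin> {?c, ?x}" using cx sz(2,4) zS 1 by (auto simp: link_def)
    moreover have "{?c, ?x} \<subseteq> link B ?w" using cx SB by (auto simp: link_def adj_simps)
    ultimately have "{?c, ?x} \<subseteq> link B ?w" "{?c, ?x} \<noteq> link B ?w" by blast+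
    with link[OF w(1)] obtain p v where pv: "p \<in> {?c, ?x}" "v \<in> link B ?w - {?c, ?x}" "adjacent p v"
      unfolding cut_connected_def by (metis insert_not_empty)
    then have v: "v \<in> B" "adjacent ?w v" "v \<noteq> ?c" "v \<noteq> ?x" by (auto simp: link_def)
    have "v \<notin> S" using adjacent_cases[OF v(2)] v(3,4)
      by (elim insertE emptyE; hypsubst_thin; simp add: in_S)
    from adjacent_cases[OF v(2)] pv(1,3) v(3,4) have "v = ?a \<or> v = ?a'"
      by (auto simp: adj_simps)
    then show False
      using NI[OF edges(2) v(1)] NI[OF edges(11) v(1)] \<open>v \<notin> S\<close> by (auto simp: adj_simps)
  next
    case 2
    from adjacent_cases[OF sz(4)[unfolded 2]] zS show False unfolding in_S by auto
  next
    case 3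
    have out: "z \<notin> set ?ws" "z \<noteq> ?w" using zS sz(3) unfolding star in_S by auto
    have "z \<in> {?a, ?g1, ?g2, ?g3, ?g4, ?a'}"
      if "s = (i, j)" "(i, j) \<in> {?c, ?d, ?y1, ?y2, ?d', ?x}" for i j
      using that(2) adjacent_cases[OF sz(4)[unfolded that(1)]] out
      by (elim insertE emptyE; hypsubst_thin; simp)
    with 3 have "z \<in> {?a, ?g1, ?g2, ?g3, ?g4, ?a'}" by (cases s) metis
    then show False
      using NIz[OF edges(2)] NIz[OF edges(4)] NIz[OF edges(5)] NIz[OF edges(7)] NIz[OF edges(9)] NIz[OF edges(11)]
      by (auto simp: adj_simps)
  next
    case 4
    have "v = ?c \<or> v = ?d" if "v \<in> S" "adjacent ?b v" for v
      using adjacent_cases[OF that(2)] that(1)[unfolded in_S]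
      by (elim insertE emptyE; hypsubst_thin; simp)
    then have "s \<noteq> ?b" using tip[OF edges(2,3)] by blast
    moreover
    have "v = ?d \<or> v = ?y1" if "v \<in> S" "adjacent ?t1 v" for v
      using adjacent_cases[OF that(2)] that(1)[unfolded in_S]
      by (elim insertE emptyE; hypsubst_thin; simp)
    then have "s \<noteq> ?t1" using tip[OF edges(4,5)] by blast
    moreover
    have "v = ?y1 \<or> v = ?y2" if "v \<in> S" "adjacent ?t2 v" for v
      using adjacent_cases[OF that(2)] that(1)[unfolded in_S]
      by (elim insertE emptyE; hypsubst_thin; simp)
    then have "s \<noteq> ?t2" using tip[OF edges(6,7)] by blast
    moreover
    have "v = ?y2 \<or> v = ?d'" if "v \<in> S" "adjacent ?t3 v" for v
      using adjacent_cases[OF that(2)] that(1)[unfolded in_S]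
      by (elim insertE emptyE; hypsubst_thin; simp)
    then have "s \<noteq> ?t3" using tip[OF edges(8,9)] by blast
    moreover
    have "v = ?d' \<or> v = ?x" if "v \<in> S" "adjacent ?b' v" for v
      using adjacent_cases[OF that(2)] that(1)[unfolded in_S]
      by (elim insertE emptyE; hypsubst_thin; simp)
    then have "s \<noteq> ?b'" using tip[OF edges(10,11)] by blast
    ultimately show False using 4 by blast
  qed
qed

lemma set_neqI: "x \<in> A \<Longrightarrow> x \<notin> B \<Longrightarrow> A \<noteq> B"
  by blast

text \<open>With the triangle c, d, y excluded, \<open>c\<close> and \<open>x\<close> are both tips
  of ears, over b, d and over b', d'. If \<open>y\<close> is on the board, two relocations bring {c,
  x} to the boundary; if not, the link of \<open>c\<close> has to continue on the other side of
  \<open>w\<close>, and a reflection leads back to \<open>stuck_second_triangle\<close>.\<close>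

lemma stuck_standard:
  assumes st: "stuck B S T" and cx: "(0, 0) \<in> S" "(1, 0) \<in> S" and w: "(0, 1) \<in> B" "(0, 1) \<notin> S"
  shows False
proof (rule ccontr)
  have P: "polygon S T" and SB: "S \<subseteq> B" using st by (auto simp: stuck_def)
  note P' = polygonD[OF P]
  note C = P'(5)
  have NI: "z \<in> S" if "{p, q} \<in> bd T" "z \<in> B" "adjacent z p" "adjacent z q" for p q z
    using stuck_insert[OF st P that] .
  let ?c = "(0, 0) :: cell" and ?x = "(1, 0) :: cell" and ?w = "(0, 1) :: cell" and ?y = "(1, -1) :: cell"
  let ?a = "(-1, 1) :: cell" and ?b = "(-1, 0) :: cell" and ?d = "(0, -1) :: cell"
  let ?a' = "(1, 1) :: cell" and ?b' = "(2, 0) :: cell" and ?d' = "(2, -1) :: cell"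
  let ?y1 = "(1, -2) :: cell" and ?y2 = "(2, -2) :: cell"
  note adj_simps = adjacent_plus hex_directions_def
  have no_cx: False if "polygon S U" "{?c, ?x} \<in> bd U" for U
    using stuck_insert[OF st that w(1)] w(2) by (simp add: adj_simps)
  have now: "t \<notin> T" if "?w \<in> t" for t using P'(3)[of t] that w(2) by auto
  have ncx: "{?c, ?x} \<notin> bd T" using no_cx P by blast
  have nca: "{?c, ?a} \<notin> bd T" "{?x, ?a'} \<notin> bd T"
    using NI[of ?c ?a ?w] NI[of ?x ?a' ?w] w by (auto simp: adj_simps)
  note edge = polygon_bd_iff[OF P]
  have e_c: "{?c, ?x} \<in> bd T \<longleftrightarrow> ({?c, ?x, ?w} \<in> T) \<noteq> ({?c, ?x, ?y} \<in> T)"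
    "{?c, ?a} \<in> bd T \<longleftrightarrow> ({?c, ?a, ?b} \<in> T) \<noteq> ({?c, ?a, ?w} \<in> T)"
    "{?c, ?b} \<in> bd T \<longleftrightarrow> ({?c, ?b, ?d} \<in> T) \<noteq> ({?c, ?a, ?b} \<in> T)"
    "{?c, ?d} \<in> bd T \<longleftrightarrow> ({?c, ?d, ?y} \<in> T) \<noteq> ({?c, ?b, ?d} \<in> T)"
    by (subst edge; simp add: adj_simps rot60_def insert_commute)+
  have e_x: "{?x, ?a'} \<in> bd T \<longleftrightarrow> ({?x, ?a', ?w} \<in> T) \<noteq> ({?x, ?a', ?b'} \<in> T)"
    "{?x, ?b'} \<in> bd T \<longleftrightarrow> ({?x, ?a', ?b'} \<in> T) \<noteq> ({?x, ?b', ?d'} \<in> T)"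
    "{?x, ?d'} \<in> bd T \<longleftrightarrow> ({?x, ?b', ?d'} \<in> T) \<noteq> ({?x, ?d', ?y} \<in> T)"
    "{?x, ?y} \<in> bd T \<longleftrightarrow> ({?x, ?d', ?y} \<in> T) \<noteq> ({?c, ?x, ?y} \<in> T)"
    by (subst edge; simp add: adj_simps rot60_def insert_commute)+
  have e_y: "{?y, ?d} \<in> bd T \<longleftrightarrow> ({?y, ?d, ?y1} \<in> T) \<noteq> ({?c, ?d, ?y} \<in> T)"
    "{?y, ?y1} \<in> bd T \<longleftrightarrow> ({?y, ?y1, ?y2} \<in> T) \<noteq> ({?y, ?d, ?y1} \<in> T)"
    "{?y, ?y2} \<in> bd T \<longleftrightarrow> ({?y, ?y2, ?d'} \<in> T) \<noteq> ({?y, ?y1, ?y2} \<in> T)"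
    "{?y, ?d'} \<in> bd T \<longleftrightarrow> ({?x, ?d', ?y} \<in> T) \<noteq> ({?y, ?y2, ?d'} \<in> T)"
    by (subst edge; simp add: adj_simps rot60_def insert_commute)+
  have "{?c, ?d, ?y} \<notin> T" using stuck_second_triangle[OF st cx w] by blast
  then have base: "{?c, ?x, ?w} \<notin> T" "{?c, ?a, ?w} \<notin> T" "{?x, ?a', ?w} \<notin> T" "{?c, ?x, ?y} \<notin> T"
    "{?c, ?a, ?b} \<notin> T" "{?x, ?a', ?b'} \<notin> T" "{?c, ?d, ?y} \<notin> T"
    using now e_c(1,2) e_x(1) ncx nca by (simp_all add: insert_commute)
  have cbd: "{?c, ?b, ?d} \<in> T"
    using polygon_fan(7)[OF P cx(1)] base by (cases "{?c, ?b, ?d} \<in> T") (simp_all add: insert_commute)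
  have bd: "{?b, ?c, ?d} \<in> T" "{?b, ?c} \<in> bd T" "{?c, ?d} \<in> bd T"
    using e_c cbd base by (simp_all add: insert_commute)
  have bS: "?b \<in> S" "?d \<in> S" using P'(3)[OF cbd] by auto
  have "card {?c, ?x, ?b, ?d} \<le> card S"
    using cx bS card_cycle_on(4)[OF C] by (intro card_mono) auto
  then have S4: "card S \<ge> 4" by simp
  have xd'y: "{?x, ?d', ?y} \<notin> T"
  proof
    assume "{?x, ?d', ?y} \<in> T"
    then have "{?x, ?y} \<in> bd T" using e_x base by simp
    from relocate_convex[OF P S4 bd _ this] no_cx show False by (auto simp: adj_simps insert_commute)
  qed
  have xbd: "{?x, ?b', ?d'} \<in> T"
    using polygon_fan(7)[OF P cx(2)] base xd'y now
    by (cases "{?x, ?b', ?d'} \<in> T") (simp_all add: insert_commute)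
  have bd': "{?b', ?x, ?d'} \<in> T" "{?b', ?x} \<in> bd T" "{?x, ?d'} \<in> bd T"
    using e_x xbd base xd'y by (simp_all add: insert_commute)
  have neq: "{?b', ?x, ?d'} \<noteq> {?b, ?c, ?d}" "{?b', ?x, ?d'} \<noteq> {?y1, ?y, ?y2}"
    by (rule set_neqI[of ?x]; simp)+
  show False
  proof (cases "?y \<in> B")
    case True
    then have yS: "?y \<in> S" using NI[OF bd(3)] by (simp add: adj_simps)
    have yd: "{?y, ?d} \<notin> bd T"
    proof
      assume yd: "{?y, ?d} \<in> bd T"
      \<comment> \<open>Moving \<open>c\<close> into {y, d} makes {y, c} a boundary edge; then
        \<open>x\<close> moves into {y, c}.\<close>
      define U where "U = insert {?y, ?c, ?d} (T - {{?b, ?c, ?d}})"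
      have U: "polygon S U" "bd U = bd T - {{?b, ?c}, {?c, ?d}, {?y, ?d}} \<union> {{?b, ?d}, {?y, ?c}, {?c, ?d}}"
        unfolding U_def using relocate_convex[OF P S4 bd _ yd] by (simp_all add: adj_simps)
      have "{?b', ?x, ?d'} \<in> U" "{?b', ?x} \<in> bd U" "{?x, ?d'} \<in> bd U" "{?y, ?c} \<in> bd U"
        unfolding U(2) using bd' neq(1) by (simp_all add: U_def doubleton_eq_iff)
      from relocate_convex[OF U(1) S4 this(1-3) _ this(4)] no_cx show False
        by (auto simp: adj_simps insert_commute)
    qed
    have yd': "{?y, ?d'} \<notin> bd T"
    proof
      assume yd: "{?y, ?d'} \<in> bd T"
      define U where "U = insert {?y, ?x, ?d'} (T - {{?b', ?x, ?d'}})"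
      have U: "polygon S U" "bd U = bd T - {{?b', ?x}, {?x, ?d'}, {?y, ?d'}} \<union> {{?b', ?d'}, {?y, ?x}, {?x, ?d'}}"
        unfolding U_def using relocate_convex[OF P S4 bd' _ yd] by (simp_all add: adj_simps)
      have "{?b, ?c, ?d} \<in> U" "{?b, ?c} \<in> bd U" "{?c, ?d} \<in> bd U" "{?y, ?x} \<in> bd U"
        unfolding U(2) using bd neq(1)[symmetric] by (simp_all add: U_def doubleton_eq_iff)
      from relocate_convex[OF U(1) S4 this(1-3) _ this(4)] no_cx show False
        by (auto simp: adj_simps insert_commute)
    qed
    have "{?y, ?d, ?y1} \<notin> T" "{?y, ?y2, ?d'} \<notin> T" using yd yd' e_y base xd'y by auto
    moreover from this have "{?y, ?y1, ?y2} \<in> T"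
      using polygon_fan(7)[OF P yS] base xd'y by (cases "{?y, ?y1, ?y2} \<in> T") (simp_all add: insert_commute)
    ultimately have ear: "{?y1, ?y, ?y2} \<in> T" "{?y1, ?y} \<in> bd T" "{?y, ?y2} \<in> bd T"
      using e_y by (simp_all add: insert_commute)
    \<comment> \<open>Now \<open>y\<close> is the tip of an ear as well: it moves into {c, d}, and
      then \<open>x\<close> into the new edge {c, y}.\<close>
    define U where "U = insert {?c, ?y, ?d} (T - {{?y1, ?y, ?y2}})"
    have U: "polygon S U" "bd U = bd T - {{?y1, ?y}, {?y, ?y2}, {?c, ?d}} \<union> {{?y1, ?y2}, {?c, ?y}, {?y, ?d}}"
      unfolding U_def using relocate_convex[OF P S4 ear _ bd(3)] by (simp_all add: adj_simps)
    have "{?b', ?x, ?d'} \<in> U" "{?b', ?x} \<in> bd U" "{?x, ?d'} \<in> bd U" "{?c, ?y} \<in> bd U"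
      unfolding U(2) using bd' neq(2) by (simp_all add: U_def doubleton_eq_iff)
    from relocate_convex[OF U(1) S4 this(1-3) _ this(4)] no_cx show False
      by (auto simp: adj_simps insert_commute)
  next
    case False
    \<comment> \<open>Without \<open>y\<close>, the only way out of {x, w} inside the link of
      \<open>c\<close> leads from \<open>w\<close> to the cell a.\<close>
    have "cut_connected (link B ?c)" using st cx(1) SB unfolding stuck_def by blast
    moreover have "{?x, ?w} \<subseteq> link B ?c" "{?x, ?w} \<noteq> link B ?c"
    proof -
      show "{?x, ?w} \<subseteq> link B ?c" using cx w SB by (auto simp: link_def adj_simps)
      have "?b \<in> link B ?c" using bS SB by (auto simp: link_def adj_simps)
      then show "{?x, ?w} \<noteq> link B ?c" by (rule set_neqI[THEN not_sym]) simp
    qed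
    ultimately obtain u v where uv: "u \<in> {?x, ?w}" "v \<in> link B ?c - {?x, ?w}" "adjacent u v"
      unfolding cut_connected_def by (metis insert_not_empty)
    then have v: "v \<in> B" "adjacent ?c v" "v \<noteq> ?x" "v \<noteq> ?w" by (auto simp: link_def)
    with False have "v \<noteq> ?y" by auto
    with adjacent_cases[OF v(2)] uv(1,3) v(3,4) have va: "v = ?a" by (auto simp: adj_simps)
    then have aS: "?a \<in> S" using NI[OF bd(2)] v(1) by (simp add: adj_simps)
    \<comment> \<open>The reflection in the line through \<open>c\<close> and \<open>w\<close>. It
      takes a to the position of \<open>x\<close> and the triangle c, b, d to the one that
      \<open>stuck_second_triangle\<close> asks for.\<close>
    define f :: "cell \<Rightarrow> cell" where "f = (\<lambda>(i, j). (- i, i + j))"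
    have ff: "f (f p) = p" for p by (cases p) (simp add: f_def)
    then have "bij f" by (intro o_bij[of f]) (simp_all add: fun_eq_iff)
    moreover have "adjacent (f p) (f q) \<longleftrightarrow> adjacent p q" for p q
      by (cases p; cases q) (simp add: f_def adjacent_def hex_directions_iff algebra_simps)
    ultimately have f: "lattice_iso f" unfolding lattice_iso_def by blast
    have fm: "f p \<in> f ` A \<longleftrightarrow> p \<in> A" for p A using lattice_isoD(1)[OF f] by (simp add: inj_image_mem_iff)
    have im: "f ` {?c, ?b, ?d} = {(0, 0), (0, -1), (1, -1)}" by (auto simp: f_def)
    show False
    proof (rule stuck_second_triangle[OF stuck_image[OF st f]])
      show "(0, 0) \<in> f ` S" using fm[of ?c S] cx by (simp add: f_def)
      show "(1, 0) \<in> f ` S" using fm[of ?a S] aS by (simp add: f_def)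
      show "(0, 1) \<in> f ` B" using fm[of ?w B] w by (simp add: f_def)
      show "(0, 1) \<notin> f ` S" using fm[of ?w S] w by (simp add: f_def)
      show "{(0, 0), (0, -1), (1, -1)} \<in> (`) f ` T" using cbd im by (metis imageI)
    qed
  qed
qed

lemma lattice_iso_affine:
  assumes "u \<in> hex_directions" "v = rot60 u \<or> u = rot60 v"
  shows "lattice_iso (\<lambda>(i, j). (fst c + i * fst u + j * fst v, snd c + i * snd u + j * snd v))"
    (is "lattice_iso ?f")
proof -
  obtain u1 u2 v1 v2 c1 c2 where uv: "u = (u1, u2)" "v = (v1, v2)" "c = (c1, c2)" by (metis surj_pair)
  have norm: "(p, q) \<in> hex_directions \<longleftrightarrow> p * p + p * q + q * q = 1" for p q
    by (simp add: hex_directions_iff)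
  have cases: "(u1, u2, v1, v2) \<in> {(1, 0, 0, 1), (0, 1, -1, 1), (-1, 1, -1, 0), (-1, 0, 0, -1), (0, -1, 1, -1), (1, -1, 1, 0),
     (0, 1, 1, 0), (-1, 1, 0, 1), (-1, 0, -1, 1), (0, -1, -1, 0), (1, -1, 0, -1), (1, 0, 1, -1)}"
  proof -
    have "(v1, v2) = (- u2, u1 + u2) \<or> (v1, v2) = (u1 + u2, - u1)"
      using assms(2) by (auto simp: uv rot60_def)
    then show ?thesis using assms(1) unfolding uv hex_directions_def
      by (elim disjE insertE emptyE) simp_all
  qed
  have "adjacent (?f p) (?f q) \<longleftrightarrow> adjacent p q" for p q
  proof -
    obtain i j where d: "q = p + (i, j)" by (metis add_diff_cancel_left' diff_add_cancel add.commute surj_pair)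
    obtain p1 p2 where p: "p = (p1, p2)" by (cases p)
    have "adjacent (?f p) (?f q) \<longleftrightarrow> (i * u1 + j * v1, i * u2 + j * v2) \<in> hex_directions"
      by (simp add: d p uv adjacent_def algebra_simps)
    also have "\<dots> \<longleftrightarrow> i * i + i * j + j * j = 1"
      unfolding norm using cases by (elim insertE emptyE) (simp_all add: algebra_simps)
    also have "\<dots> \<longleftrightarrow> adjacent p q" by (simp add: d p adjacent_def norm)
    finally show ?thesis .
  qed
  moreover have "bij ?f"
  proof (rule o_bij)
    \<comment> \<open>The determinant is 1 or -1, hence its own inverse, and Cramer's rule stays
      within the integers.\<close>
    define e where "e = u1 * v2 - u2 * v1"
    have e: "e * e = 1" using cases by (elim insertE emptyE) (simp_all add: e_def)
    let ?g = "\<lambda>(i, j). (e * ((i - c1) * v2 - (j - c2) * v1), e * (u1 * (j - c2) - u2 * (i - c1)))"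
    show "?g \<circ> ?f = id"
    proof
      fix p :: cell
      obtain i j where p: "p = (i, j)" by (cases p)
      have "e * ((i * u1 + j * v1) * v2 - (i * u2 + j * v2) * v1) = e * e * i"
        "e * (u1 * (i * u2 + j * v2) - u2 * (i * u1 + j * v1)) = e * e * j"
        by (simp_all add: e_def algebra_simps)
      then show "(?g \<circ> ?f) p = id p" by (simp add: p uv e add.assoc)
    qed
    show "?f \<circ> ?g = id"
    proof
      fix p :: cell
      obtain i j where p: "p = (i, j)" by (cases p)
      have "e * ((i - c1) * v2 - (j - c2) * v1) * u1 + e * (u1 * (j - c2) - u2 * (i - c1)) * v1 = e * e * (i - c1)"
        "e * ((i - c1) * v2 - (j - c2) * v1) * u2 + e * (u1 * (j - c2) - u2 * (i - c1)) * v2 = e * e * (j - c2)"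
        by (simp_all add: e_def algebra_simps)
      then show "(?f \<circ> ?g) p = id p" by (simp add: p uv e add.assoc)
    qed
  qed
  ultimately show ?thesis unfolding lattice_iso_def by blast
qed

text \<open>If a cell is uncovered, connectivity of the board gives a covered cell \<open>c\<close>
  with an uncovered neighbour, and connectivity of the link of \<open>c\<close> gives adjacent
  neighbours \<open>x\<close>, \<open>w\<close> of \<open>c\<close>, one covered and one not. A
  symmetry moves this triangle to the coordinates of \<open>stuck_standard\<close>.\<close>

lemma stuck_imp_spanning:
  assumes st: "stuck B S T"
  shows "S = B"
proof (rule ccontr)
  assume ne: "S \<noteq> B"
  have P: "polygon S T" and SB: "S \<subseteq> B" using st by (auto simp: stuck_def)
  have "S \<noteq> {}" using card_cycle_on(3)[OF polygonD(5)[OF P]] by auto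
  with ne SB st obtain c w0 where c: "c \<in> S" "w0 \<in> B - S" "adjacent c w0"
    unfolding stuck_def cut_connected_def by meson
  from cycle_on_neighbours[OF polygonD(5)[OF P] c(1)] obtain a where a: "{c, a} \<in> bd T" by metis
  then have aS: "a \<in> S" "adjacent c a" using cycle_on_edge[OF polygonD(5)[OF P] a] polygon_bd_adjacent[OF P a] by auto
  define A where "A = S \<inter> link B c"
  have "A \<subseteq> link B c" "a \<in> A" "w0 \<in> link B c - A" using aS SB c by (auto simp: A_def link_def)
  then obtain x w where xw: "x \<in> A" "w \<in> link B c - A" "adjacent x w"
    using st SB c(1) unfolding stuck_def cut_connected_def by (metis DiffE empty_iff subsetD)
  define u v where "u = x - c" and "v = w - c"
  have uv: "u \<in> hex_directions" "v \<in> hex_directions" "v - u \<in> hex_directions"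
    using xw by (auto simp: u_def v_def A_def link_def adjacent_def)
  define f :: "cell \<Rightarrow> cell" where "f = (\<lambda>(i, j). (fst c + i * fst u + j * fst v, snd c + i * snd u + j * snd v))"
  have f: "lattice_iso f" unfolding f_def by (rule lattice_iso_affine[OF uv(1) hex_directions_60[OF uv]])
  note g = lattice_iso_inv[OF f]
  have val: "f (0, 0) = c" "f (1, 0) = x" "f (0, 1) = w" by (simp_all add: f_def u_def v_def prod_eq_iff)
  then have gv: "inv f c = (0, 0)" "inv f x = (1, 0)" "inv f w = (0, 1)"
    using lattice_isoD(1)[OF f] by (metis inv_f_f)+
  have mem: "inv f p \<in> inv f ` X \<longleftrightarrow> p \<in> X" for p X
    using lattice_isoD(1)[OF g] by (simp add: inj_image_mem_iff)
  show False
    by (rule stuck_standard[OF stuck_image[OF st g]])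
      (use mem[of c S] mem[of x S] mem[of w B] mem[of w S] gv c xw in \<open>auto simp: A_def link_def\<close>)
qed

lemma polygon_triangle:
  assumes "adjacent a b" "adjacent b c" "adjacent a c"
  shows "polygon {a, b, c} {{a, b, c}}"
proof -
  have ne: "a \<noteq> b" "b \<noteq> c" "a \<noteq> c" using assms by auto
  have "bd {{a, b, c}} = sym_diff (bd {}) {{a, b}, {b, c}, {a, c}}"
    using bd_insert[of "{}" a b c] ne by simp
  moreover have "bd {} = ({} :: cell set set)" by (simp add: bd_def)
  ultimately have "bd {{a, b, c}} = cedges [a, b, c]" by (auto simp: cedges_Cons insert_commute)
  then have "cycle_on {a, b, c} (bd {{a, b, c}})"
    unfolding cycle_on_def using ne by (intro exI[of _ "[a, b, c]"]) simp
  moreover have "unit_triangle {a, b, c}" using assms unfolding unit_triangle_def by blast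
  ultimately show ?thesis using ne unfolding polygon_def by simp
qed

theorem spanning_polygon:
  assumes B: "finite B" "card B > 2" "cut_connected B" "\<And>c. c \<in> B \<Longrightarrow> cut_connected (link B c)"
    "\<And>c. B \<noteq> star_of_david c"
  obtains T where "polygon B T"
proof -
  have "B \<noteq> {}" using B(2) by auto
  then obtain p where p: "p \<in> B" by blast
  have "{p} \<noteq> B" using B(2) by auto
  with p B(3) obtain q where q: "q \<in> B" "adjacent p q" unfolding cut_connected_def
    by (metis DiffD1 empty_subsetI insert_not_empty insert_subset singletonD)
  have "card {p, q} \<le> 2" by (simp add: card_insert_if)
  then have "{p, q} \<noteq> B" using B(2) by auto
  with p q B(3) obtain u v where uv: "u \<in> {p, q}" "v \<in> B - {p, q}" "adjacent u v" unfolding cut_connected_def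
    by (metis empty_subsetI insert_not_empty insert_subset)
  \<comment> \<open>The link of \<open>u\<close> contains the other one of \<open>p\<close>,
    \<open>q\<close> as well as \<open>v\<close>. Being connected, it has an edge at
    \<open>u'\<close>, which completes a first triangle.\<close>
  define u' where "u' = (if u = p then q else p)"
  have u': "u' \<in> link B u" "v \<in> link B u" "v \<noteq> u'" "u \<in> B"
    using uv p q adjacent_sym[OF q(2)] by (auto simp: u'_def link_def)
  then have "{u'} \<subseteq> link B u" "{u'} \<noteq> {}" "{u'} \<noteq> link B u" by auto
  with B(4)[OF u'(4)] obtain n where n: "n \<in> link B u" "adjacent u' n" unfolding cut_connected_def
    by (metis DiffD1 singletonD)
  then have "polygon {u, u', n} {{u, u', n}}" using u'(1) by (intro polygon_triangle) (auto simp: link_def)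
  moreover have "{u, u', n} \<subseteq> B" using u'(1,4) n by (auto simp: link_def)
  ultimately have ex: "\<exists>S. (\<exists>T. polygon S T) \<and> S \<subseteq> B" by blast
  define k where "k = (GREATEST k. \<exists>S. ((\<exists>T. polygon S T) \<and> S \<subseteq> B) \<and> card S = k)"
  have bound: "\<forall>k. (\<exists>S. ((\<exists>T. polygon S T) \<and> S \<subseteq> B) \<and> card S = k) \<longrightarrow> k \<le> card B"
    using B(1) card_mono by blast
  from ex have "\<exists>k S. ((\<exists>T. polygon S T) \<and> S \<subseteq> B) \<and> card S = k" by blast
  from GreatestI_ex_nat[OF this, of "card B"] bound obtain S T where
    S: "polygon S T" "S \<subseteq> B" "card S = k" unfolding k_def by blast
  have "card S' \<le> card S" if "polygon S' T'" "S' \<subseteq> B" for S' T'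
    unfolding S(3) k_def by (rule Greatest_le_nat[where b = "card B"]) (use that bound in blast)+
  then have "stuck B S T" using S B unfolding stuck_def by blast
  with stuck_imp_spanning S(1) that show ?thesis by blast
qed

section \<open>Hole-free boards are locally connected\<close>

definition hex_point :: "real \<Rightarrow> real \<Rightarrow> complex" where
  "hex_point s t = of_real (sqrt 3) * (of_real s + of_real t * cis (pi / 3))"

lemma hex_centre_point: "hex_centre c = hex_point (of_int (fst c)) (of_int (snd c))"
  by (simp add: hex_centre_def hex_point_def)

lemma hex_point_add: "hex_point s t + hex_point s' t' = hex_point (s + s') (t + t')"
  by (simp add: hex_point_def algebra_simps)

lemma hex_point_scale: "a *\<^sub>R hex_point s t = hex_point (a * s) (a * t)"
  by (simp add: hex_point_def scaleR_conv_of_real algebra_simps)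

lemma hex_point_rot: "cis (pi / 3) * hex_point s t = hex_point (- t) (s + t)"
proof -
  have "cis (pi / 3) * cis (pi / 3) = cis (pi / 3) - 1"
    by (simp add: complex_eq_iff cos_60 sin_60)
  moreover have "cis (pi / 3) * hex_point s t =
      of_real (sqrt 3) * (of_real s * cis (pi / 3) + of_real t * (cis (pi / 3) * cis (pi / 3)))"
    by (simp only: hex_point_def algebra_simps)
  ultimately have "cis (pi / 3) * hex_point s t =
      of_real (sqrt 3) * (of_real s * cis (pi / 3) + of_real t * (cis (pi / 3) - 1))"
    by (simp only:)
  then show ?thesis by (simp add: hex_point_def algebra_simps)
qed

lemma hex_point_surj: "\<exists>s t. z = hex_point s t"
proof -
  define t where "t = Im z * 2 / 3"
  define s where "s = Re z / sqrt 3 - t / 2"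
  have "z = hex_point s t"
    by (simp add: complex_eq_iff hex_point_def cos_60 sin_60 s_def t_def field_simps)
  then show ?thesis by blast
qed

lemma hex_vertices:
  "cis (pi / 6 + real 0 * (pi / 3)) = hex_point (1/3) (1/3)"
  "cis (pi / 6 + real 1 * (pi / 3)) = hex_point (-1/3) (2/3)"
  "cis (pi / 6 + real 2 * (pi / 3)) = hex_point (-2/3) (1/3)"
  "cis (pi / 6 + real 3 * (pi / 3)) = hex_point (-1/3) (-1/3)"
  "cis (pi / 6 + real 4 * (pi / 3)) = hex_point (1/3) (-2/3)"
  "cis (pi / 6 + real 5 * (pi / 3)) = hex_point (2/3) (-1/3)"
proof -
  have step: "cis (pi / 6 + real (Suc k) * (pi / 3)) = hex_point (- t) (s + t)"
    if "cis (pi / 6 + real k * (pi / 3)) = hex_point s t" for k s t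
  proof -
    have "pi / 6 + real (Suc k) * (pi / 3) = pi / 3 + (pi / 6 + real k * (pi / 3))"
      by (simp add: field_simps)
    then have "cis (pi / 6 + real (Suc k) * (pi / 3)) = cis (pi / 3) * cis (pi / 6 + real k * (pi / 3))"
      by (simp only: cis_mult)
    then show ?thesis using that by (simp add: hex_point_rot)
  qed
  show 0: "cis (pi / 6 + real 0 * (pi / 3)) = hex_point (1/3) (1/3)"
    by (simp add: complex_eq_iff hex_point_def cos_60 sin_60 cos_30 sin_30)
  show 1: "cis (pi / 6 + real 1 * (pi / 3)) = hex_point (-1/3) (2/3)" using step[OF 0] by simp
  show 2: "cis (pi / 6 + real 2 * (pi / 3)) = hex_point (-2/3) (1/3)" using step[OF 1] by (simp add: numeral_2_eq_2)
  show 3: "cis (pi / 6 + real 3 * (pi / 3)) = hex_point (-1/3) (-1/3)" using step[OF 2] by (simp add: numeral_3_eq_3)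
  show 4: "cis (pi / 6 + real 4 * (pi / 3)) = hex_point (1/3) (-2/3)" using step[OF 3] by (simp add: eval_nat_numeral)
  show "cis (pi / 6 + real 5 * (pi / 3)) = hex_point (2/3) (-1/3)" using step[OF 4] by (simp add: eval_nat_numeral)
qed

lemma hexagon_subset: "hexagon c \<subseteq> cball (hex_centre c) 1"
  unfolding hexagon_def by (rule hull_minimal) (auto simp: dist_norm)

lemma closed_hexagon: "closed (hexagon c)"
  unfolding hexagon_def by (intro compact_imp_closed finite_imp_compact_convex_hull) simp

lemma convex_hexagon: "convex (hexagon c)"
  by (simp add: hexagon_def)

lemma hexagon_vertex: "k < 6 \<Longrightarrow> hex_centre c + cis (pi / 6 + real k * (pi / 3)) \<in> hexagon c"
  unfolding hexagon_def by (rule hull_inc) simp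

lemma hexagon_vertices:
  "hex_centre c + hex_point (1/3) (1/3) \<in> hexagon c" "hex_centre c + hex_point (-1/3) (2/3) \<in> hexagon c"
  "hex_centre c + hex_point (-2/3) (1/3) \<in> hexagon c" "hex_centre c + hex_point (-1/3) (-1/3) \<in> hexagon c"
  "hex_centre c + hex_point (1/3) (-2/3) \<in> hexagon c" "hex_centre c + hex_point (2/3) (-1/3) \<in> hexagon c"
  unfolding hex_vertices[symmetric] by (rule hexagon_vertex; simp)+

lemma hex_centre_in_hexagon: "hex_centre c \<in> hexagon c"
proof -
  have "(1/2) *\<^sub>R (hex_centre c + hex_point (1/3) (1/3)) + (1/2) *\<^sub>R (hex_centre c + hex_point (-1/3) (-1/3)) \<in> hexagon c"
    by (rule convexD[OF convex_hexagon hexagon_vertices(1,4)]) auto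
  then show ?thesis
    by (simp add: hex_centre_point hex_point_add hex_point_scale field_simps)
qed

lemma hexagon_sector:
  assumes "hex_centre c + hex_point s t \<in> hexagon c" "hex_centre c + hex_point s' t' \<in> hexagon c"
    "0 \<le> \<alpha>" "0 \<le> \<beta>" "\<alpha> + \<beta> \<le> 1"
  shows "hex_centre c + hex_point (\<alpha> * s + \<beta> * s') (\<alpha> * t + \<beta> * t') \<in> hexagon c"
proof -
  let ?p = "hex_centre c + hex_point s t" and ?q = "hex_centre c + hex_point s' t'"
  have "convex hull {?p, ?q, hex_centre c} \<subseteq> hexagon c"
    by (rule hull_minimal) (use assms hex_centre_in_hexagon convex_hexagon in auto)
  moreover have "\<alpha> *\<^sub>R ?p + \<beta> *\<^sub>R ?q + (1 - \<alpha> - \<beta>) *\<^sub>R hex_centre c \<in> convex hull {?p, ?q, hex_centre c}"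
    unfolding convex_hull_3 using assms(3-5) by fastforce
  moreover have "\<alpha> *\<^sub>R ?p + \<beta> *\<^sub>R ?q + (1 - \<alpha> - \<beta>) *\<^sub>R hex_centre c =
      hex_centre c + hex_point (\<alpha> * s + \<beta> * s') (\<alpha> * t + \<beta> * t')"
    by (simp add: hex_centre_point hex_point_add hex_point_scale algebra_simps)
  ultimately show ?thesis by auto
qed

text \<open>Rays to the vertices cut the hexagon into six sectors. In each, the point is a
  combination of two consecutive vertices with nonnegative coefficients, whose sum is up to sign one
  of the three bounded forms.\<close>

lemma hexagonI:
  assumes "\<bar>2 * p + q\<bar> \<le> 1" "\<bar>p + 2 * q\<bar> \<le> 1" "\<bar>p - q\<bar> \<le> 1"
  shows "hex_centre c + hex_point p q \<in> hexagon c"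
proof -
  note v = hexagon_vertices[of c]
  consider "p \<ge> q" "p + 2 * q \<ge> 0" | "q \<ge> p" "2 * p + q \<ge> 0" | "2 * p + q \<le> 0" "p + 2 * q \<ge> 0"
    | "q \<ge> p" "p + 2 * q \<le> 0" | "p \<ge> q" "2 * p + q \<le> 0" | "2 * p + q \<ge> 0" "p + 2 * q \<le> 0" by linarith
  then show ?thesis
  proof cases
    case 1 then show ?thesis using hexagon_sector[OF v(1,6), of "p + 2 * q" "p - q"] assms by (simp add: field_simps)
  next
    case 2 then show ?thesis using hexagon_sector[OF v(1,2), of "2 * p + q" "q - p"] assms by (simp add: field_simps)
  next
    case 3 then show ?thesis using hexagon_sector[OF v(2,3), of "p + 2 * q" "- 2 * p - q"] assms by (simp add: field_simps)
  next
    case 4 then show ?thesis using hexagon_sector[OF v(4,3), of "- p - 2 * q" "q - p"] assms by (simp add: field_simps)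
  next
    case 5 then show ?thesis using hexagon_sector[OF v(4,5), of "- 2 * p - q" "p - q"] assms by (simp add: field_simps)
  next
    case 6 then show ?thesis using hexagon_sector[OF v(5,6), of "- p - 2 * q" "2 * p + q"] assms by (simp add: field_simps)
  qed
qed

lemma hexagons_cover: "\<exists>c. z \<in> hexagon c"
proof -
  obtain s t where z: "z = hex_point s t" using hex_point_surj by blast
  define i j where "i = \<lfloor>s\<rfloor>" and "j = \<lfloor>t\<rfloor>"
  define \<sigma> \<tau> where "\<sigma> = s - of_int i" and "\<tau> = t - of_int j"
  have b: "0 \<le> \<sigma>" "\<sigma> < 1" "0 \<le> \<tau>" "\<tau> < 1" unfolding \<sigma>_def \<tau>_def i_def j_def by linarith+
  have z': "z = hex_centre (i + a, j + b) + hex_point (\<sigma> - of_int a) (\<tau> - of_int b)" for a b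
    by (simp add: z hex_centre_point hex_point_add \<sigma>_def \<tau>_def)
  \<comment> \<open>The parts of the unit parallelogram that belong to the hexagons at its corners
    (0, 0), (1, 1), (1, 0) and (0, 1).\<close>
  consider "2 * \<sigma> + \<tau> \<le> 1" "\<sigma> + 2 * \<tau> \<le> 1" | "2 * \<sigma> + \<tau> \<ge> 2" "\<sigma> + 2 * \<tau> \<ge> 2"
    | "2 * \<sigma> + \<tau> \<ge> 1" "\<sigma> + 2 * \<tau> \<le> 2" "\<tau> \<le> \<sigma>" | "\<sigma> + 2 * \<tau> \<ge> 1" "2 * \<sigma> + \<tau> \<le> 2" "\<sigma> \<le> \<tau>"
    by linarith
  then show ?thesis
  proof cases
    case 1 then show ?thesis using hexagonI[of "\<sigma> - of_int 0" "\<tau> - of_int 0" "(i + 0, j + 0)"] b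
      unfolding z'[of 0 0, symmetric] by (intro exI) (simp add: abs_le_iff)
  next
    case 2 then show ?thesis using hexagonI[of "\<sigma> - of_int 1" "\<tau> - of_int 1" "(i + 1, j + 1)"] b
      unfolding z'[of 1 1, symmetric] by (intro exI) (simp add: abs_le_iff)
  next
    case 3 then show ?thesis using hexagonI[of "\<sigma> - of_int 1" "\<tau> - of_int 0" "(i + 1, j + 0)"] b
      unfolding z'[of 1 0, symmetric] by (intro exI) (simp add: abs_le_iff)
  next
    case 4 then show ?thesis using hexagonI[of "\<sigma> - of_int 0" "\<tau> - of_int 1" "(i + 0, j + 1)"] b
      unfolding z'[of 0 1, symmetric] by (intro exI) (simp add: abs_le_iff)
  qed
qed

text \<open>A third of the squared distance between centres. Being an integer, it turns distance
  bounds into adjacency.\<close>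

abbreviation hex_norm :: "cell \<Rightarrow> int" where
  "hex_norm d \<equiv> fst d * fst d + fst d * snd d + snd d * snd d"

lemma dist_hex_centre: "(dist (hex_centre c) (hex_centre d))\<^sup>2 = of_int (3 * hex_norm (c - d))"
  unfolding dist_norm hex_centre_diff[symmetric] by (rule norm_hex_centre)

lemma hex_norm_bounds: "3 * (fst d * fst d) \<le> 4 * hex_norm d" "3 * (snd d * snd d) \<le> 4 * hex_norm d"
proof -
  have "0 \<le> (fst d + 2 * snd d) * (fst d + 2 * snd d)" "0 \<le> (2 * fst d + snd d) * (2 * fst d + snd d)" by simp_all
  then show "3 * (fst d * fst d) \<le> 4 * hex_norm d" "3 * (snd d * snd d) \<le> 4 * hex_norm d"
    by (simp_all add: algebra_simps)
qed

lemma hex_norm_pos: "d \<noteq> 0 \<Longrightarrow> hex_norm d > 0"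
proof -
  assume "d \<noteq> 0"
  then have "fst d * fst d > 0 \<or> snd d * snd d > 0" by (auto simp: prod_eq_iff zero_less_mult_iff)
  moreover have "0 < x \<or> 0 < y \<Longrightarrow> 3 * x \<le> 4 * n \<Longrightarrow> 3 * y \<le> 4 * n \<Longrightarrow> 0 < n" for x y n :: int
    by auto
  ultimately show ?thesis using hex_norm_bounds[of d] by blast
qed

lemma dist_hex_centre_le: "dist (hex_centre c) (hex_centre d) \<le> real k \<Longrightarrow> 3 * hex_norm (c - d) \<le> int (k * k)"
proof -
  assume "dist (hex_centre c) (hex_centre d) \<le> real k"
  then have "(dist (hex_centre c) (hex_centre d))\<^sup>2 \<le> (real k)\<^sup>2" by (intro power_mono) auto
  then have "real_of_int (3 * hex_norm (c - d)) \<le> real_of_int (int (k * k))"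
    unfolding dist_hex_centre by (simp add: power2_eq_square)
  then show ?thesis by (simp only: of_int_le_iff)
qed

text \<open>Both centres are within 1 of \<open>z\<close>, hence within 2 of each other. So three
  times the \<open>hex_norm\<close> of their difference is at most 4, and the
  \<open>hex_norm\<close> is 0 or 1.\<close>

lemma hexagons_meet:
  assumes "z \<in> hexagon c" "z \<in> hexagon d"
  shows "c = d \<or> adjacent c d"
proof -
  have "dist (hex_centre d) (hex_centre c) \<le> dist (hex_centre d) z + dist (hex_centre c) z"
    by (rule dist_triangle2)
  also have "dist (hex_centre c) z \<le> 1" "dist (hex_centre d) z \<le> 1"
    using assms hexagon_subset[of c] hexagon_subset[of d] by auto
  then have "dist (hex_centre d) z + dist (hex_centre c) z \<le> real 2" by simp
  finally have "3 * hex_norm (d - c) \<le> 4" using dist_hex_centre_le[of d c 2] by simp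
  then have "hex_norm (d - c) \<le> 1" by presburger
  then consider "d - c = 0" | "hex_norm (d - c) = 1" using hex_norm_pos[of "d - c"] by fastforce
  then show ?thesis by cases (auto simp: adjacent_def hex_directions_iff)
qed

lemma hex_centre_not_in_hexagon:
  assumes "c \<noteq> d"
  shows "hex_centre c \<notin> hexagon d"
proof
  assume "hex_centre c \<in> hexagon d"
  then have "dist (hex_centre c) (hex_centre d) \<le> real 1" using hexagon_subset[of d] by (auto simp: dist_commute)
  from dist_hex_centre_le[OF this] hex_norm_pos[of "c - d"] assms show False by auto
qed

lemma finite_near: "finite {d. dist (hex_centre d) (hex_centre c) \<le> 3}"
proof (rule finite_subset)
  show "{d. dist (hex_centre d) (hex_centre c) \<le> 3} \<subseteq> (\<lambda>e. e + c) ` ({-2..2} \<times> {-2..2})"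
  proof
    fix d assume "d \<in> {d. dist (hex_centre d) (hex_centre c) \<le> 3}"
    then have "3 * hex_norm (d - c) \<le> 9" using dist_hex_centre_le[of d c 3] by simp
    then have "fst (d - c) * fst (d - c) \<le> 4" "snd (d - c) * snd (d - c) \<le> 4"
      using hex_norm_bounds[of "d - c"] by linarith+
    then have "\<bar>fst (d - c)\<bar> \<le> 2" "\<bar>snd (d - c)\<bar> \<le> 2"
      using abs_le_square_iff[of "fst (d - c)" 2] abs_le_square_iff[of "snd (d - c)" 2]
      by (simp_all add: power2_eq_square)
    then have "d - c \<in> {-2..2} \<times> {-2..2}" by (cases "d - c") (auto simp: abs_le_iff)
    then have "d - c + c \<in> (\<lambda>e. e + c) ` ({-2..2} \<times> {-2..2})" by (rule imageI)
    then show "d \<in> (\<lambda>e. e + c) ` ({-2..2} \<times> {-2..2})" by simp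
  qed
qed simp

text \<open>Hexagons that meet are adjacent, so an adjacency-closed set of cells outside \<open>B\<close> covers a
  relatively clopen part of the complement of the board.\<close>

lemma open_region:
  assumes K: "K \<inter> B = {}" "\<And>c d. c \<in> K \<Longrightarrow> d \<notin> B \<Longrightarrow> adjacent c d \<Longrightarrow> d \<in> K"
  shows "open ((\<Union>c\<in>K. hexagon c) - (\<Union>c\<in>B. hexagon c))" (is "open ?A")
  unfolding open_contains_ball
proof
  fix z assume z: "z \<in> ?A"
  then obtain c where c: "c \<in> K" "z \<in> hexagon c" by blast
  \<comment> \<open>The radius is 3 = 1 + 1 + 1: from the centre of \<open>c\<close> to
    \<open>z\<close>, from \<open>z\<close> to a nearby point, and from there to the centre of its
    hexagon. Only finitely many hexagons are involved, so \<open>F\<close> is closed.\<close>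
  define F where "F = (\<Union>d\<in>{d. dist (hex_centre d) (hex_centre c) \<le> 3} - K. hexagon d)"
  have "closed F" unfolding F_def by (intro closed_UN finite_Diff finite_near) (simp add: closed_hexagon)
  moreover have "z \<notin> F"
  proof
    assume "z \<in> F"
    then obtain d where d: "d \<notin> K" "z \<in> hexagon d" unfolding F_def by blast
    then have "d \<notin> B" using z by blast
    moreover have "adjacent c d" using hexagons_meet[OF c(2) d(2)] c(1) d(1) by auto
    ultimately show False using K(2) c(1) d(1) by blast
  qed
  ultimately obtain e where e: "e > 0" "ball z e \<subseteq> - F" by (metis ComplI open_Compl open_contains_ball)
  have "ball z (min e 1) \<subseteq> ?A"
  proof
    fix u assume u: "u \<in> ball z (min e 1)"
    then have "u \<notin> F" using e by auto
    have near: "d \<in> K" if "u \<in> hexagon d" for d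
    proof (rule ccontr)
      assume "d \<notin> K"
      have "dist (hex_centre d) u \<le> 1" using hexagon_subset[of d] that by auto
      moreover have "dist (hex_centre c) z \<le> 1" using hexagon_subset[of c] c(2) by auto
      moreover have "dist z u < 1" using u by auto
      ultimately have "dist (hex_centre d) (hex_centre c) \<le> 3"
        by (smt (verit) dist_commute dist_triangle)
      with \<open>d \<notin> K\<close> that have "u \<in> F" unfolding F_def by blast
      with \<open>u \<notin> F\<close> show False by blast
    qed
    then have "u \<notin> (\<Union>c\<in>B. hexagon c)" using K(1) by blast
    moreover obtain d where "u \<in> hexagon d" using hexagons_cover by blast
    ultimately show "u \<in> ?A" using near by blast
  qed
  then show "\<exists>e>0. ball z e \<subseteq> ?A" using e(1) by (meson min_less_iff_conj zero_less_one)
qed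

text \<open>The parts of the complement covered by \<open>K\<close> and by the remaining cells
  outside \<open>B\<close> would be disjoint, open and nonempty. This turns the topological
  hypothesis into connectivity of the outside cells under adjacency.\<close>

lemma hole_free_outside:
  assumes "hole_free B" "K \<inter> B = {}" "\<And>c d. c \<in> K \<Longrightarrow> d \<notin> B \<Longrightarrow> adjacent c d \<Longrightarrow> d \<in> K" "K \<noteq> {}"
  shows "K = - B"
proof (rule ccontr)
  assume ne: "K \<noteq> - B"
  define L where "L = - B - K"
  let ?A = "\<lambda>K. (\<Union>c\<in>K. hexagon c) - (\<Union>c\<in>B. hexagon c)"
  have L: "L \<inter> B = {}" "\<And>c d. c \<in> L \<Longrightarrow> d \<notin> B \<Longrightarrow> adjacent c d \<Longrightarrow> d \<in> L"
    using assms(3) adjacent_sym unfolding L_def by blast+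
  have nonempty: "?A M \<noteq> {}" if M: "M \<noteq> {}" "M \<inter> B = {}" for M
  proof -
    obtain c where c: "c \<in> M" using M by blast
    have "hex_centre c \<notin> hexagon b" if "b \<in> B" for b
      by (rule hex_centre_not_in_hexagon) (use c that \<open>M \<inter> B = {}\<close> in blast)
    then have "hex_centre c \<in> ?A M" using c hex_centre_in_hexagon by blast
    then show ?thesis by blast
  qed
  have "connected (- (\<Union>c\<in>B. hexagon c))" using assms(1) by (simp add: hole_free_def)
  moreover have "open (?A K)" by (rule open_region) (use assms(2,3) in auto)
  moreover have "open (?A L)" by (rule open_region) (use L in auto)
  moreover have "- (\<Union>c\<in>B. hexagon c) \<subseteq> ?A K \<union> ?A L"
  proof
    fix z assume z: "z \<in> - (\<Union>c\<in>B. hexagon c)"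
    obtain c where c: "z \<in> hexagon c" using hexagons_cover by blast
    then have "c \<in> K \<or> c \<in> L" using z by (auto simp: L_def)
    then show "z \<in> ?A K \<union> ?A L" using c z by blast
  qed
  moreover have "?A K \<inter> ?A L \<inter> - (\<Union>c\<in>B. hexagon c) = {}"
  proof -
    have False if "z \<in> ?A K" "z \<in> ?A L" for z
    proof -
      from that obtain c d where cd: "c \<in> K" "z \<in> hexagon c" "d \<in> L" "z \<in> hexagon d" by blast
      with hexagons_meet[OF cd(2,4)] assms(3)[of c d] show False by (auto simp: L_def)
    qed
    then show ?thesis by blast
  qed
  moreover have "?A K \<inter> - (\<Union>c\<in>B. hexagon c) \<noteq> {}" using nonempty[OF assms(4,2)] by blast
  moreover have "L \<noteq> {}" using ne assms(2) by (auto simp: L_def)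
  then have "?A L \<inter> - (\<Union>c\<in>B. hexagon c) \<noteq> {}" using nonempty[OF _ L(1)] by blast
  ultimately show False using connectedD by metis
qed

text \<open>Vanishing of the first cohomology modulo 2 of the flag complex of the cells in \<open>X\<close>. This
  passes from a large parallelogram to the board by removing one cell after the other, and it
  implies that a vertex with a disconnected link is a cut vertex.\<close>

definition cocycle :: "cell set \<Rightarrow> (cell \<Rightarrow> cell \<Rightarrow> bool) \<Rightarrow> bool" where
  "cocycle X f \<longleftrightarrow> (\<forall>p\<in>X. \<forall>q\<in>X. f p q = f q p) \<and>
    (\<forall>p\<in>X. \<forall>q\<in>X. \<forall>r\<in>X. adjacent p q \<and> adjacent q r \<and> adjacent p r \<longrightarrow> f p r = (f p q \<noteq> f q r))"

definition acyclic_cells :: "cell set \<Rightarrow> bool" where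
  "acyclic_cells X \<longleftrightarrow>
    (\<forall>f. cocycle X f \<longrightarrow> (\<exists>\<phi> :: cell \<Rightarrow> bool. \<forall>p\<in>X. \<forall>q\<in>X. adjacent p q \<longrightarrow> f p q = (\<phi> p \<noteq> \<phi> q)))"

lemma cocycleD:
  assumes "cocycle X f"
  shows "p \<in> X \<Longrightarrow> q \<in> X \<Longrightarrow> f p q = f q p"
    "p \<in> X \<Longrightarrow> q \<in> X \<Longrightarrow> r \<in> X \<Longrightarrow> adjacent p q \<Longrightarrow> adjacent q r \<Longrightarrow> adjacent p r \<Longrightarrow> f p r = (f p q \<noteq> f q r)"
  using assms unfolding cocycle_def by blast+

lemma acyclic_cellsD:
  assumes "acyclic_cells X" "cocycle X f"
  shows "\<exists>\<phi> :: cell \<Rightarrow> bool. \<forall>p\<in>X. \<forall>q\<in>X. adjacent p q \<longrightarrow> f p q = (\<phi> p \<noteq> \<phi> q)"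
  by (rule assms(1)[unfolded acyclic_cells_def, rule_format, OF assms(2)])

lemma acyclic_cells_image:
  assumes "acyclic_cells X" "lattice_iso h"
  shows "acyclic_cells (h ` X)"
  unfolding acyclic_cells_def
proof (intro allI impI)
  note h = lattice_isoD[OF assms(2)]
  fix f assume f: "cocycle (h ` X) f"
  have f': "cocycle X (\<lambda>p q. f (h p) (h q))"
    unfolding cocycle_def
  proof (intro conjI ballI impI; (elim conjE)?)
    fix p q assume "p \<in> X" "q \<in> X"
    then show "f (h p) (h q) = f (h q) (h p)" by (intro cocycleD(1)[OF f] imageI)
  next
    fix p q r assume "p \<in> X" "q \<in> X" "r \<in> X" "adjacent p q" "adjacent q r" "adjacent p r"
    then show "f (h p) (h r) = (f (h p) (h q) \<noteq> f (h q) (h r))"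
      by (intro cocycleD(2)[OF f] imageI) (simp_all add: h(4))
  qed
  obtain \<phi> :: "cell \<Rightarrow> bool" where "\<forall>p\<in>X. \<forall>q\<in>X. adjacent p q \<longrightarrow> f (h p) (h q) = (\<phi> p \<noteq> \<phi> q)"
    using acyclic_cellsD[OF assms(1) f'] ..
  then show "\<exists>\<phi> :: cell \<Rightarrow> bool. \<forall>p\<in>h ` X. \<forall>q\<in>h ` X. adjacent p q \<longrightarrow> f p q = (\<phi> p \<noteq> \<phi> q)"
    using h(1,4) by (intro exI[of _ "\<lambda>p. \<phi> (inv h p)"]) simp
qed

text \<open>As the neighbour (1, 0) is missing, the link of (0, 0) lies on a path of five cells,
  where every cocycle has a primitive. Using this primitive as the values on the edges at (0, 0)
  extends the cocycle to \<open>X\<close>.\<close>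

lemma acyclic_cells_remove_standard:
  assumes X: "acyclic_cells X" "(1, 0) \<notin> X"
  shows "acyclic_cells (X - {(0, 0)})"
  unfolding acyclic_cells_def
proof (intro allI impI)
  fix f assume f: "cocycle (X - {(0, 0)}) f"
  let ?n1 = "(0, 1) :: cell" and ?n2 = "(-1, 1) :: cell" and ?n3 = "(-1, 0) :: cell"
    and ?n4 = "(0, -1) :: cell" and ?n5 = "(1, -1) :: cell"
  \<comment> \<open>\<open>g\<close> sums \<open>f\<close> along the path. Some of these cells may
    be missing from \<open>X\<close>, but only differences between consecutive present cells are
    used, and these do not depend on the terms before.\<close>
  define g where "g = (\<lambda>p. if p = ?n2 then f ?n1 ?n2
    else if p = ?n3 then (f ?n1 ?n2 \<noteq> f ?n2 ?n3)
    else if p = ?n4 then ((f ?n1 ?n2 \<noteq> f ?n2 ?n3) \<noteq> f ?n3 ?n4)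
    else if p = ?n5 then (((f ?n1 ?n2 \<noteq> f ?n2 ?n3) \<noteq> f ?n3 ?n4) \<noteq> f ?n4 ?n5) else False)"
  have near: "p \<in> {?n1, ?n2, ?n3, ?n4, ?n5}" if "p \<in> X" "adjacent (0, 0) p" for p
    using adjacent_cases[OF that(2)] that(1) X(2) by auto
  have g: "f p q = (g p \<noteq> g q)"
    if "p \<in> X - {(0, 0)}" "q \<in> X - {(0, 0)}" "adjacent (0, 0) p" "adjacent (0, 0) q" "adjacent p q" for p q
  proof -
    have "f p q = f q p" using cocycleD(1)[OF f] that by blast
    moreover have "p \<in> {?n1, ?n2, ?n3, ?n4, ?n5}" "q \<in> {?n1, ?n2, ?n3, ?n4, ?n5}" using near that by blast+
    ultimately show ?thesis using that(5)
      by (elim insertE emptyE; hypsubst_thin; simp add: adjacent_plus hex_directions_def g_def; blast)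
  qed
  define f' where "f' = (\<lambda>p q. if p = (0, 0) then g q else if q = (0, 0) then g p else f p q)"
  have c': "cocycle X f'" unfolding cocycle_def
  proof (intro conjI ballI impI; (elim conjE)?)
    fix p q assume "p \<in> X" "q \<in> X"
    then show "f' p q = f' q p" using cocycleD(1)[OF f, of p q] by (auto simp: f'_def)
  next
    fix p q r assume pqr: "p \<in> X" "q \<in> X" "r \<in> X" "adjacent p q" "adjacent q r" "adjacent p r"
    note ne = pqr(4-6)[THEN adjacent_neq]
    note s = pqr(4-6)[THEN adjacent_sym]
    consider "p = (0, 0)" | "q = (0, 0)" | "r = (0, 0)" | "p \<noteq> (0, 0)" "q \<noteq> (0, 0)" "r \<noteq> (0, 0)" by blast
    then show "f' p r = (f' p q \<noteq> f' q r)"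
    proof cases
      case 1 then show ?thesis using g[of q r] pqr ne by (auto simp: f'_def)
    next
      case 2 then show ?thesis using g[of p r] pqr ne s by (auto simp: f'_def)
    next
      case 3 then show ?thesis using g[of p q] pqr ne s by (auto simp: f'_def)
    next
      case 4 then show ?thesis using cocycleD(2)[OF f, of p q r] pqr by (simp add: f'_def)
    qed
  qed
  obtain \<phi> :: "cell \<Rightarrow> bool" where \<phi>: "\<forall>p\<in>X. \<forall>q\<in>X. adjacent p q \<longrightarrow> f' p q = (\<phi> p \<noteq> \<phi> q)"
    using acyclic_cellsD[OF X(1) c'] ..
  show "\<exists>\<phi> :: cell \<Rightarrow> bool. \<forall>p\<in>X - {(0, 0)}. \<forall>q\<in>X - {(0, 0)}. adjacent p q \<longrightarrow> f p q = (\<phi> p \<noteq> \<phi> q)"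
  proof (intro exI[of _ \<phi>] ballI impI)
    fix p q assume "p \<in> X - {(0, 0)}" "q \<in> X - {(0, 0)}" "adjacent p q"
    with \<phi>[rule_format, of p q] show "f p q = (\<phi> p \<noteq> \<phi> q)" by (simp add: f'_def)
  qed
qed

lemma acyclic_cells_remove:
  assumes X: "acyclic_cells X" "s \<notin> X" "adjacent r s"
  shows "acyclic_cells (X - {r})"
proof -
  define u where "u = s - r"
  define h :: "cell \<Rightarrow> cell" where
    "h = (\<lambda>(i, j). (fst r + i * fst u + j * fst (rot60 u), snd r + i * snd u + j * snd (rot60 u)))"
  have h: "lattice_iso h" unfolding h_def
    by (rule lattice_iso_affine) (use X(3) in \<open>auto simp: u_def adjacent_def\<close>)
  have val: "h (0, 0) = r" "h (1, 0) = s" by (simp_all add: h_def u_def prod_eq_iff)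
  have inv: "inv h r = (0, 0)" "inv h s = (1, 0)" using val lattice_isoD(1)[OF h] by (metis inv_f_f)+
  note g = lattice_iso_inv[OF h]
  have "(1, 0) \<notin> inv h ` X" using X(2) inv(2) lattice_isoD(1)[OF g] by (metis inj_image_mem_iff)
  from acyclic_cells_remove_standard[OF acyclic_cells_image[OF X(1) g] this]
  have "acyclic_cells (h ` (inv h ` X - {(0, 0)}))" using acyclic_cells_image h by blast
  moreover have "h ` (inv h ` X - {(0, 0)}) = X - {r}"
    using val(1) lattice_isoD(1,2)[OF h] by (simp add: image_set_diff image_image surj_f_inv_f)
  ultimately show ?thesis by simp
qed

text \<open>The primitive sums \<open>f\<close> along the bottom row and then up the column.
  Vertical edges are right by construction, diagonal ones follow from one triangle, and horizontal
  ones by induction on the row through the two triangles of a rhombus.\<close>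

lemma acyclic_cells_box:
  "acyclic_cells {p. \<bar>fst p\<bar> \<le> int N \<and> \<bar>snd p\<bar> \<le> int N}" (is "acyclic_cells ?R")
  unfolding acyclic_cells_def
proof (intro allI impI)
  fix f assume f: "cocycle ?R f"
  define p :: "nat \<Rightarrow> nat \<Rightarrow> cell" where "p = (\<lambda>i j. (int i - int N, int j - int N))"
  define H where "H = rec_nat False (\<lambda>i b. b \<noteq> f (p i 0) (p (Suc i) 0))"
  define V where "V = (\<lambda>i. rec_nat (H i) (\<lambda>j b. b \<noteq> f (p i j) (p i (Suc j))))"
  have H: "H (Suc i) = (H i \<noteq> f (p i 0) (p (Suc i) 0))" for i by (simp add: H_def)
  have V: "V i 0 = H i" "V i (Suc j) = (V i j \<noteq> f (p i j) (p i (Suc j)))" for i j by (simp_all add: V_def)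
  have R: "p i j \<in> ?R \<longleftrightarrow> i \<le> 2 * N \<and> j \<le> 2 * N" for i j by (auto simp: p_def)
  have adj: "adjacent (p i j) (p (Suc i) j)" "adjacent (p i j) (p i (Suc j))" "adjacent (p (Suc i) j) (p i (Suc j))" for i j
    by (simp_all add: p_def adjacent_plus hex_directions_def)
  have diag: "f (p (Suc i) j) (p i (Suc j)) = (f (p i j) (p (Suc i) j) \<noteq> f (p i j) (p i (Suc j)))"
    if "Suc i \<le> 2 * N" "Suc j \<le> 2 * N" for i j
  proof -
    have "f (p (Suc i) j) (p i (Suc j)) = (f (p (Suc i) j) (p i j) \<noteq> f (p i j) (p i (Suc j)))"
      by (rule cocycleD(2)[OF f]) (use that R adj adjacent_sym in auto)
    moreover have "f (p (Suc i) j) (p i j) = f (p i j) (p (Suc i) j)" by (rule cocycleD(1)[OF f]) (use that R in auto)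
    ultimately show ?thesis by simp
  qed
  have hor: "f (p i j) (p (Suc i) j) = (V i j \<noteq> V (Suc i) j)" if "Suc i \<le> 2 * N" "j \<le> 2 * N" for i j
    using that(2)
  proof (induction j)
    case 0
    then show ?case by (auto simp: V H)
  next
    case (Suc j)
    have "f (p i (Suc j)) (p (Suc i) (Suc j)) = (f (p i (Suc j)) (p (Suc i) j) \<noteq> f (p (Suc i) j) (p (Suc i) (Suc j)))"
      by (rule cocycleD(2)[OF f]) (use that Suc.prems R adj adjacent_sym in auto)
    moreover have "f (p i (Suc j)) (p (Suc i) j) = f (p (Suc i) j) (p i (Suc j))"
      by (rule cocycleD(1)[OF f]) (use that Suc.prems R in auto)
    ultimately show ?case using diag[OF that(1) Suc.prems] Suc by (auto simp: V)
  qed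
  define \<phi> where "\<phi> = (\<lambda>c :: cell. V (nat (fst c + int N)) (nat (snd c + int N)))"
  have \<phi>: "\<phi> (p i j) = V i j" for i j by (simp add: \<phi>_def p_def)
  have main: "f a b = (\<phi> a \<noteq> \<phi> b)" if "a \<in> ?R" "b \<in> ?R" "b - a \<in> {(1, 0), (0, 1), (-1, 1)}" for a b
  proof -
    define i j k l where "i = nat (fst a + int N)" and "j = nat (snd a + int N)"
      and "k = nat (fst b + int N)" and "l = nat (snd b + int N)"
    have ab: "a = p i j" "b = p k l" using that by (auto simp: p_def i_def j_def k_def l_def prod_eq_iff)
    have "(k = Suc i \<and> l = j) \<or> (k = i \<and> l = Suc j) \<or> (i = Suc k \<and> l = Suc j)"
      using that(3) unfolding ab p_def by auto
    then show ?thesis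
    proof (elim disjE conjE)
      assume "k = Suc i" "l = j"
      then show ?thesis using hor[of i j] that(1,2) unfolding ab R \<phi> by auto
    next
      assume "k = i" "l = Suc j"
      then show ?thesis unfolding ab \<phi> by (simp add: V) blast
    next
      assume "i = Suc k" "l = Suc j"
      then show ?thesis using hor[of k j] diag[of k j] that(1,2) unfolding ab R \<phi> by (auto simp: V)
    qed
  qed
  have "f a b = (\<phi> a \<noteq> \<phi> b)" if "a \<in> ?R" "b \<in> ?R" "adjacent a b" for a b :: cell
  proof -
    have "b - a \<in> {(1, 0), (0, 1), (-1, 1)} \<or> a - b \<in> {(1, 0), (0, 1), (-1, 1)}"
    proof -
      have "a - b = - (b - a)" by simp
      moreover have "b - a \<in> hex_directions" using that(3) by (simp add: adjacent_def)
      ultimately show ?thesis unfolding hex_directions_def by (elim insertE emptyE) simp_all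
    qed
    moreover have "f a b = f b a" using cocycleD(1)[OF f that(1,2)] .
    ultimately show ?thesis using main[of a b] main[of b a] that(1,2) by blast
  qed
  then show "\<exists>\<phi> :: cell \<Rightarrow> bool. \<forall>a\<in>?R. \<forall>b\<in>?R. adjacent a b \<longrightarrow> f a b = (\<phi> a \<noteq> \<phi> b)"
    by (intro exI[of _ \<phi>] ballI impI) simp
qed

text \<open>Cells are removed from a large box one at a time. Some cell of \<open>X - B\<close> has
  a neighbour outside \<open>X\<close>, as the removal needs: otherwise \<open>X - B\<close> would
  be closed under adjacency outside \<open>B\<close>, hence equal to \<open>- B\<close>, and
  \<open>X\<close> would be infinite.\<close>

lemma acyclic_cells_hole_free:
  assumes "hole_free B" "finite B"
  shows "acyclic_cells B"
proof -
  have "acyclic_cells X \<Longrightarrow> finite X \<Longrightarrow> B \<subseteq> X \<Longrightarrow> acyclic_cells B" for X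
  proof (induction "card (X - B)" arbitrary: X rule: less_induct)
    case less
    show ?case
    proof (cases "X = B")
      case False
      have "\<exists>r\<in>X - B. \<exists>s. s \<notin> X \<and> adjacent r s"
      proof (rule ccontr)
        assume "\<not> ?thesis"
        then have "X - B = - B" using less.prems False by (intro hole_free_outside[OF assms(1)]) auto
        then have "UNIV = X" using less.prems(3) by blast
        then show False using less.prems(2) by (metis finite_prod infinite_UNIV_int)
      qed
      then obtain r s where rs: "r \<in> X - B" "s \<notin> X" "adjacent r s" by blast
      have "card (X - {r} - B) < card (X - B)"
        using rs less.prems(2) by (intro psubset_card_mono) auto
      from less.hyps[OF this acyclic_cells_remove[OF less.prems(1) rs(2,3)]] less.prems(2,3) rs(1)
      show ?thesis by blast
    qed (use less.prems in simp)
  qed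
  moreover obtain N where "\<forall>p\<in>B. \<bar>fst p\<bar> \<le> int N \<and> \<bar>snd p\<bar> \<le> int N"
  proof -
    define M where "M = Max (insert 0 ((\<lambda>p. \<bar>fst p\<bar>) ` B \<union> (\<lambda>p. \<bar>snd p\<bar>) ` B))"
    have "\<forall>p\<in>B. \<bar>fst p\<bar> \<le> M \<and> \<bar>snd p\<bar> \<le> M" "0 \<le> M"
      using assms(2) by (auto simp: M_def intro!: Max_ge)
    then show ?thesis using that[of "nat M"] by auto
  qed
  moreover have "finite {p :: cell. \<bar>fst p\<bar> \<le> int N \<and> \<bar>snd p\<bar> \<le> int N}" for N
    by (rule finite_subset[of _ "{- int N..int N} \<times> {- int N..int N}"]) (auto simp: abs_le_iff)
  ultimately show ?thesis using acyclic_cells_box by blast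
qed

section \<open>Connectivity of the board and of its links\<close>

lemma cut_connected_if_graph_connected:
  assumes "graph_connected B adjacent"
  shows "cut_connected B"
  unfolding cut_connected_def
proof (intro allI impI; elim conjE)
  fix A assume A: "A \<subseteq> B" "A \<noteq> {}" "A \<noteq> B"
  then obtain u v where uv: "u \<in> A" "v \<in> B - A" by blast
  have "(\<lambda>x y. x \<in> B \<and> y \<in> B \<and> adjacent x y)\<^sup>*\<^sup>* u v"
    using assms uv A(1) unfolding graph_connected_def by blast
  then show "\<exists>u\<in>A. \<exists>v\<in>B - A. adjacent u v"
    using uv
  proof (induction rule: converse_rtranclp_induct)
    case (step x y)
    then show ?case by (cases "y \<in> A") blast+
  qed blast
qed

text \<open>If no edge joins \<open>A\<close> to the rest of the link, the edges from
  \<open>c\<close> to \<open>A\<close> form a cocycle, because a triangle at \<open>c\<close>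
  contains two of them or none. Its primitive is constant along paths that avoid \<open>c\<close>,
  so it agrees on \<open>A\<close> and on the rest of the link; the edges from \<open>c\<close> to
  these two parts say the opposite.\<close>

lemma cut_connected_link:
  assumes "acyclic_cells B" "c \<in> B" "graph_connected (B - {c}) adjacent"
  shows "cut_connected (link B c)"
  unfolding cut_connected_def
proof (intro allI impI; elim conjE; rule ccontr)
  fix A assume A: "A \<subseteq> link B c" "A \<noteq> {}" "A \<noteq> link B c"
    and no: "\<not> (\<exists>u\<in>A. \<exists>v\<in>link B c - A. adjacent u v)"
  define f where "f = (\<lambda>p q. p = c \<and> q \<in> A \<or> q = c \<and> p \<in> A)"
  have cA: "c \<notin> A" using A(1) by (auto simp: link_def)
  have same: "u \<in> A \<longleftrightarrow> v \<in> A" if "u \<in> link B c" "v \<in> link B c" "adjacent u v" for u v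
    using no that adjacent_sym by blast
  have c': "cocycle B f" unfolding cocycle_def
  proof (intro conjI ballI impI; (elim conjE)?)
    fix p q r assume pqr: "p \<in> B" "q \<in> B" "r \<in> B" "adjacent p q" "adjacent q r" "adjacent p r"
    note ne = pqr(4-6)[THEN adjacent_neq]
    note s = pqr(4-6)[THEN adjacent_sym]
    consider "p = c" | "q = c" | "r = c" | "p \<noteq> c" "q \<noteq> c" "r \<noteq> c" by blast
    then show "f p r = (f p q \<noteq> f q r)"
    proof cases
      case 1 then show ?thesis using same[of q r] pqr ne cA by (auto simp: f_def link_def)
    next
      case 2 then show ?thesis using same[of p r] pqr ne s cA by (auto simp: f_def link_def)
    next
      case 3 then show ?thesis using same[of p q] pqr ne s cA by (auto simp: f_def link_def)
    qed (simp add: f_def)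
  qed (auto simp: f_def)
  obtain \<phi> :: "cell \<Rightarrow> bool" where "\<forall>p\<in>B. \<forall>q\<in>B. adjacent p q \<longrightarrow> f p q = (\<phi> p \<noteq> \<phi> q)"
    using acyclic_cellsD[OF assms(1) c'] ..
  then have \<phi>: "f p q = (\<phi> p \<noteq> \<phi> q)" if "p \<in> B" "q \<in> B" "adjacent p q" for p q using that by blast
  obtain a b where ab: "a \<in> A" "b \<in> link B c - A" using A by blast
  have abB: "a \<in> B" "b \<in> B" "adjacent c a" "adjacent c b" using ab A(1) by (auto simp: link_def)
  then have "a \<in> B - {c}" "b \<in> B - {c}" by auto
  then have "(\<lambda>x y. x \<in> B - {c} \<and> y \<in> B - {c} \<and> adjacent x y)\<^sup>*\<^sup>* a b"
    using assms(3) unfolding graph_connected_def by blast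
  then have "\<phi> a = \<phi> b"
  proof (induction rule: rtranclp_induct)
    case (step x y)
    then have "f x y = (\<phi> x \<noteq> \<phi> y)" "\<not> f x y" using \<phi>[of x y] by (auto simp: f_def)
    then show ?case using step.IH by simp
  qed simp
  moreover have "f c a" "\<not> f c b" using ab cA by (auto simp: f_def)
  ultimately show False using \<phi>[of c a] \<phi>[of c b] abB assms(2) by simp
qed

theorem theorem3:
  shows "\<exists>f :: nat \<Rightarrow> nat.
    (\<lambda>n. real (f n)) \<in> O(\<lambda>n. real n ^ 3) \<and>
    (\<forall>n B. \<forall>C C' :: 'l configuration.
       proper_board n B \<and> is_configuration n B C \<and> is_configuration n B C' \<and> gourds C = gourds C' \<longrightarrow>
       (\<exists>k \<le> f n. (move B ^^ k) C C'))"
proof (intro exI[of _ "\<lambda>n. 100 * n ^ 3"] conjI allI impI; (elim conjE)?)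
  show "(\<lambda>n. real (100 * n ^ 3)) \<in> O(\<lambda>n. real n ^ 3)" by simp
next
  fix n B and C C' :: "'l configuration"
  assume B: "proper_board n B" and C: "is_configuration n B C" "is_configuration n B C'" "gourds C = gourds C'"
  have fin: "finite B" and card: "card B = 2 * n + 1" "card B > 2" and hf: "hole_free B"
    and con: "graph_connected B adjacent" "\<And>c. c \<in> B \<Longrightarrow> graph_connected (B - {c}) adjacent"
    and star: "\<And>c. B \<noteq> star_of_david c"
    using B by (auto simp: proper_board_def board_def two_connected_def)
  from spanning_polygon[OF fin card(2) cut_connected_if_graph_connected[OF con(1)]
      cut_connected_link[OF acyclic_cells_hole_free[OF hf fin] _ con(2)] star]
  obtain T where "polygon B T" by blast
  then obtain vs where vs: "gadget_cycle vs" "set vs = B" by (rule polygon_gadget_cycle)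
  have "n \<ge> 1" using card by simp
  from reach_gadget_cycle[OF vs card(1) this C]
  show "\<exists>k\<le>100 * n ^ 3. (move B ^^ k) C C'" unfolding reach_def .
qed

end
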